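(* For $n\ge 1$ let $$M(n)=\max\Big\{\prod_{p,p'\in\mathcal P}\gcd(p-1,p'-1)\ :\ \mathcal P \text{ a set of distinct primes with } \prod_{p\in\mathcal P}p\le n\Big\},$$ where the product runs over all ordered pairs $(p,p')\in\mathcal P\times\mathcal P$. Then $\lim_{n\to\infty}\frac{\log M(n)}{\lambda(n)}=\frac14$, where $\lambda(n)=\frac{(\log n)^2}{\log\log n}$. *)

theory Defs
  imports "HOL-Analysis.Analysis" "HOL-Computational_Algebra.Primes"
begin

definition admissible :: "nat \<Rightarrow> nat set \<Rightarrow> bool" where
  "admissible n P \<longleftrightarrow> finite P \<and> (\<forall>p\<in>P. prime p) \<and> \<Prod>P \<le> n"

definition gcd_pair_prod :: "nat set \<Rightarrow> nat" where
  "gcd_pair_prod P = (\<Prod>(p, p')\<in>P \<times> P. gcd (p - 1) (p' - 1))"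

definition M :: "nat \<Rightarrow> nat" where
  "M n = Max {gcd_pair_prod P | P. admissible n P}"

definition lambda_fn :: "nat \<Rightarrow> real" where
  "lambda_fn n = (ln (real n))^2 / ln (ln (real n))"

end

theory Submission
  imports Defs "HOL-Number_Theory.Number_Theory" "HOL-Computational_Algebra.Squarefree"
    "HOL-Real_Asymp.Real_Asymp"
begin

text \<open>
  Write \<open>L = ln n\<close>.

  Upper bound. Primes exceeding a fixed power of \<open>L\<close> contribute little because there are few of
  them. For the remaining pairs the divisor bound shows that, with rare exceptions,
  \<open>ln gcd \<le> min (ln p) (ln p') - c\<close> with \<open>c\<close> close to \<open>ln L\<close>, and \<open>w - c \<le> w\<^sup>2 / (4 * c)\<close>; the
  right-hand side factors over \<open>p\<close> and \<open>p'\<close>, and the sum of \<open>ln p\<close> is at most \<open>L\<close>.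

  Lower bound. Equality forces \<open>p\<close> of size \<open>L\<^sup>2\<close> and a common modulus \<open>q\<close> of size \<open>L\<close>, so one needs a
  prime \<open>q\<close> near \<open>D\<close> with at least \<open>D\<close> primes \<open>p = 1 (mod q)\<close> below \<open>D powr (2 + \<epsilon>)\<close>. Such a \<open>q\<close> exists on
  average over prime moduli: Vaughan's identity reduces the count to trivial type I sums and to type II
  sums. For prime \<open>q\<close> the condition \<open>m * n = 1 (mod q)\<close> pairs the residue class of \<open>m\<close> with its inverse,
  so Cauchy-Schwarz and the arithmetic large sieve bound the type II sums without any use of
  characters, and no Siegel-Walfisz theorem is needed as all moduli are prime and large.
\<close>

section \<open>The large sieve inequality\<close>

text \<open>Moduli of size \<open>L\<close> for primes of size \<open>L\<^sup>2\<close> lie exactly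
  at the square-root barrier: up to logarithms the type II bound is \<open>sqrt x * D\<close>, and
  it reaches the main term \<open>x\<close> at \<open>x = D\<^sup>2\<close>. A spare power is
  therefore built in by taking integers \<open>t\<close> with \<open>D = t ^ k\<close> and
  \<open>x = t ^ (2 * k + 1)\<close>. The type II bound is then smaller than the main term by
  \<open>sqrt t\<close>, which pays for all logarithms and for a divisor factor
  \<open>t powr (1 / 8)\<close>, and the loss \<open>1 / k\<close> in the exponent disappears as
  \<open>k\<close> grows. Only one good modulus is wanted, so the deviations from equidistribution
  are added over \<open>q\<close> with their signs, without absolute values. If every prime
  \<open>q\<close> near \<open>D\<close> had too few primes, this sum would be more negative than
  Vaughan's identity allows. The number of primes expected, \<open>t ^ (k + 1)\<close> up to
  logarithms, exceeds the number wanted by nearly a factor \<open>t\<close>; hence crude Chebyshev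
  constants suffice.\<close>

definition expo :: "nat \<Rightarrow> real \<Rightarrow> complex" where
  "expo m \<theta> = cis (2 * pi * \<theta> * real m)"

definition dirichlet_sum :: "nat \<Rightarrow> real \<Rightarrow> complex" where
  "dirichlet_sum n \<theta> = (\<Sum>j<n. expo j \<theta>)"

lemma expo_power: "expo m \<theta> = cis (2 * pi * \<theta>) ^ m"
  by (simp add: expo_def Complex.DeMoivre mult_ac)

lemma expo_diff: "expo m (\<theta> - \<phi>) = expo m \<theta> * cnj (expo m \<phi>)"
  by (simp add: expo_def cis_cnj cis_mult algebra_simps)

lemma dirichlet_sum_0 [simp]: "dirichlet_sum n 0 = of_nat n"
  by (simp add: dirichlet_sum_def expo_def)

lemma norm_dirichlet_sum_commute: "norm (dirichlet_sum n (\<theta> - \<phi>)) = norm (dirichlet_sum n (\<phi> - \<theta>))"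
proof -
  have "dirichlet_sum n (\<theta> - \<phi>) = cnj (dirichlet_sum n (\<phi> - \<theta>))"
    by (simp add: dirichlet_sum_def expo_def cis_cnj algebra_simps)
  then show ?thesis by simp
qed

lemma norm_dirichlet_sum_le:
  assumes "sin (pi * \<theta>) \<noteq> 0"
  shows "(norm (dirichlet_sum n \<theta>))\<^sup>2 \<le> 1 / (sin (pi * \<theta>))\<^sup>2"
proof -
  define z where "z = cis (2 * pi * \<theta>)"
  have s: "(norm (z - 1))\<^sup>2 = 4 * (sin (pi * \<theta>))\<^sup>2"
  proof -
    have "(norm (z - 1))\<^sup>2 = (cos (2 * (pi * \<theta>)) - 1)\<^sup>2 + (sin (2 * (pi * \<theta>)))\<^sup>2"
      unfolding z_def cmod_power2 by (simp add: mult.assoc)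
    also have "\<dots> = 2 - 2 * cos (2 * (pi * \<theta>))"
      using sin_cos_squared_add[of "2 * (pi * \<theta>)"] by (simp add: power2_diff)
    also have "\<dots> = 4 * (sin (pi * \<theta>))\<^sup>2"
      by (subst cos_double_sin) simp
    finally show ?thesis .
  qed
  have "(z - 1) * dirichlet_sum n \<theta> = z ^ n - 1"
    by (simp add: dirichlet_sum_def expo_power z_def power_diff_1_eq)
  then have "(norm (z - 1))\<^sup>2 * (norm (dirichlet_sum n \<theta>))\<^sup>2 = (norm (z ^ n - 1))\<^sup>2"
    by (metis norm_mult power_mult_distrib)
  also have "norm (z ^ n - 1) \<le> 2"
    using norm_triangle_ineq4[of "z ^ n" 1] by (simp add: z_def norm_power)
  then have "(norm (z ^ n - 1))\<^sup>2 \<le> 2\<^sup>2" by (intro power_mono) auto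
  finally have "4 * ((sin (pi * \<theta>))\<^sup>2 * (norm (dirichlet_sum n \<theta>))\<^sup>2) \<le> 4" by (simp add: s)
  then show ?thesis using assms by (simp add: field_simps)
qed

lemma sin_ge_chord:
  assumes "0 \<le> x" "x \<le> pi / 2"
  shows "2 / pi * x \<le> sin x"
proof -
  have "convex_on {0..pi} (\<lambda>x. - sin x)"
    by (rule f''_ge0_imp_convex[where f' = "\<lambda>x. - cos x" and f'' = "\<lambda>x. sin x"])
       (auto intro!: derivative_eq_intros sin_ge_zero)
  from convex_onD[OF this, of "2 / pi * x" 0 "pi / 2"] show ?thesis
    using assms by (simp add: field_simps)
qed

text \<open>The right-hand side keeps both ends of the unit interval, so that a sum over spaced
  points splits into two sums of inverse squares without deciding which integer is nearer.
  Reflection to \<open>1 - t\<close> leaves only \<open>t \<le> 1/2\<close>, where the chord bound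
  applies.\<close>

lemma inverse_sin_square_le:
  assumes "0 < t" "t < 1"
  shows "1 / (sin (pi * t))\<^sup>2 \<le> (1 / t\<^sup>2 + 1 / (1 - t)\<^sup>2) / 4"
proof -
  have *: "1 / (sin (pi * t))\<^sup>2 \<le> 1 / (4 * t\<^sup>2)" if "0 < t" "t \<le> 1/2" for t :: real
  proof -
    have "2 * t \<le> sin (pi * t)" using sin_ge_chord[of "pi * t"] that by (simp add: field_simps)
    then have "(2 * t)\<^sup>2 \<le> (sin (pi * t))\<^sup>2" using that by (intro power_mono) auto
    then show ?thesis using that by (intro divide_left_mono) (auto intro!: mult_pos_pos)
  qed
  show ?thesis
  proof (cases "t \<le> 1/2")
    case True
    have "1 / (4 * t\<^sup>2) \<le> (1 / t\<^sup>2 + 1 / (1 - t)\<^sup>2) / 4" by (simp add: add_divide_distrib mult.commute)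
    with *[of t] True assms show ?thesis by linarith
  next
    case False
    have "sin (pi * (1 - t)) = sin (pi * t)" by (simp add: right_diff_distrib)
    with *[of "1 - t"] False assms have "1 / (sin (pi * t))\<^sup>2 \<le> 1 / (4 * (1 - t)\<^sup>2)" by simp
    moreover have "1 / (4 * (1 - t)\<^sup>2) \<le> (1 / t\<^sup>2 + 1 / (1 - t)\<^sup>2) / 4" by (simp add: add_divide_distrib mult.commute)
    ultimately show ?thesis by linarith
  qed
qed

lemma sum_inverse_squares_le: "(\<Sum>j=1..n. 1 / (real j)\<^sup>2) \<le> 2"
proof -
  \<comment> \<open>The subtracted term makes the induction close:
    \<open>1 / (n + 1)\<^sup>2\<close> is at most the telescoping difference
    \<open>1 / n - 1 / (n + 1)\<close>.\<close>
  have "(\<Sum>j=1..Suc n. 1 / (real j)\<^sup>2) \<le> 2 - 1 / real (Suc n)" for n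
  proof (induction n)
    case (Suc n)
    have "1 / (real (Suc (Suc n)))\<^sup>2 \<le> 1 / real (Suc n) - 1 / real (Suc (Suc n))"
    proof -
      have "1 / (real (Suc (Suc n)))\<^sup>2 \<le> 1 / (real (Suc n) * real (Suc (Suc n)))"
        unfolding power2_eq_square by (intro frac_le mult_mono) auto
      also have "\<dots> = 1 / real (Suc n) - 1 / real (Suc (Suc n))" by (simp add: field_simps)
      finally show ?thesis .
    qed
    with Suc show ?case by simp
  qed simp
  then have "(\<Sum>j=1..Suc n. 1 / (real j)\<^sup>2) \<le> 2" by (rule order_trans) simp
  then show ?thesis by (rule order_trans[rotated]) (intro sum_mono2, auto)
qed

text \<open>Points at mutual distance at least \<delta> have distinct floors of
  \<open>t / \<delta>\<close>, all at least 1, so the summands are dominated by different terms of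
  the series over \<open>1 / j\<^sup>2\<close>.\<close>

lemma sum_inverse_squares_spaced:
  fixes \<delta> :: real
  assumes "finite T" "\<delta> > 0" and ge: "\<And>t. t \<in> T \<Longrightarrow> \<delta> \<le> t"
    and sp: "\<And>s t. s \<in> T \<Longrightarrow> t \<in> T \<Longrightarrow> s \<noteq> t \<Longrightarrow> \<delta> \<le> \<bar>s - t\<bar>"
  shows "(\<Sum>t\<in>T. 1 / t\<^sup>2) \<le> 2 / \<delta>\<^sup>2"
proof -
  define f where "f t = nat \<lfloor>t / \<delta>\<rfloor>" for t :: real
  have f: "1 \<le> f t" "real (f t) \<le> t / \<delta>" "t / \<delta> < real (f t) + 1" if "t \<in> T" for t
  proof -
    have "1 \<le> t / \<delta>" using ge[OF that] assms(2) by simp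
    then show "1 \<le> f t" "real (f t) \<le> t / \<delta>" "t / \<delta> < real (f t) + 1"
      unfolding f_def by (simp_all add: le_nat_iff le_floor_iff)
  qed
  have inj: "inj_on f T"
  proof (rule inj_onI, rule ccontr)
    fix s t assume *: "s \<in> T" "t \<in> T" "f s = f t" "s \<noteq> t"
    have "\<bar>s / \<delta> - t / \<delta>\<bar> < 1" using f(2,3)[OF *(1)] f(2,3)[OF *(2)] *(3) by linarith
    then have "\<bar>s - t\<bar> < \<delta>" using assms(2) by (simp add: diff_divide_distrib[symmetric] abs_divide)
    with sp[OF *(1,2,4)] show False by simp
  qed
  have "(\<Sum>t\<in>T. 1 / t\<^sup>2) \<le> (\<Sum>t\<in>T. (1 / \<delta>\<^sup>2) * (1 / (real (f t))\<^sup>2))"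
  proof (rule sum_mono)
    fix t assume t: "t \<in> T"
    have "real (f t) * \<delta> \<le> t" using f(2)[OF t] assms(2) by (simp add: field_simps)
    then have "(real (f t) * \<delta>)\<^sup>2 \<le> t\<^sup>2" using assms(2) by (intro power_mono) auto
    then have "1 / t\<^sup>2 \<le> 1 / (real (f t) * \<delta>)\<^sup>2"
      using f(1)[OF t] assms(2) by (intro divide_left_mono) (auto intro!: mult_pos_pos simp: ge[OF t] intro: less_le_trans[OF _ ge[OF t]])
    then show "1 / t\<^sup>2 \<le> (1 / \<delta>\<^sup>2) * (1 / (real (f t))\<^sup>2)" by (simp add: power_mult_distrib mult.commute)
  qed
  also have "\<dots> = (1 / \<delta>\<^sup>2) * (\<Sum>j\<in>f ` T. 1 / (real j)\<^sup>2)"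
    by (simp add: sum_distrib_left sum.reindex[OF inj])
  also have "(\<Sum>j\<in>f ` T. 1 / (real j)\<^sup>2) \<le> (\<Sum>j=1..Max (insert 0 (f ` T)). 1 / (real j)\<^sup>2)"
    using assms(1) f(1) by (intro sum_mono2) (auto intro!: Max_ge)
  also have "\<dots> \<le> 2" by (rule sum_inverse_squares_le)
  finally show ?thesis by (simp add: mult_left_mono divide_right_mono)
qed

text \<open>Keeping the points at distance \<delta> from 0 and 1 turns ordinary spacing into spacing
  on the circle: differences stay below \<open>1 - \<delta>\<close>. The diagonal gives the square
  of \<open>n\<close>; the points on either side of \<open>\<theta>\<close> cost
  \<open>1 / \<delta>\<^sup>2\<close> each.\<close>

lemma dirichlet_sum_spaced:
  fixes \<delta> :: real
  assumes "finite X" "\<delta> > 0" and range: "\<And>\<theta>. \<theta> \<in> X \<Longrightarrow> \<delta> \<le> \<theta> \<and> \<theta> \<le> 1 - \<delta>"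
    and sp: "\<And>\<theta> \<phi>. \<theta> \<in> X \<Longrightarrow> \<phi> \<in> X \<Longrightarrow> \<theta> \<noteq> \<phi> \<Longrightarrow> \<delta> \<le> \<bar>\<theta> - \<phi>\<bar>"
    and "\<theta> \<in> X"
  shows "(\<Sum>\<phi>\<in>X. (norm (dirichlet_sum n (\<theta> - \<phi>)))\<^sup>2) \<le> (real n)\<^sup>2 + 2 / \<delta>\<^sup>2"
proof -
  define X1 where "X1 = {\<phi> \<in> X. \<phi> > \<theta>}"
  define X2 where "X2 = {\<phi> \<in> X. \<phi> < \<theta>}"
  have X: "X = insert \<theta> (X1 \<union> X2)" "\<theta> \<notin> X1 \<union> X2" "X1 \<inter> X2 = {}" "finite X1" "finite X2"
    using assms(1,5) by (auto simp: X1_def X2_def)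
  have key: "(\<Sum>t\<in>T. 1 / (sin (pi * t))\<^sup>2) \<le> 1 / \<delta>\<^sup>2"
    if T: "finite T" "\<And>t. t \<in> T \<Longrightarrow> \<delta> \<le> t \<and> t \<le> 1 - \<delta>"
      "\<And>s t. s \<in> T \<Longrightarrow> t \<in> T \<Longrightarrow> s \<noteq> t \<Longrightarrow> \<delta> \<le> \<bar>s - t\<bar>" for T
  proof -
    have "(\<Sum>t\<in>T. 1 / (sin (pi * t))\<^sup>2) \<le> (\<Sum>t\<in>T. (1 / t\<^sup>2 + 1 / (1 - t)\<^sup>2) / 4)"
      by (intro sum_mono inverse_sin_square_le) (use T(2) assms(2) in force)+
    also have "\<dots> = ((\<Sum>t\<in>T. 1 / t\<^sup>2) + (\<Sum>t\<in>(\<lambda>t. 1 - t) ` T. 1 / t\<^sup>2)) / 4"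
      by (subst sum.reindex) (auto simp: inj_on_def sum.distrib sum_divide_distrib[symmetric])
    also have "(\<Sum>t\<in>T. 1 / t\<^sup>2) \<le> 2 / \<delta>\<^sup>2"
      by (rule sum_inverse_squares_spaced) (use T assms(2) in auto)
    also have "(\<Sum>t\<in>(\<lambda>t. 1 - t) ` T. 1 / t\<^sup>2) \<le> 2 / \<delta>\<^sup>2"
    proof (rule sum_inverse_squares_spaced)
      fix s t assume "s \<in> (\<lambda>t. 1 - t) ` T" "t \<in> (\<lambda>t. 1 - t) ` T" "s \<noteq> t"
      then obtain s' t' where "s' \<in> T" "t' \<in> T" "s = 1 - s'" "t = 1 - t'" "s' \<noteq> t'" by auto
      with T(3)[of t' s'] show "\<delta> \<le> \<bar>s - t\<bar>" by simp
    qed (use T(1,2) assms(2) in force)+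
    finally show ?thesis by simp
  qed
  have b: "(norm (dirichlet_sum n (\<theta> - \<phi>)))\<^sup>2 \<le> 1 / (sin (pi * t))\<^sup>2"
    if "t = \<bar>\<phi> - \<theta>\<bar>" "\<phi> \<in> X" "\<phi> \<noteq> \<theta>" for \<phi> t
  proof -
    have t: "0 < t" "t < 1" using that range[OF that(2)] range[OF assms(5)] assms(2) by auto
    have "sin (pi * t) > 0" using t by (intro sin_gt_zero) auto
    then have "(norm (dirichlet_sum n t))\<^sup>2 \<le> 1 / (sin (pi * t))\<^sup>2"
      by (intro norm_dirichlet_sum_le) auto
    moreover have "norm (dirichlet_sum n (\<theta> - \<phi>)) = norm (dirichlet_sum n t)"
      using norm_dirichlet_sum_commute[of n \<theta> \<phi>] that(1) by (auto simp: abs_if)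
    ultimately show ?thesis by simp
  qed
  have "(\<Sum>\<phi>\<in>X. (norm (dirichlet_sum n (\<theta> - \<phi>)))\<^sup>2) = (real n)\<^sup>2 +
     ((\<Sum>\<phi>\<in>X1. (norm (dirichlet_sum n (\<theta> - \<phi>)))\<^sup>2) + (\<Sum>\<phi>\<in>X2. (norm (dirichlet_sum n (\<theta> - \<phi>)))\<^sup>2))"
    using X by (subst X(1)) (simp add: sum.union_disjoint)
  also have "(\<Sum>\<phi>\<in>X1. (norm (dirichlet_sum n (\<theta> - \<phi>)))\<^sup>2) \<le> (\<Sum>t\<in>(\<lambda>\<phi>. \<phi> - \<theta>) ` X1. 1 / (sin (pi * t))\<^sup>2)"
    by (subst sum.reindex) (auto simp: inj_on_def X1_def intro!: sum_mono b)
  also have "\<dots> \<le> 1 / \<delta>\<^sup>2"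
  proof (rule key)
    fix t assume "t \<in> (\<lambda>\<phi>. \<phi> - \<theta>) ` X1"
    then obtain \<phi> where "\<phi> \<in> X" "\<phi> > \<theta>" "t = \<phi> - \<theta>" by (auto simp: X1_def)
    with sp[of \<phi> \<theta>] range[of \<phi>] range[of \<theta>] assms(2,5) show "\<delta> \<le> t \<and> t \<le> 1 - \<delta>" by auto
  next
    fix s t assume "s \<in> (\<lambda>\<phi>. \<phi> - \<theta>) ` X1" "t \<in> (\<lambda>\<phi>. \<phi> - \<theta>) ` X1" "s \<noteq> t"
    then obtain \<phi> \<psi> where "\<phi> \<in> X" "\<psi> \<in> X" "\<phi> \<noteq> \<psi>" "s = \<phi> - \<theta>" "t = \<psi> - \<theta>" by (auto simp: X1_def)
    with sp[of \<phi> \<psi>] show "\<delta> \<le> \<bar>s - t\<bar>" by simp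
  qed (use X(4) in simp)
  also have "(\<Sum>\<phi>\<in>X2. (norm (dirichlet_sum n (\<theta> - \<phi>)))\<^sup>2) \<le> (\<Sum>t\<in>(\<lambda>\<phi>. \<theta> - \<phi>) ` X2. 1 / (sin (pi * t))\<^sup>2)"
    by (subst sum.reindex) (auto simp: inj_on_def X2_def intro!: sum_mono b)
  also have "\<dots> \<le> 1 / \<delta>\<^sup>2"
  proof (rule key)
    fix t assume "t \<in> (\<lambda>\<phi>. \<theta> - \<phi>) ` X2"
    then obtain \<phi> where "\<phi> \<in> X" "\<phi> < \<theta>" "t = \<theta> - \<phi>" by (auto simp: X2_def)
    with sp[of \<theta> \<phi>] range[of \<phi>] range[of \<theta>] assms(2,5) show "\<delta> \<le> t \<and> t \<le> 1 - \<delta>" by auto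
  next
    fix s t assume "s \<in> (\<lambda>\<phi>. \<theta> - \<phi>) ` X2" "t \<in> (\<lambda>\<phi>. \<theta> - \<phi>) ` X2" "s \<noteq> t"
    then obtain \<phi> \<psi> where "\<phi> \<in> X" "\<psi> \<in> X" "\<phi> \<noteq> \<psi>" "s = \<theta> - \<phi>" "t = \<theta> - \<psi>" by (auto simp: X2_def)
    with sp[of \<psi> \<phi>] show "\<delta> \<le> \<bar>s - t\<bar>" by simp
  qed (use X(5) in simp)
  finally show ?thesis by simp
qed

text \<open>Fejer-type majorant: averaging over the differences \<open>j - l\<close> with \<open>j, l < 2 * K\<close> makes the
  off-diagonal kernel nonnegative with quadratic decay.\<close>

lemma large_sieve_dual:
  fixes \<delta> :: real and y :: "real \<Rightarrow> complex"
  assumes "finite X" "\<delta> > 0" and range: "\<And>\<theta>. \<theta> \<in> X \<Longrightarrow> \<delta> \<le> \<theta> \<and> \<theta> \<le> 1 - \<delta>"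
    and sp: "\<And>\<theta> \<phi>. \<theta> \<in> X \<Longrightarrow> \<phi> \<in> X \<Longrightarrow> \<theta> \<noteq> \<phi> \<Longrightarrow> \<delta> \<le> \<bar>\<theta> - \<phi>\<bar>"
    and "n \<le> K"
  shows "real K * (\<Sum>m<n. (norm (\<Sum>\<theta>\<in>X. y \<theta> * expo m \<theta>))\<^sup>2) \<le>
    (4 * (real K)\<^sup>2 + 2 / \<delta>\<^sup>2) * (\<Sum>\<theta>\<in>X. (norm (y \<theta>))\<^sup>2)"
proof -
  define Y where "Y j l = (\<Sum>\<theta>\<in>X. y \<theta> * (expo j \<theta> * cnj (expo l \<theta>)))" for j l
  define Z where "Z m = (\<Sum>\<theta>\<in>X. y \<theta> * expo m \<theta>)" for m
  have YZ: "Y (l + m) l = Z m" for l m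
    unfolding Y_def Z_def by (intro sum.cong refl arg_cong2[where f = times]) (simp_all add: expo_def cis_cnj cis_mult algebra_simps)
  \<comment> \<open>With \<open>n \<le> K\<close>, each \<open>m < n\<close> is a difference
    \<open>j - l\<close> of indices below \<open>2 * K\<close> in at least \<open>K\<close> ways,
    namely \<open>j = l + m\<close> for every \<open>l < K\<close>.\<close>
  have "real K * (\<Sum>m<n. (norm (Z m))\<^sup>2) = (\<Sum>(l,m)\<in>{..<K}\<times>{..<n}. (norm (Z m))\<^sup>2)"
    by (simp add: sum.cartesian_product[symmetric])
  also have "\<dots> = (\<Sum>(j,l)\<in>(\<lambda>(l,m). (l + m, l)) ` ({..<K}\<times>{..<n}). (norm (Y j l))\<^sup>2)"
    by (subst sum.reindex) (auto simp: inj_on_def YZ intro!: sum.cong)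
  also have "\<dots> \<le> (\<Sum>(j,l)\<in>{..<2*K}\<times>{..<2*K}. (norm (Y j l))\<^sup>2)"
    using assms(5) by (intro sum_mono2) auto
  also have "\<dots> \<le> norm (\<Sum>(j,l)\<in>{..<2*K}\<times>{..<2*K}. complex_of_real ((norm (Y j l))\<^sup>2))"
  proof -
    have "(\<Sum>(j,l)\<in>{..<2*K}\<times>{..<2*K}. complex_of_real ((norm (Y j l))\<^sup>2)) = complex_of_real (\<Sum>(j,l)\<in>{..<2*K}\<times>{..<2*K}. (norm (Y j l))\<^sup>2)"
      by (simp add: case_prod_unfold)
    then show ?thesis by (simp only: norm_of_real abs_ge_self)
  qed
  also have "(\<Sum>(j,l)\<in>{..<2*K}\<times>{..<2*K}. complex_of_real ((norm (Y j l))\<^sup>2)) =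
     (\<Sum>\<theta>\<in>X. \<Sum>\<phi>\<in>X. y \<theta> * cnj (y \<phi>) * complex_of_real ((norm (dirichlet_sum (2*K) (\<theta> - \<phi>)))\<^sup>2))"
    (is "_ = ?R")
  proof -
    have "(\<Sum>(j,l)\<in>{..<2*K}\<times>{..<2*K}. complex_of_real ((norm (Y j l))\<^sup>2)) =
      (\<Sum>j<2*K. \<Sum>l<2*K. \<Sum>\<theta>\<in>X. \<Sum>\<phi>\<in>X. y \<theta> * cnj (y \<phi>) * (expo j (\<theta> - \<phi>) * cnj (expo l (\<theta> - \<phi>))))"
      unfolding sum.cartesian_product[symmetric]
      by (intro sum.cong refl, simp only: complex_norm_square)
         (simp add: Y_def sum_product expo_diff mult_ac)
    also have "\<dots> = (\<Sum>\<theta>\<in>X. \<Sum>\<phi>\<in>X. \<Sum>j<2*K. \<Sum>l<2*K. y \<theta> * cnj (y \<phi>) * (expo j (\<theta> - \<phi>) * cnj (expo l (\<theta> - \<phi>))))"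
      by (simp only: sum.swap[where A = "{..<2*K}" and B = X])
    also have "\<dots> = ?R"
      by (simp only: complex_norm_square dirichlet_sum_def cnj_sum sum_product) (simp only: sum_distrib_left)
    finally show ?thesis .
  qed
  also have "norm ?R \<le> (\<Sum>\<theta>\<in>X. \<Sum>\<phi>\<in>X. norm (y \<theta>) * norm (y \<phi>) * (norm (dirichlet_sum (2*K) (\<theta> - \<phi>)))\<^sup>2)"
    by (intro order_trans[OF norm_sum] sum_mono) (simp add: norm_mult norm_power)
  \<comment> \<open>Schur's test: the kernel is nonnegative and symmetric, so
    \<open>2 * a * b \<le> a\<^sup>2 + b\<^sup>2\<close> leaves only its row sums.\<close>
  also have "\<dots> \<le> (\<Sum>\<theta>\<in>X. \<Sum>\<phi>\<in>X. ((norm (y \<theta>))\<^sup>2 / 2 + (norm (y \<phi>))\<^sup>2 / 2) * (norm (dirichlet_sum (2*K) (\<theta> - \<phi>)))\<^sup>2)"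
  proof (intro sum_mono mult_right_mono)
    fix \<theta> \<phi>
    show "norm (y \<theta>) * norm (y \<phi>) \<le> (norm (y \<theta>))\<^sup>2 / 2 + (norm (y \<phi>))\<^sup>2 / 2"
      using sum_squares_bound[of "norm (y \<theta>)" "norm (y \<phi>)"] by simp
  qed auto
  also have "\<dots> = (\<Sum>\<theta>\<in>X. (norm (y \<theta>))\<^sup>2 / 2 * (\<Sum>\<phi>\<in>X. (norm (dirichlet_sum (2*K) (\<theta> - \<phi>)))\<^sup>2)) +
      (\<Sum>\<theta>\<in>X. (norm (y \<theta>))\<^sup>2 / 2 * (\<Sum>\<phi>\<in>X. (norm (dirichlet_sum (2*K) (\<theta> - \<phi>)))\<^sup>2))" (is "_ = ?S + ?S")
  proof -
    have "(\<Sum>\<theta>\<in>X. \<Sum>\<phi>\<in>X. (norm (y \<phi>))\<^sup>2 / 2 * (norm (dirichlet_sum (2*K) (\<theta> - \<phi>)))\<^sup>2) = ?S"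
      by (subst sum.swap, subst norm_dirichlet_sum_commute) (simp only: sum_distrib_left)
    moreover have "(\<Sum>\<theta>\<in>X. \<Sum>\<phi>\<in>X. (norm (y \<theta>))\<^sup>2 / 2 * (norm (dirichlet_sum (2*K) (\<theta> - \<phi>)))\<^sup>2) = ?S"
      by (simp only: sum_distrib_left)
    ultimately show ?thesis by (simp only: distrib_right sum.distrib)
  qed
  also have "?S \<le> (\<Sum>\<theta>\<in>X. (norm (y \<theta>))\<^sup>2 / 2 * ((real (2*K))\<^sup>2 + 2 / \<delta>\<^sup>2))"
    by (intro sum_mono mult_left_mono dirichlet_sum_spaced[OF assms(1,2) range sp]) auto
  finally show ?thesis
    by (simp add: Z_def sum_distrib_right[symmetric] sum_divide_distrib[symmetric] power_mult_distrib mult.commute)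
qed

text \<open>Duality: pairing the sums \<open>S\<close> with their own conjugates writes
  \<open>T\<close> as a sum over \<open>m\<close>. Cauchy-Schwarz and the dual inequality with
  coefficients \<open>cnj (S \<theta>)\<close> bound \<open>K * T\<^sup>2\<close> by
  \<open>B * T\<close> times the sum of \<open>(a m)\<^sup>2\<close>, and one factor
  \<open>T\<close> cancels.\<close>

lemma large_sieve:
  fixes \<delta> :: real and a :: "nat \<Rightarrow> real"
  assumes "finite X" "\<delta> > 0" and range: "\<And>\<theta>. \<theta> \<in> X \<Longrightarrow> \<delta> \<le> \<theta> \<and> \<theta> \<le> 1 - \<delta>"
    and sp: "\<And>\<theta> \<phi>. \<theta> \<in> X \<Longrightarrow> \<phi> \<in> X \<Longrightarrow> \<theta> \<noteq> \<phi> \<Longrightarrow> \<delta> \<le> \<bar>\<theta> - \<phi>\<bar>"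
    and "n \<le> K"
  shows "real K * (\<Sum>\<theta>\<in>X. (norm (\<Sum>m<n. a m * expo m \<theta>))\<^sup>2) \<le>
    (4 * (real K)\<^sup>2 + 2 / \<delta>\<^sup>2) * (\<Sum>m<n. (a m)\<^sup>2)"
proof -
  define S where "S \<theta> = (\<Sum>m<n. a m * expo m \<theta>)" for \<theta>
  define Y where "Y m = (\<Sum>\<theta>\<in>X. cnj (S \<theta>) * expo m \<theta>)" for m
  define T where "T = (\<Sum>\<theta>\<in>X. (norm (S \<theta>))\<^sup>2)"
  define B where "B = 4 * (real K)\<^sup>2 + 2 / \<delta>\<^sup>2"
  have T0: "T \<ge> 0" unfolding T_def by (intro sum_nonneg) auto
  have "complex_of_real T = (\<Sum>\<theta>\<in>X. S \<theta> * cnj (S \<theta>))"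
    unfolding T_def of_real_sum complex_norm_square ..
  also have "\<dots> = (\<Sum>m<n. a m * Y m)"
    unfolding Y_def sum_distrib_left by (subst sum.swap) (simp add: S_def sum_distrib_right mult_ac)
  finally have "T = norm (\<Sum>m<n. a m * Y m)" using T0 by (metis abs_of_nonneg norm_of_real)
  also have "\<dots> \<le> (\<Sum>m<n. \<bar>a m\<bar> * norm (Y m))"
    by (intro order_trans[OF norm_sum]) (simp add: norm_mult)
  finally have "T\<^sup>2 \<le> (\<Sum>m<n. \<bar>a m\<bar> * norm (Y m))\<^sup>2" using T0 by (intro power_mono)
  also have "\<dots> \<le> (\<Sum>m<n. (a m)\<^sup>2) * (\<Sum>m<n. (norm (Y m))\<^sup>2)"
    using Cauchy_Schwarz_ineq_sum[of "\<lambda>m. \<bar>a m\<bar>" "\<lambda>m. norm (Y m)" "{..<n}"] by simp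
  finally have "real K * T\<^sup>2 \<le> (\<Sum>m<n. (a m)\<^sup>2) * (real K * (\<Sum>m<n. (norm (Y m))\<^sup>2))"
    by (simp add: mult.left_commute mult_left_mono)
  also have "\<dots> \<le> (\<Sum>m<n. (a m)\<^sup>2) * (B * T)"
    using large_sieve_dual[OF assms, of "\<lambda>\<theta>. cnj (S \<theta>)"]
    by (intro mult_left_mono) (simp_all add: Y_def T_def B_def sum_nonneg)
  finally have "T * (real K * T) \<le> T * (B * (\<Sum>m<n. (a m)\<^sup>2))"
    by (simp only: power2_eq_square mult_ac)
  moreover have "B \<ge> 0" by (simp add: B_def)
  ultimately have "real K * T \<le> B * (\<Sum>m<n. (a m)\<^sup>2)"
    using T0 by (cases "T = 0") (auto simp: sum_nonneg)
  then show ?thesis by (simp add: T_def S_def B_def)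
qed

section \<open>Bilinear forms over the residue class 1 modulo primes\<close>

definition class_sum :: "(nat \<Rightarrow> real) \<Rightarrow> nat set \<Rightarrow> nat \<Rightarrow> nat \<Rightarrow> real" where
  "class_sum f I q r = (\<Sum>m\<in>I. if m mod q = r then f m else 0)"

lemma sum_expo_multiples:
  assumes "q > 0"
  shows "(\<Sum>a<q. expo m (real a / real q) * cnj (expo m' (real a / real q))) =
    (if m mod q = m' mod q then of_nat q else 0)"
proof -
  define \<theta> where "\<theta> = 2 * pi * ((real m - real m') / real q)"
  have e: "expo m (real a / real q) * cnj (expo m' (real a / real q)) = cis \<theta> ^ a" for a
    by (simp add: expo_def cis_cnj cis_mult \<theta>_def Complex.DeMoivre algebra_simps diff_divide_distrib)
  have "cis \<theta> ^ q = cis (2 * pi * (of_int (int m - int m')))"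
    using assms by (simp add: Complex.DeMoivre \<theta>_def)
  then have 1: "cis \<theta> ^ q = 1" by (simp only: cis_multiple_2pi Ints_of_int)
  have 2: "cis \<theta> = 1 \<longleftrightarrow> m mod q = m' mod q"
  proof
    assume "cis \<theta> = 1"
    then have "cos \<theta> = 1" by (metis cis.sel(1) one_complex.sel(1))
    then obtain k :: int where "\<theta> = of_int k * 2 * pi" by (auto simp: cos_one_2pi_int)
    then have "(real m - real m') / real q = of_int k"
      unfolding \<theta>_def times_divide_eq_right[symmetric] by (simp del: times_divide_eq_right)
    then have "real m - real m' = of_int k * real q" using assms by (simp add: field_simps)
    then have "of_int (int m - int m') = (of_int (k * int q) :: real)" by simp
    then have "int m - int m' = k * int q" by (simp only: of_int_eq_iff)
    then have "[int m = int m'] (mod int q)" by (simp add: cong_iff_dvd_diff)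
    then have "[m = m'] (mod q)" by (simp only: cong_int_iff)
    then show "m mod q = m' mod q" by (simp only: cong_def)
  next
    assume "m mod q = m' mod q"
    then have "[m = m'] (mod q)" by (simp only: cong_def)
    then have "[int m = int m'] (mod int q)" by (simp only: cong_int_iff)
    then have "int q dvd int m - int m'" by (simp only: cong_iff_dvd_diff)
    then obtain k where k: "int m - int m' = int q * k" by (elim dvdE)
    have "real m - real m' = of_int (int m - int m')" by simp
    then have "(real m - real m') / real q = of_int k" using assms unfolding k by simp
    then show "cis \<theta> = 1" by (simp only: \<theta>_def cis_multiple_2pi Ints_of_int)
  qed
  show ?thesis
  proof (cases "cis \<theta> = 1")
    case True
    then show ?thesis using 2 by (simp add: e)
  next
    case False
    then show ?thesis using 1 2 by (simp add: e geometric_sum)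
  qed
qed

lemma parseval_residues:
  assumes "q > 0"
  shows "(\<Sum>a<q. (norm (\<Sum>m<n. f m * expo m (real a / real q)))\<^sup>2) =
    real q * (\<Sum>r<q. (class_sum f {..<n} q r)\<^sup>2)"
proof -
  have "complex_of_real (\<Sum>a<q. (norm (\<Sum>m<n. f m * expo m (real a / real q)))\<^sup>2) =
     (\<Sum>a<q. \<Sum>m<n. \<Sum>m'<n. of_real (f m * f m') * (expo m (real a / real q) * cnj (expo m' (real a / real q))))"
    unfolding of_real_sum complex_norm_square cnj_sum sum_product by (simp add: mult_ac)
  also have "\<dots> = (\<Sum>m<n. \<Sum>m'<n. \<Sum>a<q. of_real (f m * f m') * (expo m (real a / real q) * cnj (expo m' (real a / real q))))"
    by (subst sum.swap) (intro sum.cong refl sum.swap)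
  also have "\<dots> = (\<Sum>m<n. \<Sum>m'<n. of_real (f m * f m') * (if m mod q = m' mod q then of_nat q else 0))"
    by (simp only: sum_distrib_left[symmetric] sum_expo_multiples[OF assms])
  also have "\<dots> = complex_of_real (\<Sum>m<n. \<Sum>m'<n. f m * f m' * (if m mod q = m' mod q then real q else 0))"
    by (simp add: if_distrib cong: if_cong)
  finally have "(\<Sum>a<q. (norm (\<Sum>m<n. f m * expo m (real a / real q)))\<^sup>2) =
     (\<Sum>m<n. \<Sum>m'<n. f m * f m' * (if m mod q = m' mod q then real q else 0))"
    by (simp only: of_real_eq_iff)
  also have "\<dots> = (\<Sum>m<n. \<Sum>m'<n. \<Sum>r<q. real q * ((if m mod q = r then f m else 0) * (if m' mod q = r then f m' else 0)))"
  proof (intro sum.cong refl)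
    fix m m'
    have "(\<Sum>r<q. real q * ((if m mod q = r then f m else 0) * (if m' mod q = r then f m' else 0))) =
        (\<Sum>r<q. if r = m mod q then real q * (f m * (if m' mod q = r then f m' else 0)) else 0)"
      by (intro sum.cong refl) auto
    also have "\<dots> = real q * (f m * (if m' mod q = m mod q then f m' else 0))"
      using assms by (subst sum.delta) auto
    finally show "f m * f m' * (if m mod q = m' mod q then real q else 0) =
       (\<Sum>r<q. real q * ((if m mod q = r then f m else 0) * (if m' mod q = r then f m' else 0)))"
      by (auto simp del: mult_if_delta)
  qed
  also have "\<dots> = (\<Sum>r<q. \<Sum>m<n. \<Sum>m'<n. real q * ((if m mod q = r then f m else 0) * (if m' mod q = r then f m' else 0)))"
    by (simp only: sum.swap[where B = "{..<q}"])
  also have "\<dots> = real q * (\<Sum>r<q. (class_sum f {..<n} q r)\<^sup>2)"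
    unfolding class_sum_def power2_eq_square sum_product by (simp only: sum_distrib_left)
  finally show ?thesis .
qed

lemma sum_class_sum:
  assumes "q > 0" "finite I"
  shows "(\<Sum>r<q. class_sum f I q r) = sum f I"
  unfolding class_sum_def using assms by (subst sum.swap) simp

text \<open>Parseval modulo \<open>q\<close>: removing the zero frequency amounts to centring the
  class sums at their mean.\<close>

lemma residue_variance:
  assumes "q > 0"
  shows "real q * (\<Sum>r<q. (class_sum f {..<n} q r - (\<Sum>m<n. f m) / real q)\<^sup>2) =
    (\<Sum>a\<in>{1..<q}. (norm (\<Sum>m<n. f m * expo m (real a / real q)))\<^sup>2)"
proof -
  define s where "s = (\<Sum>m<n. f m)"
  define C where "C = class_sum f {..<n} q"
  have C: "(\<Sum>r<q. C r) = s" unfolding C_def s_def using assms by (intro sum_class_sum) auto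
  have "(\<Sum>r<q. (C r - s / real q)\<^sup>2) = (\<Sum>r<q. (C r)\<^sup>2) - 2 * s / real q * (\<Sum>r<q. C r) + real q * (s / real q)\<^sup>2"
    by (simp add: power2_diff sum.distrib sum_subtractf sum_distrib_left sum_divide_distrib mult_ac)
  also have "real q * \<dots> = real q * (\<Sum>r<q. (C r)\<^sup>2) - s\<^sup>2"
    using assms by (simp add: C field_simps power2_eq_square)
  also have "real q * (\<Sum>r<q. (C r)\<^sup>2) = (\<Sum>a<q. (norm (\<Sum>m<n. f m * expo m (real a / real q)))\<^sup>2)"
    unfolding C_def by (rule parseval_residues[OF assms, symmetric])
  also have "\<dots> = (\<Sum>a\<in>insert 0 {1..<q}. (norm (\<Sum>m<n. f m * expo m (real a / real q)))\<^sup>2)"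
    using assms by (intro sum.cong) auto
  also have "\<dots> = (norm (complex_of_real s))\<^sup>2 + (\<Sum>a\<in>{1..<q}. (norm (\<Sum>m<n. f m * expo m (real a / real q)))\<^sup>2)"
    by (subst sum.insert) (simp_all add: expo_def s_def)
  finally show ?thesis unfolding C_def s_def[symmetric] by simp
qed

text \<open>Fractions \<open>a / q\<close> with \<open>0 < a < q\<close> and prime
  \<open>q \<le> D\<close> are distinct, and two of them differ by a nonzero integer
  \<open>a * q' - a' * q\<close> divided by at most \<open>D\<^sup>2\<close>. The residue variance
  converts their exponential sums back into class sums.\<close>

lemma arithmetic_large_sieve:
  fixes f :: "nat \<Rightarrow> real"
  assumes "finite S" and S: "\<And>q. q \<in> S \<Longrightarrow> prime q \<and> q \<le> D" and "D > 0" and I: "I \<subseteq> {..<n}"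
  shows "(\<Sum>q\<in>S. real q * (\<Sum>r<q. (class_sum f I q r - sum f I / real q)\<^sup>2)) \<le>
    6 * real (n + D\<^sup>2) * (\<Sum>m\<in>I. (f m)\<^sup>2)"
proof -
  define g where "g m = (if m \<in> I then f m else 0)" for m
  define P where "P = Sigma S (\<lambda>q. {1..<q})"
  define h where "h = (\<lambda>(q, a). real a / real q)"
  define \<delta> where "\<delta> = 1 / (real D)\<^sup>2"
  \<comment> \<open>\<open>K\<close> dominates both \<open>n\<close>, as the large sieve demands,
    and \<open>1 / \<delta>\<close>. Both terms of the constant are then multiples of
    \<open>K\<^sup>2\<close>, with \<open>4 + 2 = 6\<close>, and one \<open>K\<close>
    cancels.\<close>
  define K where "K = n + D\<^sup>2"
  have K: "real K > 0" using assms(3) by (simp add: K_def add_nonneg_pos)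
  have fin: "finite P" unfolding P_def using assms(1) by auto
  have \<delta>: "\<delta> > 0" using assms(3) by (simp add: \<delta>_def)
  have sep: "\<delta> \<le> \<bar>h (q, a) - h (q', a')\<bar>" if "(q, a) \<in> P" "(q', a') \<in> P" "(q, a) \<noteq> (q', a')" for q a q' a'
  proof -
    have *: "prime q" "prime q'" "q \<le> D" "q' \<le> D" "0 < a" "a < q" "0 < a'" "a' < q'"
      using that S by (auto simp: P_def)
    have ne: "a * q' \<noteq> a' * q"
    proof
      assume eq: "a * q' = a' * q"
      then have "q dvd a * q'" by simp
      moreover have "\<not> q dvd a" using * by (auto dest: dvd_imp_le)
      ultimately have "q = q'" using * by (metis prime_dvd_mult_iff primes_dvd_imp_eq)
      with eq * that(3) show False by simp
    qed
    have "1 \<le> \<bar>int (a * q') - int (a' * q)\<bar>" using ne by linarith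
    then have "1 \<le> real_of_int \<bar>int (a * q') - int (a' * q)\<bar>" by (simp only: of_int_1_le_iff)
    then have "1 \<le> \<bar>real a * real q' - real a' * real q\<bar>" by simp
    moreover have "h (q, a) - h (q', a') = (real a * real q' - real a' * real q) / (real q * real q')"
      using * by (simp add: h_def field_simps)
    ultimately have "1 / (real q * real q') \<le> \<bar>h (q, a) - h (q', a')\<bar>"
      by (simp add: abs_divide divide_right_mono)
    moreover have "\<delta> \<le> 1 / (real q * real q')"
      unfolding \<delta>_def power2_eq_square using * by (intro divide_left_mono mult_mono) (auto intro!: mult_pos_pos)
    ultimately show ?thesis by linarith
  qed
  have inj: "inj_on h P"
  proof (rule inj_onI)
    fix x y assume "x \<in> P" "y \<in> P" "h x = h y"
    with sep[of "fst x" "snd x" "fst y" "snd y"] \<delta> show "x = y" by (cases x; cases y) auto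
  qed
  have ls: "real K * (\<Sum>\<theta>\<in>h ` P. (norm (\<Sum>m<n. g m * expo m \<theta>))\<^sup>2) \<le>
    (4 * (real K)\<^sup>2 + 2 / \<delta>\<^sup>2) * (\<Sum>m<n. (g m)\<^sup>2)"
  proof (rule large_sieve)
    fix \<theta> assume "\<theta> \<in> h ` P"
    then obtain q a where "q \<in> S" "a \<in> {1..<q}" "\<theta> = real a / real q"
      by (auto simp: P_def h_def)
    with S have *: "prime q" "q \<le> D" "0 < a" "a < q" "\<theta> = real a / real q" by auto
    have "real q * 1 \<le> real D * real D" using *(2) assms(3) by (intro mult_mono) auto
    then have "\<delta> \<le> 1 / real q"
      unfolding \<delta>_def power2_eq_square using prime_gt_0_nat[OF *(1)] assms(3) by (intro divide_left_mono) auto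
    moreover have "1 / real q \<le> \<theta>" using * by (auto intro!: divide_right_mono)
    moreover have "1 / real q \<le> 1 - \<theta>" using * by (simp add: field_simps)
    ultimately show "\<delta> \<le> \<theta> \<and> \<theta> \<le> 1 - \<delta>" by linarith
  next
    fix \<theta> \<phi> assume "\<theta> \<in> h ` P" "\<phi> \<in> h ` P" "\<theta> \<noteq> \<phi>"
    then show "\<delta> \<le> \<bar>\<theta> - \<phi>\<bar>" using sep by auto
  qed (use fin \<delta> in \<open>auto simp: K_def\<close>)
  have "2 / \<delta>\<^sup>2 \<le> 2 * (real K)\<^sup>2"
  proof -
    have "2 / \<delta>\<^sup>2 = 2 * ((real D)\<^sup>2)\<^sup>2" by (simp add: \<delta>_def power_divide)
    also have "\<dots> \<le> 2 * (real K)\<^sup>2" by (intro mult_left_mono power_mono) (auto simp: K_def)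
    finally show ?thesis .
  qed
  then have "(4 * (real K)\<^sup>2 + 2 / \<delta>\<^sup>2) * (\<Sum>m<n. (g m)\<^sup>2) \<le> (6 * (real K)\<^sup>2) * (\<Sum>m<n. (g m)\<^sup>2)"
    by (intro mult_right_mono) (auto simp: sum_nonneg)
  with ls have "real K * (\<Sum>\<theta>\<in>h ` P. (norm (\<Sum>m<n. g m * expo m \<theta>))\<^sup>2) \<le> real K * (6 * real K * (\<Sum>m<n. (g m)\<^sup>2))"
    by (simp add: power2_eq_square mult_ac)
  then have "(\<Sum>\<theta>\<in>h ` P. (norm (\<Sum>m<n. g m * expo m \<theta>))\<^sup>2) \<le> 6 * real K * (\<Sum>m<n. (g m)\<^sup>2)"
    using K by (simp only: mult_le_cancel_left_pos)
  also have "(\<Sum>\<theta>\<in>h ` P. (norm (\<Sum>m<n. g m * expo m \<theta>))\<^sup>2) =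
      (\<Sum>q\<in>S. \<Sum>a\<in>{1..<q}. (norm (\<Sum>m<n. g m * expo m (real a / real q)))\<^sup>2)"
    unfolding P_def by (subst sum.Sigma) (use assms(1) inj in \<open>auto simp: sum.reindex h_def P_def case_prod_unfold\<close>)
  also have "\<dots> = (\<Sum>q\<in>S. real q * (\<Sum>r<q. (class_sum g {..<n} q r - (\<Sum>m<n. g m) / real q)\<^sup>2))"
    by (intro sum.cong refl residue_variance[symmetric]) (use S in \<open>auto dest: prime_gt_0_nat\<close>)
  also have "class_sum g {..<n} = class_sum f I"
    unfolding class_sum_def g_def fun_eq_iff using I by (auto intro!: sum.mono_neutral_cong_right)
  also have "(\<Sum>m<n. g m) = sum f I"
    unfolding g_def using I by (auto intro!: sum.mono_neutral_cong_right)
  also have "(\<Sum>m<n. (g m)\<^sup>2) = (\<Sum>m\<in>I. (f m)\<^sup>2)"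
    unfolding g_def using I by (auto intro!: sum.mono_neutral_cong_right)
  finally show ?thesis by (simp add: K_def)
qed

text \<open>For prime \<open>q\<close> this is the indicator of the class 1 without its principal
  character part: on integers coprime to \<open>q\<close> the mean over the reduced classes is
  subtracted, and multiples of \<open>q\<close> get 0.\<close>

definition res_dev :: "nat \<Rightarrow> nat \<Rightarrow> real" where
  "res_dev q n = (if n mod q = 1 then 1 else 0) - (if q dvd n then 0 else 1 / (real q - 1))"

text \<open>Bridges two notions of mean: \<open>res_dev\<close> centres over the reduced classes,
  the large sieve over all classes. The mean minimises the sum of squared distances, so passing to
  another centre only enlarges the bound.\<close>

lemma sum_square_mean_le:
  fixes A :: "'a \<Rightarrow> real"
  assumes "finite R" "R \<noteq> {}"
  shows "(\<Sum>r\<in>R. (A r - sum A R / real (card R))\<^sup>2) \<le> (\<Sum>r\<in>R. (A r - c)\<^sup>2)"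
proof -
  define k where "k = real (card R)"
  define d where "d = sum A R / k"
  have k: "k > 0" using assms by (simp add: k_def card_gt_0_iff)
  have s: "sum A R = k * d" using k by (simp add: d_def)
  have "(\<Sum>r\<in>R. (A r - c)\<^sup>2) - (\<Sum>r\<in>R. (A r - d)\<^sup>2) = (\<Sum>r\<in>R. (c\<^sup>2 - d\<^sup>2) - 2 * (c - d) * A r)"
    unfolding sum_subtractf[symmetric] by (intro sum.cong) (auto simp: power2_eq_square algebra_simps)
  also have "\<dots> = k * (c\<^sup>2 - d\<^sup>2) - 2 * (c - d) * (k * d)"
    by (simp add: sum_subtractf sum_distrib_left[symmetric] s k_def)
  also have "\<dots> = k * (c - d)\<^sup>2" by (simp add: power2_eq_square algebra_simps)
  finally show ?thesis using k unfolding d_def k_def[symmetric] by (smt (verit) mult_nonneg_nonneg zero_le_power2)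
qed

lemma res_inverse_ex:
  fixes q :: nat
  assumes "prime q"
  obtains \<sigma> where "bij_betw \<sigma> {1..<q} {1..<q}"
    "\<And>m n. (m * n) mod q = 1 \<longleftrightarrow> m mod q \<in> {1..<q} \<and> n mod q = \<sigma> (m mod q)"
proof -
  have q: "q > 1" using assms by (rule prime_gt_1_nat)
  have "\<forall>r\<in>{1..<q}. \<exists>s. s \<in> {1..<q} \<and> (r * s) mod q = 1"
  proof
    fix r assume r: "r \<in> {1..<q}"
    then have "coprime r q" using assms by (metis atLeastLessThan_iff coprime_commute dvd_imp_le not_le prime_imp_coprime zero_less_one less_le_trans)
    then obtain s where "[r * s = 1] (mod q)" using cong_solve_coprime_nat by auto
    then have s: "(r * (s mod q)) mod q = 1" using q by (simp add: cong_def mod_mult_right_eq)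
    then have "s mod q \<noteq> 0" using q by (intro notI) simp
    with s q show "\<exists>s. s \<in> {1..<q} \<and> (r * s) mod q = 1" by (intro exI[of _ "s mod q"]) auto
  qed
  then obtain \<sigma> where \<sigma>: "\<And>r. r \<in> {1..<q} \<Longrightarrow> \<sigma> r \<in> {1..<q} \<and> (r * \<sigma> r) mod q = 1"
    by metis
  have uniq: "s = s'" if "s < q" "s' < q" "(r * s) mod q = 1" "(r * s') mod q = 1" for r s s'
  proof -
    have "s = (s * ((r * s') mod q)) mod q" using that by simp
    also have "\<dots> = (s' * ((r * s) mod q)) mod q" by (simp only: mod_mult_right_eq mult_ac)
    also have "\<dots> = s'" using that by simp
    finally show ?thesis .
  qed
  have inv: "\<sigma> (\<sigma> r) = r" if "r \<in> {1..<q}" for r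
    using uniq[of "\<sigma> (\<sigma> r)" r "\<sigma> r"] \<sigma>[OF that] \<sigma>[of "\<sigma> r"] that by (simp add: mult.commute)
  show ?thesis
  proof (rule that)
    show "bij_betw \<sigma> {1..<q} {1..<q}"
      by (rule bij_betw_byWitness[where f' = \<sigma>]) (use \<sigma> inv in auto)
    fix m n
    have mm: "(m * n) mod q = ((m mod q) * (n mod q)) mod q" by (simp add: mod_mult_eq)
    show "(m * n) mod q = 1 \<longleftrightarrow> m mod q \<in> {1..<q} \<and> n mod q = \<sigma> (m mod q)"
    proof
      assume 1: "(m * n) mod q = 1"
      then have "m mod q \<noteq> 0" unfolding mm by (intro notI) simp
      then have r: "m mod q \<in> {1..<q}" using q by auto
      moreover have "n mod q = \<sigma> (m mod q)"
        using uniq[of "n mod q" "\<sigma> (m mod q)" "m mod q"] 1 \<sigma>[OF r] q unfolding mm by auto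
      ultimately show "m mod q \<in> {1..<q} \<and> n mod q = \<sigma> (m mod q)" ..
    qed (use \<sigma> mm in auto)
  qed
qed

text \<open>The principal part subtracted in \<open>res_dev\<close> is exactly what centring
  produces, so the form is a covariance of \<open>A r\<close> and \<open>B (\<sigma> r)\<close> over
  the reduced classes; after Cauchy-Schwarz, reindexing removes \<open>\<sigma>\<close>. The
  constants \<open>c\<close> and \<open>d\<close> are arbitrary because the true means are optimal;
  the means over all classes will be inserted.\<close>

lemma bilinear_res_dev_single:
  assumes "prime q" "finite I" "finite J"
  shows "(\<Sum>m\<in>I. \<Sum>n\<in>J. f m * g n * res_dev q (m * n)) \<le>
    sqrt (\<Sum>r<q. (class_sum f I q r - c)\<^sup>2) * sqrt (\<Sum>r<q. (class_sum g J q r - d)\<^sup>2)"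
proof -
  define A where "A = class_sum f I q"
  define B where "B = class_sum g J q"
  define R where "R = {1..<q}"
  have q: "q > 1" using assms(1) by (rule prime_gt_1_nat)
  obtain \<sigma> where bij: "bij_betw \<sigma> R R"
    and \<sigma>: "\<And>m n. (m * n) mod q = 1 \<longleftrightarrow> m mod q \<in> R \<and> n mod q = \<sigma> (m mod q)"
    using res_inverse_ex[OF assms(1)] unfolding R_def by metis
  have R: "finite R" "R \<noteq> {}" "real (card R) = real q - 1" using q by (auto simp: R_def)
  have AR: "sum (class_sum h H q) R = (\<Sum>m\<in>H. if q dvd m then 0 else h m)" for h H
  proof -
    have "sum (class_sum h H q) R = (\<Sum>m\<in>H. \<Sum>r\<in>R. if m mod q = r then h m else 0)"
      unfolding class_sum_def by (rule sum.swap)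
    also have "\<dots> = (\<Sum>m\<in>H. if q dvd m then 0 else h m)"
      using R q by (intro sum.cong refl) (auto simp: R_def mod_eq_0_iff_dvd Suc_le_eq simp flip: mod_greater_zero_iff_not_dvd)
    finally show ?thesis .
  qed
  have "(\<Sum>m\<in>I. \<Sum>n\<in>J. f m * g n * (if (m * n) mod q = 1 then 1 else 0)) =
     (\<Sum>m\<in>I. \<Sum>n\<in>J. \<Sum>r\<in>R. (if m mod q = r then f m else 0) * (if n mod q = \<sigma> r then g n else 0))"
  proof (intro sum.cong refl)
    fix m n
    have "(\<Sum>r\<in>R. (if m mod q = r then f m else 0) * (if n mod q = \<sigma> r then g n else 0)) =
       (\<Sum>r\<in>R. if m mod q = r then f m * (if n mod q = \<sigma> (m mod q) then g n else 0) else 0)"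
      by (intro sum.cong) auto
    also have "\<dots> = (if m mod q \<in> R then f m * (if n mod q = \<sigma> (m mod q) then g n else 0) else 0)"
      using R(1) by simp
    finally show "f m * g n * (if (m * n) mod q = 1 then 1 else 0) =
       (\<Sum>r\<in>R. (if m mod q = r then f m else 0) * (if n mod q = \<sigma> r then g n else 0))"
      by (simp only: \<sigma>) simp
  qed
  also have "\<dots> = (\<Sum>r\<in>R. \<Sum>m\<in>I. \<Sum>n\<in>J. (if m mod q = r then f m else 0) * (if n mod q = \<sigma> r then g n else 0))"
    by (simp only: sum.swap[where B = R])
  also have "\<dots> = (\<Sum>r\<in>R. A r * B (\<sigma> r))"
    unfolding A_def B_def class_sum_def sum_product ..
  finally have 1: "(\<Sum>m\<in>I. \<Sum>n\<in>J. f m * g n * (if (m * n) mod q = 1 then 1 else 0)) = (\<Sum>r\<in>R. A r * B (\<sigma> r))" .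
  have 2: "(\<Sum>m\<in>I. \<Sum>n\<in>J. f m * g n * (if q dvd m * n then 0 else 1 / (real q - 1))) = sum A R * sum B R / (real q - 1)"
    unfolding A_def B_def AR sum_product sum_divide_distrib
    by (intro sum.cong refl) (use assms(1) in \<open>auto simp: prime_dvd_mult_iff\<close>)
  have \<sigma>B: "(\<Sum>r\<in>R. B (\<sigma> r)) = sum B R"
    using sum.reindex_bij_betw[OF bij, of B] .
  define a where "a = sum A R / real (card R)"
  define b where "b = sum B R / real (card R)"
  have k: "real (card R) > 0" using R(1,2) by (simp add: card_gt_0_iff)
  have "(\<Sum>m\<in>I. \<Sum>n\<in>J. f m * g n * res_dev q (m * n)) = (\<Sum>r\<in>R. A r * B (\<sigma> r)) - sum A R * sum B R / (real q - 1)"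
    unfolding 1[symmetric] 2[symmetric] by (simp only: res_dev_def right_diff_distrib sum_subtractf)
  also have "\<dots> = (\<Sum>r\<in>R. (A r - a) * (B (\<sigma> r) - b))"
  proof -
    have "(\<Sum>r\<in>R. (A r - a) * (B (\<sigma> r) - b)) =
       (\<Sum>r\<in>R. A r * B (\<sigma> r)) - b * sum A R - a * (\<Sum>r\<in>R. B (\<sigma> r)) + real (card R) * (a * b)"
      by (simp add: algebra_simps sum.distrib sum_subtractf sum_distrib_left)
    also have "\<dots> = (\<Sum>r\<in>R. A r * B (\<sigma> r)) - sum A R * sum B R / real (card R)"
      using k by (simp add: a_def b_def \<sigma>B)
    finally show ?thesis by (simp add: R(3))
  qed
  also have "\<dots> \<le> sqrt (\<Sum>r\<in>R. (A r - a)\<^sup>2) * sqrt (\<Sum>r\<in>R. (B (\<sigma> r) - b)\<^sup>2)"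
    unfolding real_sqrt_mult[symmetric] by (intro real_le_rsqrt Cauchy_Schwarz_ineq_sum)
  also have "(\<Sum>r\<in>R. (B (\<sigma> r) - b)\<^sup>2) = (\<Sum>r\<in>R. (B r - b)\<^sup>2)"
    using sum.reindex_bij_betw[OF bij, of "\<lambda>r. (B r - b)\<^sup>2"] .
  also have "sqrt (\<Sum>r\<in>R. (A r - a)\<^sup>2) * sqrt (\<Sum>r\<in>R. (B r - b)\<^sup>2) \<le>
     sqrt (\<Sum>r\<in>R. (A r - c)\<^sup>2) * sqrt (\<Sum>r\<in>R. (B r - d)\<^sup>2)"
    unfolding a_def b_def
    by (intro mult_mono real_sqrt_le_mono sum_square_mean_le R(1,2)) (auto simp: sum_nonneg)
  also have "\<dots> \<le> sqrt (\<Sum>r<q. (A r - c)\<^sup>2) * sqrt (\<Sum>r<q. (B r - d)\<^sup>2)"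
    by (intro mult_mono real_sqrt_le_mono sum_mono2) (auto simp: sum_nonneg R_def)
  finally show ?thesis by (simp add: A_def B_def)
qed

text \<open>The weight \<open>q\<close> in the arithmetic large sieve is at least \<open>D0\<close>,
  so each of the two summed variances gains a factor \<open>1 / D0\<close>; Cauchy-Schwarz over
  \<open>q\<close> combines them into a single \<open>1 / D0\<close>.\<close>

lemma bilinear_res_dev:
  fixes f g :: "nat \<Rightarrow> real"
  assumes "finite S" and S: "\<And>q. q \<in> S \<Longrightarrow> prime q \<and> real q \<ge> D0 \<and> q \<le> D" and D: "D > 0" "D0 > 0"
    and I: "I \<subseteq> {..<k}" and J: "J \<subseteq> {..<l}"
  shows "(\<Sum>m\<in>I. \<Sum>n\<in>J. f m * g n * (\<Sum>q\<in>S. res_dev q (m * n))) \<le>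
    6 / D0 * sqrt (real (k + D\<^sup>2) * real (l + D\<^sup>2)) * (sqrt (\<Sum>m\<in>I. (f m)\<^sup>2) * sqrt (\<Sum>n\<in>J. (g n)\<^sup>2))"
proof -
  have fin: "finite I" "finite J" using I J by (auto intro: finite_subset)
  define V where "V h H q = (\<Sum>r<q. (class_sum h H q r - sum h H / real q)\<^sup>2)" for h H q
  have V0: "V h H q \<ge> 0" for h H q unfolding V_def by (intro sum_nonneg) auto
  have V: "(\<Sum>q\<in>S. V h H q) \<le> 6 * real (n + D\<^sup>2) * (\<Sum>m\<in>H. (h m)\<^sup>2) / D0" if "H \<subseteq> {..<n}" for h H n
  proof -
    have "(\<Sum>q\<in>S. D0 * V h H q) \<le> (\<Sum>q\<in>S. real q * V h H q)"
      using S V0 by (intro sum_mono mult_right_mono) auto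
    also have "\<dots> \<le> 6 * real (n + D\<^sup>2) * (\<Sum>m\<in>H. (h m)\<^sup>2)"
      unfolding V_def using S by (intro arithmetic_large_sieve[OF assms(1) _ D(1) that]) auto
    finally show ?thesis using D(2) by (simp add: sum_distrib_left[symmetric] field_simps)
  qed
  have "(\<Sum>m\<in>I. \<Sum>n\<in>J. f m * g n * (\<Sum>q\<in>S. res_dev q (m * n))) =
     (\<Sum>q\<in>S. \<Sum>m\<in>I. \<Sum>n\<in>J. f m * g n * res_dev q (m * n))"
    by (simp only: sum_distrib_left sum.swap[where B = S])
  also have "\<dots> \<le> (\<Sum>q\<in>S. sqrt (V f I q) * sqrt (V g J q))"
    unfolding V_def using S fin by (intro sum_mono bilinear_res_dev_single) auto
  also have "\<dots> \<le> sqrt ((\<Sum>q\<in>S. V f I q) * (\<Sum>q\<in>S. V g J q))"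
    using Cauchy_Schwarz_ineq_sum[of "\<lambda>q. sqrt (V f I q)" "\<lambda>q. sqrt (V g J q)" S] V0
    by (intro real_le_rsqrt) simp
  also have "\<dots> \<le> sqrt ((6 * real (k + D\<^sup>2) * (\<Sum>m\<in>I. (f m)\<^sup>2) / D0) * (6 * real (l + D\<^sup>2) * (\<Sum>m\<in>J. (g m)\<^sup>2) / D0))"
    using D(2) by (intro real_sqrt_le_mono mult_mono V I J) (auto intro!: sum_nonneg V0 mult_nonneg_nonneg divide_nonneg_pos)
  also have "\<dots> = sqrt ((6 / D0)\<^sup>2 * (real (k + D\<^sup>2) * real (l + D\<^sup>2) * ((\<Sum>m\<in>I. (f m)\<^sup>2) * (\<Sum>m\<in>J. (g m)\<^sup>2))))"
    by (rule arg_cong[where f = sqrt]) (simp only: power2_eq_square times_divide_eq_left times_divide_eq_right divide_divide_eq_left mult_ac)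
  also have "\<dots> = 6 / D0 * sqrt (real (k + D\<^sup>2) * real (l + D\<^sup>2)) * (sqrt (\<Sum>m\<in>I. (f m)\<^sup>2) * sqrt (\<Sum>n\<in>J. (g n)\<^sup>2))"
    using D(2) by (simp add: real_sqrt_mult mult_ac)
  finally show ?thesis .
qed

text \<open>A staircase region is cut recursively into its two halves and a rectangle; by Cauchy-Schwarz
  every one of the \<open>k\<close> levels of the recursion costs at most \<open>C * \<parallel>f\<parallel> * \<parallel>g\<parallel>\<close>.\<close>

lemma staircase_bilinear:
  fixes \<phi> :: "nat \<Rightarrow> nat \<Rightarrow> real" and u v :: "nat \<Rightarrow> real" and t :: "nat \<Rightarrow> nat"
  assumes rect: "\<And>I J. I \<subseteq> {s0<..s1} \<Longrightarrow> J \<subseteq> {..<l} \<Longrightarrow>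
      (\<Sum>m\<in>I. \<Sum>n\<in>J. \<phi> m n) \<le> C * (sqrt (sum u I) * sqrt (sum v J))"
    and mono: "\<And>m m'. s0 \<le> m \<Longrightarrow> m \<le> m' \<Longrightarrow> m' \<le> s1 \<Longrightarrow> t m' \<le> t m" and "t s0 < l" and "C \<ge> 0"
    and nonneg: "\<And>m. u m \<ge> 0" "\<And>n. v n \<ge> 0"
  shows "s0 \<le> s \<Longrightarrow> s + 2 ^ k \<le> s1 \<Longrightarrow>
    (\<Sum>m\<in>{s<..s + 2 ^ k}. \<Sum>n\<in>{t (s + 2 ^ k)<..t m}. \<phi> m n) \<le>
      real k * C * (sqrt (sum u {s<..s + 2 ^ k}) * sqrt (sum v {t (s + 2 ^ k)<..t s}))"
proof (induction k arbitrary: s)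
  case 0
  have "{s<..s + 2 ^ 0} = {Suc s}" by auto
  then show ?case by simp
next
  case (Suc k)
  define r where "r = s + 2 ^ k"
  define e where "e = s + 2 ^ Suc k"
  have e: "r + 2 ^ k = e" by (simp add: r_def e_def)
  have ord: "s0 \<le> s" "s \<le> r" "r \<le> e" "e \<le> s1" using Suc.prems by (auto simp: r_def e_def)
  have split: "{s<..e} = {s<..r} \<union> {r<..e}" "{s<..r} \<inter> {r<..e} = {}" using ord by auto
  have te: "t e \<le> t r" "t r \<le> t s" "t s \<le> t s0" using ord by (auto intro!: mono)
  have splitJ: "{t e<..t s} = {t r<..t s} \<union> {t e<..t r}" "{t r<..t s} \<inter> {t e<..t r} = {}" using te by auto
  define U1 U2 V1 V2 where "U1 = sum u {s<..r}" and "U2 = sum u {r<..e}"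
    and "V1 = sum v {t r<..t s}" and "V2 = sum v {t e<..t r}"
  have nn: "U1 \<ge> 0" "U2 \<ge> 0" "V1 \<ge> 0" "V2 \<ge> 0"
    unfolding U1_def U2_def V1_def V2_def by (intro sum_nonneg nonneg)+
  have U: "sum u {s<..e} = U1 + U2" unfolding split(1) U1_def U2_def using split(2) by (intro sum.union_disjoint) auto
  have V: "sum v {t e<..t s} = V1 + V2" unfolding splitJ(1) V1_def V2_def using splitJ(2) by (intro sum.union_disjoint) auto
  have "(\<Sum>m\<in>{s<..e}. \<Sum>n\<in>{t e<..t m}. \<phi> m n) =
     (\<Sum>m\<in>{s<..r}. \<Sum>n\<in>{t e<..t m}. \<phi> m n) + (\<Sum>m\<in>{r<..e}. \<Sum>n\<in>{t e<..t m}. \<phi> m n)"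
    unfolding split(1) using split(2) by (intro sum.union_disjoint) auto
  \<comment> \<open>The left half is cut at height \<open>t r\<close>: above it lies a smaller
    staircase, below it a full rectangle on the range \<open>{t e<..t r}\<close> that also carries
    the staircase of the right half.\<close>
  also have "(\<Sum>m\<in>{s<..r}. \<Sum>n\<in>{t e<..t m}. \<phi> m n) =
     (\<Sum>m\<in>{s<..r}. (\<Sum>n\<in>{t r<..t m}. \<phi> m n) + (\<Sum>n\<in>{t e<..t r}. \<phi> m n))"
  proof (intro sum.cong refl)
    fix m assume "m \<in> {s<..r}"
    then have "t r \<le> t m" using ord by (intro mono) auto
    then have "{t e<..t m} = {t r<..t m} \<union> {t e<..t r}" using te by auto
    then show "(\<Sum>n\<in>{t e<..t m}. \<phi> m n) = (\<Sum>n\<in>{t r<..t m}. \<phi> m n) + (\<Sum>n\<in>{t e<..t r}. \<phi> m n)"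
      by (simp only:) (intro sum.union_disjoint, auto)
  qed
  also have "\<dots> = (\<Sum>m\<in>{s<..r}. \<Sum>n\<in>{t r<..t m}. \<phi> m n) + (\<Sum>m\<in>{s<..r}. \<Sum>n\<in>{t e<..t r}. \<phi> m n)"
    by (rule sum.distrib)
  also have "(\<Sum>m\<in>{s<..r}. \<Sum>n\<in>{t r<..t m}. \<phi> m n) \<le> real k * C * (sqrt U1 * sqrt V1)"
    using Suc.IH[of s] ord unfolding U1_def V1_def r_def by simp
  also have "(\<Sum>m\<in>{r<..e}. \<Sum>n\<in>{t e<..t m}. \<phi> m n) \<le> real k * C * (sqrt U2 * sqrt V2)"
    using Suc.IH[of r] ord unfolding U2_def V2_def e by simp
  also have "(\<Sum>m\<in>{s<..r}. \<Sum>n\<in>{t e<..t r}. \<phi> m n) \<le> C * (sqrt (U1 + U2) * sqrt (V1 + V2))"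
  proof (rule order_trans[OF rect])
    show "C * (sqrt (sum u {s<..r}) * sqrt (sum v {t e<..t r})) \<le> C * (sqrt (U1 + U2) * sqrt (V1 + V2))"
      using nn assms(4) by (intro mult_left_mono mult_mono real_sqrt_le_mono) (auto simp: U1_def V2_def)
  qed (use ord te assms(3) in auto)
  also have "real k * C * (sqrt U1 * sqrt V1) + C * (sqrt (U1 + U2) * sqrt (V1 + V2)) + real k * C * (sqrt U2 * sqrt V2) =
      real k * C * (sqrt U1 * sqrt V1 + sqrt U2 * sqrt V2) + C * (sqrt (U1 + U2) * sqrt (V1 + V2))"
    by (simp add: algebra_simps)
  \<comment> \<open>Cauchy-Schwarz in the plane: the two smaller staircases use disjoint ranges of
    \<open>m\<close> and of \<open>n\<close>, so together they cost no more than one staircase on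
    the whole block.\<close>
  also have "sqrt U1 * sqrt V1 + sqrt U2 * sqrt V2 \<le> sqrt (U1 + U2) * sqrt (V1 + V2)"
  proof -
    have "(sqrt U1 * sqrt V1 + sqrt U2 * sqrt V2)\<^sup>2 \<le> (U1 + U2) * (V1 + V2)"
    proof -
      have "0 \<le> (sqrt U1 * sqrt V2 - sqrt U2 * sqrt V1)\<^sup>2" by simp
      then have "2 * (sqrt U1 * sqrt V2 * (sqrt U2 * sqrt V1)) \<le> U1 * V2 + U2 * V1"
        using nn by (simp add: power2_diff power_mult_distrib)
      then show ?thesis using nn by (simp add: power2_sum power_mult_distrib algebra_simps)
    qed
    then show ?thesis unfolding real_sqrt_mult[symmetric] by (rule real_le_rsqrt)
  qed
  finally have "(\<Sum>m\<in>{s<..e}. \<Sum>n\<in>{t e<..t m}. \<phi> m n) \<le>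
      real k * C * (sqrt (U1 + U2) * sqrt (V1 + V2)) + C * (sqrt (U1 + U2) * sqrt (V1 + V2))"
    using assms(4) by (simp add: mult_left_mono)
  then have "(\<Sum>m\<in>{s<..e}. \<Sum>n\<in>{t e<..t m}. \<phi> m n) \<le>
      real (Suc k) * C * (sqrt (sum u {s<..e}) * sqrt (sum v {t e<..t s}))"
    unfolding U V by (simp add: algebra_simps)
  then show ?case by (simp only: e_def)
qed

section \<open>The divisor bound and Vaughan's identity\<close>

lemma card_divisors_prime_power_mult_le:
  fixes p m :: nat
  assumes "prime p" "m > 0"
  shows "card {d. d dvd p ^ a * m} \<le> (a + 1) * card {d. d dvd m}"
proof -
  have "{d. d dvd p ^ a * m} \<subseteq> (\<lambda>(i, d). p ^ i * d) ` ({..a} \<times> {d. d dvd m})"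
  proof
    fix d assume "d \<in> {d. d dvd p ^ a * m}"
    then have "d dvd p ^ a * m" by simp
    then obtain b c where "d = b * c" "b dvd p ^ a" "c dvd m" by (rule division_decomp[THEN exE]) blast
    moreover from this(2) assms(1) obtain i where "i \<le> a" "b = p ^ i" using divides_primepow_nat by blast
    ultimately show "d \<in> (\<lambda>(i, d). p ^ i * d) ` ({..a} \<times> {d. d dvd m})" by force
  qed
  then have "card {d. d dvd p ^ a * m} \<le> card ({..a} \<times> {d. d dvd m})"
    using assms(2) by (intro surj_card_le) auto
  then show ?thesis by (simp add: card_cartesian_product)
qed

text \<open>By multiplicativity each prime power \<open>p ^ a\<close> exactly dividing
  \<open>n\<close> costs the ratio of \<open>a + 1\<close> to
  \<open>p powr (\<epsilon> * a)\<close>. This is at most 1 once \<open>p\<close> is large and at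
  most \<open>c\<close> always, so only the boundedly many primes below \<open>B\<close> enlarge the
  constant.\<close>

lemma divisor_bound:
  fixes \<epsilon> :: real
  assumes "\<epsilon> > 0"
  obtains C where "C \<ge> 1" "\<And>n. n > 0 \<Longrightarrow> real (card {d. d dvd n}) \<le> C * real n powr \<epsilon>"
proof -
  \<comment> \<open>Made for \<open>1 + y \<le> exp y\<close> at
    \<open>y = \<epsilon> * a * ln 2\<close>: the second summand of \<open>c\<close> turns
    \<open>c * y\<close> into at least \<open>a\<close>.\<close>
  define c where "c = 1 + 1 / (\<epsilon> * ln 2)"
  have c: "c \<ge> 1" using assms by (simp add: c_def)
  have c_bound: "real a + 1 \<le> c * real p powr (\<epsilon> * real a)" if "p \<ge> 2" for a p :: nat
  proof -
    have "real a + 1 \<le> c * (1 + \<epsilon> * real a * ln 2)"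
      using assms by (simp add: c_def field_simps)
    also have "\<dots> \<le> c * exp (\<epsilon> * real a * ln 2)"
      using c by (intro mult_left_mono exp_ge_add_one_self) auto
    also have "\<dots> \<le> c * real p powr (\<epsilon> * real a)"
      using c assms that unfolding powr_def by (auto intro!: mult_left_mono)
    finally show ?thesis .
  qed
  \<comment> \<open>From \<open>B\<close> on, \<open>p powr \<epsilon> \<ge> 2\<close>, and
    \<open>a + 1 \<le> 2 ^ a\<close> suffices.\<close>
  define B where "B = nat \<lceil>2 powr (1 / \<epsilon>)\<rceil>"
  have B_bound: "real a + 1 \<le> real p powr (\<epsilon> * real a)" if "p \<ge> B" for a p :: nat
  proof -
    have "2 powr (1 / \<epsilon>) \<le> real p" using that unfolding B_def by linarith
    then have "(2 powr (1 / \<epsilon>)) powr \<epsilon> \<le> real p powr \<epsilon>" using assms by (intro powr_mono2) auto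
    then have 2: "2 \<le> real p powr \<epsilon>" using assms by (simp add: powr_powr)
    have "real a + 1 \<le> 2 ^ a" by (induction a) auto
    also have "\<dots> \<le> (real p powr \<epsilon>) ^ a" using 2 by (intro power_mono) auto
    also have "\<dots> = real p powr (\<epsilon> * real a)"
    proof -
      have "p > 0" using 2 by (intro gr0I) auto
      then show ?thesis by (simp add: powr_powr flip: powr_realpow)
    qed
    finally show ?thesis .
  qed
  define E where "E n = {p \<in> prime_factors n. p < B}" for n
  have main: "real (card {d. d dvd n}) \<le> c ^ card (E n) * real n powr \<epsilon>" if "n > 0" for n
    using that
  proof (induction n rule: less_induct)
    case (less n)
    show ?case
    proof (cases "n = 1")
      case True
      then show ?thesis using c by (simp add: E_def)
    next
      case False
      then obtain p where p: "prime p" "p dvd n" using prime_factor_nat by blast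
      define a where "a = multiplicity p n"
      obtain m where m: "n = p ^ a * m" "\<not> p dvd m"
        unfolding a_def using less.prems p(1) multiplicity_decompose'[of n p] not_prime_unit[of p]
        by (metis less_irrefl)
      have a: "a > 0" using p m less.prems by (cases a) auto
      have m0: "m > 0" using m less.prems by (intro gr0I) auto
      have p2: "p \<ge> 2" using p(1) by (rule prime_ge_2_nat)
      have "m < p ^ a * m" using one_less_power[of p a] p2 a m0 by simp
      then have "m < n" using m by simp
      note IH = less.IH[OF this m0]
      have npow: "real p powr (\<epsilon> * real a) * real m powr \<epsilon> = real n powr \<epsilon>"
        using p2 m0 by (simp add: m(1) powr_mult powr_powr mult.commute flip: powr_realpow)
      have pf: "prime_factors n = insert p (prime_factors m)"
      proof -
        have "prime_factors n = prime_factors (p ^ a) \<union> prime_factors m"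
          unfolding m(1) using p2 m0 by (intro prime_factors_product) auto
        also have "prime_factors (p ^ a) = {p}"
          using p(1) a by (simp add: prime_factorization_prime_power)
        finally show ?thesis by simp
      qed
      have pm: "p \<notin> prime_factors m" using m(2) by auto
      have "real (card {d. d dvd n}) \<le> (real a + 1) * real (card {d. d dvd m})"
      proof -
        have "card {d. d dvd n} \<le> (a + 1) * card {d. d dvd m}"
          using card_divisors_prime_power_mult_le[OF p(1) m0, of a] m(1) by simp
        then have "real (card {d. d dvd n}) \<le> real ((a + 1) * card {d. d dvd m})"
          by (simp only: of_nat_le_iff)
        then show ?thesis by (simp add: algebra_simps)
      qed
      also have "\<dots> \<le> (real a + 1) * (c ^ card (E m) * real m powr \<epsilon>)"
        by (intro mult_left_mono IH) auto
      also have "\<dots> \<le> c ^ card (E n) * (real p powr (\<epsilon> * real a) * real m powr \<epsilon>)"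
      proof (cases "p < B")
        case True
        have "E n = insert p (E m)" using True pf by (auto simp: E_def)
        moreover have "p \<notin> E m" "finite (E m)" using pm by (auto simp: E_def)
        ultimately have "card (E n) = Suc (card (E m))" by simp
        then have "c ^ card (E n) * (real p powr (\<epsilon> * real a) * real m powr \<epsilon>) =
            (c * real p powr (\<epsilon> * real a)) * (c ^ card (E m) * real m powr \<epsilon>)" by (simp add: mult_ac)
        moreover have "(real a + 1) * (c ^ card (E m) * real m powr \<epsilon>) \<le>
            (c * real p powr (\<epsilon> * real a)) * (c ^ card (E m) * real m powr \<epsilon>)"
          using c by (intro mult_right_mono c_bound p2) auto
        ultimately show ?thesis by (simp only:)
      next
        case False
        then have "E n = E m" using pf by (auto simp: E_def)
        then have "c ^ card (E n) * (real p powr (\<epsilon> * real a) * real m powr \<epsilon>) =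
            real p powr (\<epsilon> * real a) * (c ^ card (E m) * real m powr \<epsilon>)" by (simp add: mult_ac)
        then show ?thesis using B_bound[of p a] False c by (auto intro!: mult_right_mono)
      qed
      finally show ?thesis unfolding npow .
    qed
  qed
  show ?thesis
  proof (rule that)
    show "c ^ B \<ge> 1" using c by simp
    fix n :: nat assume n: "n > 0"
    have "card (E n) \<le> card {..<B}" by (intro card_mono) (auto simp: E_def)
    then have "c ^ card (E n) \<le> c ^ B" using c by (intro power_increasing) auto
    then have "c ^ card (E n) * real n powr \<epsilon> \<le> c ^ B * real n powr \<epsilon>" by (intro mult_right_mono) auto
    with main[OF n] show "real (card {d. d dvd n}) \<le> c ^ B * real n powr \<epsilon>" by linarith
  qed
qed

section \<open>The Moebius function and Vaughan's identity\<close>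

definition moebius :: "nat \<Rightarrow> real" where
  "moebius n = (if squarefree n then (-1) ^ card (prime_factors n) else 0)"

lemma abs_moebius_le: "\<bar>moebius n\<bar> \<le> 1"
  by (simp add: moebius_def power_abs)

text \<open>Squarefree divisors correspond to sets of prime factors, which turns the divisor sum of
  \<open>moebius\<close> into an expanded product of factors \<open>1 - 1\<close>.\<close>

lemma bij_betw_squarefree_divisors:
  fixes n :: nat
  assumes "n > 0"
  shows "bij_betw prime_factors {d. d dvd n \<and> squarefree d} (Pow (prime_factors n))"
proof (rule bij_betw_byWitness[where f' = "\<lambda>A. \<Prod>A"])
  show "\<forall>d\<in>{d. d dvd n \<and> squarefree d}. \<Prod>(prime_factors d) = d"
  proof
    fix d assume "d \<in> {d. d dvd n \<and> squarefree d}"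
    then have d: "d \<noteq> 0" "squarefree d" using assms by auto
    have "(\<Prod>p\<in>prime_factors d. p ^ multiplicity p d) = d"
      using d(1) by (simp add: prod_prime_factors)
    moreover have "(\<Prod>p\<in>prime_factors d. p ^ multiplicity p d) = \<Prod>(prime_factors d)"
      using d by (intro prod.cong refl) (auto simp: squarefree_factorial_semiring')
    ultimately show "\<Prod>(prime_factors d) = d" by simp
  qed
  have fin: "finite A" and pr: "\<forall>p\<in>A. prime p" if "A \<in> Pow (prime_factors n)" for A
    using that by (auto intro: finite_subset)
  have pf: "prime_factors (\<Prod>A) = A" if "A \<in> Pow (prime_factors n)" for A
  proof -
    have "0 \<notin> A" using pr[OF that] not_prime_0 by blast
    then have "prime_factors (\<Prod>A) = (\<Union>p\<in>A. prime_factors p)"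
      using prime_factors_prod[OF fin[OF that], of "\<lambda>x. x"] by simp
    then show ?thesis using pr[OF that] by (auto simp: prime_prime_factors)
  qed
  then show "\<forall>A\<in>Pow (prime_factors n). prime_factors (\<Prod>A) = A" by blast
  show "prime_factors ` {d. d dvd n \<and> squarefree d} \<subseteq> Pow (prime_factors n)"
    using assms by (auto dest: dvd_trans simp: prime_factors_dvd)
  show "(\<lambda>A. \<Prod>A) ` Pow (prime_factors n) \<subseteq> {d. d dvd n \<and> squarefree d}"
  proof safe
    fix A assume A: "A \<subseteq> prime_factors n"
    then have A': "A \<in> Pow (prime_factors n)" by simp
    have "\<Prod>A dvd \<Prod>(prime_factors n)" using A by (intro prod_dvd_prod_subset) auto
    also have "\<Prod>(prime_factors n) dvd (\<Prod>p\<in>prime_factors n. p ^ multiplicity p n)"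
      by (intro prod_dvd_prod) (auto simp: prime_factors_multiplicity intro!: dvd_power)
    also have "\<dots> = n" using assms by (simp add: prod_prime_factors)
    finally show "\<Prod>A dvd n" .
    show "squarefree (\<Prod>A)"
      using pr[OF A'] by (intro squarefree_prod_coprime primes_coprime) (auto intro: squarefree_prime)
  qed
qed

lemma sum_moebius_divisors:
  assumes "n > 0"
  shows "(\<Sum>d | d dvd n. moebius d) = (if n = 1 then 1 else 0)"
proof -
  have "(\<Sum>d | d dvd n. moebius d) = (\<Sum>d | d dvd n \<and> squarefree d. (-1) ^ card (prime_factors d))"
    using assms by (intro sum.mono_neutral_cong_right) (auto simp: moebius_def)
  also have "\<dots> = (\<Sum>A\<in>Pow (prime_factors n). (-1) ^ card A)"
    by (rule sum.reindex_bij_betw[OF bij_betw_squarefree_divisors[OF assms]])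
  also have "\<dots> = (\<Prod>p\<in>prime_factors n. 1 - 1 :: real)"
    by (subst prod_diff_conv_sum) auto
  also have "\<dots> = (if n = 1 then 1 else 0)"
    using assms by (auto simp: card_gt_0_iff prime_factorization_empty_iff)
  finally show ?thesis .
qed

lemma sum_hyperbola:
  fixes F :: "nat \<Rightarrow> nat \<Rightarrow> real"
  shows "(\<Sum>d=1..x. \<Sum>k=1..x div d. F d k) = (\<Sum>n=1..x. \<Sum>d | d dvd n. F d (n div d))"
proof -
  have "(\<Sum>d=1..x. \<Sum>k=1..x div d. F d k) = (\<Sum>(d,k)\<in>Sigma {1..x} (\<lambda>d. {1..x div d}). F d k)"
    by (rule sum.Sigma) auto
  also have "\<dots> = (\<Sum>(n,d)\<in>Sigma {1..x} (\<lambda>n. {d. d dvd n}). F d (n div d))"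
  proof (rule sum.reindex_bij_witness[where i = "\<lambda>(n,d). (d, n div d)" and j = "\<lambda>(d,k). (d * k, d)"])
    fix z assume "z \<in> Sigma {1..x} (\<lambda>d. {1..x div d})"
    then obtain d k where z: "z = (d, k)" "1 \<le> d" "1 \<le> k" "k \<le> x div d" by auto
    then have "d * k \<le> x" using less_eq_div_iff_mult_less_eq[of d k x] by (simp add: mult.commute)
    then show "(case z of (d,k) \<Rightarrow> (d * k, d)) \<in> Sigma {1..x} (\<lambda>n. {d. d dvd n})" using z by auto
    show "(case (case z of (d,k) \<Rightarrow> (d * k, d)) of (n,d) \<Rightarrow> (d, n div d)) = z" using z by auto
    show "(case (case z of (d,k) \<Rightarrow> (d * k, d)) of (n,d) \<Rightarrow> F d (n div d)) = (case z of (d, k) \<Rightarrow> F d k)" using z by auto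
  next
    fix z assume "z \<in> Sigma {1..x} (\<lambda>n. {d. d dvd n})"
    then obtain n d where z: "z = (n, d)" "1 \<le> n" "n \<le> x" "d dvd n" by auto
    then obtain k where k: "n = d * k" by auto
    with z have "d \<ge> 1" "k \<ge> 1" "k * d \<le> x" by (auto simp: Suc_le_eq mult.commute)
    moreover from this have "k \<le> x div d" using less_eq_div_iff_mult_less_eq[of d k x] by simp
    moreover have "d \<le> x" using \<open>k \<ge> 1\<close> \<open>k * d \<le> x\<close> by (metis le_trans mult_le_mono1 nat_mult_1)
    ultimately show "(case z of (n,d) \<Rightarrow> (d, n div d)) \<in> Sigma {1..x} (\<lambda>d. {1..x div d})" using z k by auto
    show "(case (case z of (n,d) \<Rightarrow> (d, n div d)) of (d,k) \<Rightarrow> (d * k, d)) = z" using z k by auto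
  qed
  also have "\<dots> = (\<Sum>n=1..x. \<Sum>d | d dvd n. F d (n div d))"
    by (rule sum.Sigma[symmetric]) auto
  finally show ?thesis .
qed

lemma sum_hyperbola_swap:
  fixes F :: "nat \<Rightarrow> nat \<Rightarrow> real"
  shows "(\<Sum>d=1..x. \<Sum>k=1..x div d. F d k) = (\<Sum>k=1..x. \<Sum>d=1..x div k. F d k)"
proof -
  have *: "{1..x div d} = {k. k \<in> {1..x} \<and> d * k \<le> x}" if "d \<in> {1..x}" for d
    using that less_eq_div_iff_mult_less_eq[of d _ x] order_trans[OF div_le_dividend[of x d]]
    by (auto simp: mult.commute) (metis div_le_dividend le_trans)
  have "(\<Sum>d=1..x. \<Sum>k=1..x div d. F d k) = (\<Sum>d=1..x. \<Sum>k | k \<in> {1..x} \<and> d * k \<le> x. F d k)"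
    by (intro sum.cong refl) (simp only: *)
  also have "\<dots> = (\<Sum>k=1..x. \<Sum>d | d \<in> {1..x} \<and> d * k \<le> x. F d k)"
    by (rule sum.swap_restrict) auto
  also have "\<dots> = (\<Sum>k=1..x. \<Sum>d=1..x div k. F d k)"
    by (intro sum.cong refl) (simp only: * mult.commute)
  finally show ?thesis .
qed

text \<open>The Dirichlet convolution of the constant 1 with Moebius cut off at \<open>U\<close>; on
  \<open>{1..U}\<close> the cut-off is invisible and the value is that of the full
  convolution.\<close>

definition trunc_moebius_sum :: "nat \<Rightarrow> nat \<Rightarrow> real" where
  "trunc_moebius_sum U m = (\<Sum>b | b dvd m. if b \<le> U then moebius b else 0)"

text \<open>\<open>G f\<close> sums the convolution of truncated Moebius, the constant 1 and
  \<open>f\<close> against \<open>e\<close>, and is linear in \<open>f\<close>. For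
  \<open>f = mangoldt\<close> the last two factors convolve to \<open>ln\<close>; for
  \<open>Lo\<close> both outer variables stay below \<open>U\<close>; these are the two type I sums.
  Since \<open>mangoldt\<close> is \<open>Lo\<close> plus \<open>Hi\<close>, the remainder is the
  sum of \<open>Hi\<close> minus \<open>G Hi\<close>, the type II sum.\<close>

lemma vaughan_identity:
  fixes e :: "nat \<Rightarrow> real"
  assumes "1 \<le> U" "U \<le> x"
  shows "(\<Sum>n=1..x. mangoldt n * e n) =
    (\<Sum>n=1..U. mangoldt n * e n)
    + (\<Sum>b=1..U. moebius b * (\<Sum>j=1..x div b. ln (real j) * e (b * j)))
    - (\<Sum>b=1..U. \<Sum>c=1..U. moebius b * mangoldt c * (\<Sum>k=1..x div b div c. e (b * c * k)))
    + (\<Sum>m=1..x. \<Sum>c\<in>{U<..x div m}. ((if m = 1 then 1 else 0) - trunc_moebius_sum U m) * mangoldt c * e (m * c))"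
proof -
  define G where "G f = (\<Sum>m=1..x. \<Sum>c=1..x div m. trunc_moebius_sum U m * f c * e (m * c))" for f :: "nat \<Rightarrow> real"
  define Lo where "Lo c = (if c \<le> U then mangoldt c else 0 :: real)" for c
  define Hi where "Hi c = (if c \<le> U then 0 else mangoldt c :: real)" for c
  have G: "G f = (\<Sum>b=1..U. moebius b * (\<Sum>k=1..x div b. \<Sum>c=1..x div b div k. f c * e (b * (k * c))))" for f
  proof -
    define F where "F b k = (if b \<le> U then moebius b * (\<Sum>c=1..x div b div k. f c * e (b * (k * c))) else 0)" for b k
    have "G f = (\<Sum>m=1..x. \<Sum>b | b dvd m. F b (m div b))"
      unfolding G_def
    proof (rule sum.cong[OF refl])
      fix m assume m: "m \<in> {1..x}"
      have "(\<Sum>c=1..x div m. trunc_moebius_sum U m * f c * e (m * c)) =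
          (\<Sum>b | b dvd m. (if b \<le> U then moebius b else 0) * (\<Sum>c=1..x div m. f c * e (m * c)))"
        by (simp add: trunc_moebius_sum_def sum_distrib_left sum_distrib_right mult_ac sum.swap[of _ "{b. b dvd m}"])
      also have "\<dots> = (\<Sum>b | b dvd m. F b (m div b))"
        using m by (intro sum.cong refl) (auto simp: F_def div_mult2_eq[symmetric] mult.assoc[symmetric] elim!: dvdE)
      finally show "(\<Sum>c=1..x div m. trunc_moebius_sum U m * f c * e (m * c)) = (\<Sum>b | b dvd m. F b (m div b))" .
    qed
    also have "\<dots> = (\<Sum>b=1..x. \<Sum>k=1..x div b. F b k)" by (rule sum_hyperbola[symmetric])
    also have "\<dots> = (\<Sum>b=1..U. \<Sum>k=1..x div b. F b k)"
      using assms(2) by (intro sum.mono_neutral_right) (auto simp: F_def)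
    also have "\<dots> = (\<Sum>b=1..U. moebius b * (\<Sum>k=1..x div b. \<Sum>c=1..x div b div k. f c * e (b * (k * c))))"
      by (intro sum.cong refl) (simp add: F_def sum_distrib_left)
    finally show ?thesis .
  qed
  have GL: "G mangoldt = (\<Sum>b=1..U. moebius b * (\<Sum>j=1..x div b. ln (real j) * e (b * j)))"
    unfolding G
  proof (rule sum.cong[OF refl], rule arg_cong2[where f = times, OF refl])
    fix b
    define y where "y = x div b"
    have "(\<Sum>k=1..y. \<Sum>c=1..y div k. mangoldt c * e (b * (k * c))) = (\<Sum>c=1..y. \<Sum>k=1..y div c. mangoldt c * e (b * (k * c)))"
      by (rule sum_hyperbola_swap)
    also have "\<dots> = (\<Sum>j=1..y. \<Sum>c | c dvd j. mangoldt c * e (b * (j div c * c)))"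
      by (rule sum_hyperbola)
    also have "\<dots> = (\<Sum>j=1..y. ln (real j) * e (b * j))"
    proof (intro sum.cong refl)
      fix j assume j: "j \<in> {1..y}"
      have "(\<Sum>c | c dvd j. mangoldt c * e (b * (j div c * c))) = (\<Sum>c | c dvd j. mangoldt c) * e (b * j)"
        by (simp add: sum_distrib_right)
      then show "(\<Sum>c | c dvd j. mangoldt c * e (b * (j div c * c))) = ln (real j) * e (b * j)"
        using j mangoldt_sum[of j, where ?'a = real] by simp
    qed
    finally show "(\<Sum>k=1..x div b. \<Sum>c=1..x div b div k. mangoldt c * e (b * (k * c))) = (\<Sum>j=1..x div b. ln (real j) * e (b * j))"
      by (simp only: y_def)
  qed
  have GLo: "G Lo = (\<Sum>b=1..U. \<Sum>c=1..U. moebius b * mangoldt c * (\<Sum>k=1..x div b div c. e (b * c * k)))"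
    unfolding G
  proof (rule sum.cong[OF refl])
    fix b assume "b \<in> {1..U}"
    define y where "y = x div b"
    have "(\<Sum>k=1..y. \<Sum>c=1..y div k. Lo c * e (b * (k * c))) = (\<Sum>c=1..y. \<Sum>k=1..y div c. Lo c * e (b * (k * c)))"
      by (rule sum_hyperbola_swap)
    also have "\<dots> = (\<Sum>c=1..y. Lo c * (\<Sum>k=1..y div c. e (b * c * k)))"
      by (simp add: sum_distrib_left mult_ac)
    \<comment> \<open>Beyond \<open>y\<close> the inner sums are empty because
      \<open>y div c = 0\<close>, so the range may be enlarged until it contains
      \<open>{1..U}\<close>; \<open>Lo\<close> then cuts it down to that interval.\<close>
    also have "\<dots> = (\<Sum>c=1..y + U. Lo c * (\<Sum>k=1..y div c. e (b * c * k)))"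
      by (intro sum.mono_neutral_left) auto
    also have "\<dots> = (\<Sum>c=1..U. mangoldt c * (\<Sum>k=1..y div c. e (b * c * k)))"
      by (intro sum.mono_neutral_cong_right) (auto simp: Lo_def)
    finally show "moebius b * (\<Sum>k=1..x div b. \<Sum>c=1..x div b div k. Lo c * e (b * (k * c))) =
        (\<Sum>c=1..U. moebius b * mangoldt c * (\<Sum>k=1..x div b div c. e (b * c * k)))"
      unfolding y_def[symmetric] by (simp only: sum_distrib_left mult.assoc)
  qed
  have "(\<Sum>m=1..x. \<Sum>c\<in>{U<..x div m}. ((if m = 1 then 1 else 0) - trunc_moebius_sum U m) * mangoldt c * e (m * c)) =
     (\<Sum>m=1..x. \<Sum>c=1..x div m. ((if m = 1 then 1 else 0) - trunc_moebius_sum U m) * Hi c * e (m * c))"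
    using assms(1) by (intro sum.cong[OF refl] sum.mono_neutral_cong_left) (auto simp: Hi_def)
  also have "\<dots> = (\<Sum>m=1..x. \<Sum>c=1..x div m. (if m = 1 then 1 else 0) * Hi c * e (m * c)) - G Hi"
    unfolding G_def sum_subtractf[symmetric] by (simp add: algebra_simps)
  also have "(\<Sum>m=1..x. \<Sum>c=1..x div m. (if m = 1 then 1 else 0) * Hi c * e (m * c)) = (\<Sum>m=1..x. if m = 1 then (\<Sum>c=1..x. Hi c * e c) else 0)"
    by (intro sum.cong refl) auto
  also have "\<dots> = (\<Sum>c=1..x. Hi c * e c)" using assms by (subst sum.delta) auto
  also have "\<dots> = (\<Sum>c=1..x. mangoldt c * e c) - (\<Sum>c=1..x. Lo c * e c)"
    unfolding sum_subtractf[symmetric] by (intro sum.cong) (auto simp: Hi_def Lo_def)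
  also have "(\<Sum>c=1..x. Lo c * e c) = (\<Sum>c=1..U. mangoldt c * e c)"
    using assms by (intro sum.mono_neutral_cong_right) (auto simp: Lo_def)
  also have "G Hi = G mangoldt - G Lo"
    unfolding G_def sum_subtractf[symmetric] by (intro sum.cong refl) (auto simp: Hi_def Lo_def algebra_simps)
  finally show ?thesis by (simp add: GL GLo)
qed

text \<open>Confines the type II coefficients to \<open>m > U\<close>, so that both variables of
  that sum exceed \<open>U\<close>.\<close>

lemma trunc_moebius_sum_eq:
  assumes "0 < m" "m \<le> U"
  shows "trunc_moebius_sum U m = (if m = 1 then 1 else 0)"
proof -
  have "trunc_moebius_sum U m = (\<Sum>b | b dvd m. moebius b)"
    unfolding trunc_moebius_sum_def using assms by (intro sum.cong) (auto dest: dvd_imp_le)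
  then show ?thesis using sum_moebius_divisors[OF assms(1)] by simp
qed

lemma abs_trunc_moebius_sum_le:
  assumes "m > 0"
  shows "\<bar>trunc_moebius_sum U m\<bar> \<le> real (card {d. d dvd m})"
proof -
  have "\<bar>trunc_moebius_sum U m\<bar> \<le> (\<Sum>b | b dvd m. 1)"
    unfolding trunc_moebius_sum_def using abs_moebius_le by (intro order_trans[OF sum_abs] sum_mono) auto
  then show ?thesis by simp
qed

section \<open>Type I sums: deviations along an interval\<close>

lemma res_dev_mult:
  assumes "prime q" "\<not> q dvd b"
  obtains s where "1 \<le> s" "s < q"
    "\<And>k. res_dev q (b * k) = (if k mod q = s then 1 else 0) - (if q dvd k then 0 else 1 / (real q - 1))"
proof -
  obtain \<sigma> where bij: "bij_betw \<sigma> {1..<q} {1..<q}"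
    and \<sigma>: "\<And>m n. (m * n) mod q = 1 \<longleftrightarrow> m mod q \<in> {1..<q} \<and> n mod q = \<sigma> (m mod q)"
    using res_inverse_ex[OF assms(1)] by metis
  have b: "b mod q \<in> {1..<q}" using assms by (auto simp: prime_gt_0_nat Suc_le_eq mod_greater_zero_iff_not_dvd)
  then have s: "\<sigma> (b mod q) \<in> {1..<q}" using bij by (auto simp: bij_betw_def)
  show ?thesis
  proof (rule that)
    fix k
    show "res_dev q (b * k) = (if k mod q = \<sigma> (b mod q) then 1 else 0) - (if q dvd k then 0 else 1 / (real q - 1))"
      unfolding res_dev_def \<sigma> using b assms by (simp add: prime_dvd_mult_iff)
  qed (use s in auto)
qed

text \<open>A full period sums to 0: one hit against \<open>q - 1\<close> shares of
  \<open>1 / (q - 1)\<close>. The remainder modulo \<open>q\<close> leaves 0 or 1 minus a number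
  between 0 and 1, whatever the length \<open>y\<close>.\<close>

lemma abs_sum_res_dev_le:
  assumes "prime q" "\<not> q dvd b"
  shows "\<bar>\<Sum>k=1..y. res_dev q (b * k)\<bar> \<le> 1"
proof -
  have q: "q > 1" using assms(1) by (rule prime_gt_1_nat)
  obtain s where s: "1 \<le> s" "s < q"
    "\<And>k. res_dev q (b * k) = (if k mod q = s then 1 else 0) - (if q dvd k then 0 else 1 / (real q - 1))"
    using res_dev_mult[OF assms] by metis
  have "(\<Sum>k=1..y. res_dev q (b * k)) = (if s \<le> y mod q then 1 else 0) - real (y mod q) / (real q - 1)"
  proof (induction y)
    case (Suc y)
    show ?case
    proof (cases "Suc (y mod q) = q")
      case True
      then have 0: "Suc y mod q = 0" by (simp add: mod_Suc)
      moreover have "real (y mod q) = real q - 1" using True by linarith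
      moreover have "s \<le> y mod q" using True s(2) by linarith
      ultimately show ?thesis using Suc s q by (simp add: mod_eq_0_iff_dvd)
    next
      case False
      then have m: "Suc y mod q = Suc (y mod q)" by (simp add: mod_Suc)
      then have "\<not> q dvd Suc y" by (simp flip: mod_eq_0_iff_dvd)
      then show ?thesis using Suc s(1) m by (auto simp: s(3) add_divide_distrib)
    qed
  qed (use s in simp)
  moreover have "0 \<le> real (y mod q) / (real q - 1)" "real (y mod q) / (real q - 1) \<le> 1"
  proof -
    have "real (y mod q) + 1 \<le> real q" using mod_less_divisor[of q y] q by linarith
    then show "0 \<le> real (y mod q) / (real q - 1)" "real (y mod q) / (real q - 1) \<le> 1"
      using q by auto
  qed
  ultimately show ?thesis by (auto simp: abs_if)
qed

text \<open>Partial summation for a nondecreasing weight, meant for the logarithm in the first type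
  I sum.\<close>

lemma abs_sum_mono_mult_le:
  fixes f g :: "nat \<Rightarrow> real"
  assumes G: "\<And>j. \<bar>\<Sum>k=1..j. g k\<bar> \<le> 1" and mono: "\<And>k. k \<ge> 1 \<Longrightarrow> f k \<le> f (Suc k)" and "f 1 \<ge> 0"
  shows "y \<ge> 1 \<Longrightarrow> \<bar>\<Sum>k=1..y. f k * g k\<bar> \<le> 2 * f y"
proof -
  have *: "\<bar>(\<Sum>k=1..y. f k * g k) - f y * (\<Sum>k=1..y. g k)\<bar> \<le> f y - f 1 \<and> f 1 \<le> f y" if "y \<ge> 1"
    using that
  proof (induction y rule: nat_induct_at_least)
    case (Suc y)
    define Gy where "Gy = (\<Sum>k=1..y. g k)"
    have "(\<Sum>k=1..Suc y. f k * g k) - f (Suc y) * (\<Sum>k=1..Suc y. g k) =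
       ((\<Sum>k=1..y. f k * g k) - f y * Gy) - (f (Suc y) - f y) * Gy"
      by (simp add: algebra_simps Gy_def)
    moreover have "\<bar>(f (Suc y) - f y) * Gy\<bar> \<le> (f (Suc y) - f y) * 1"
      unfolding abs_mult using G[of y] mono[OF Suc.hyps] by (intro mult_mono) (auto simp: Gy_def)
    moreover have "\<bar>X\<bar> \<le> F' - F1" if "X = Y - Z" "\<bar>Z\<bar> \<le> (F' - F) * 1" "\<bar>Y\<bar> \<le> F - F1" for X Y Z F F' F1 :: real
      using that by (auto simp: abs_le_iff)
    ultimately show ?case
      using Suc.IH mono[OF Suc.hyps] unfolding Gy_def by (meson order_trans)
  qed simp
  assume "y \<ge> 1"
  note * = *[OF this]
  have "\<bar>f y * (\<Sum>k=1..y. g k)\<bar> \<le> f y * 1"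
    unfolding abs_mult using G[of y] * assms(3) by (intro mult_mono) auto
  with * assms(3) show ?thesis by linarith
qed

section \<open>Type II sums and Chebyshev estimates\<close>

text \<open>In a dyadic block of \<open>m\<close> the hyperbola \<open>n \<le> x div m\<close>
  bounds a staircase standing on a full rectangle. The rectangle costs one bilinear estimate and the
  \<open>i\<close> halvings of the block one each, hence the factor \<open>Suc i\<close>.\<close>

lemma type2_block:
  fixes f g :: "nat \<Rightarrow> real"
  assumes "finite S" and S: "\<And>q. q \<in> S \<Longrightarrow> prime q \<and> real q \<ge> D0 \<and> q \<le> D" and D: "D > 0" "D0 > 0"
    and T: "T = max U (x div 2 ^ i)"
  shows "(\<Sum>m\<in>{2 ^ i<..2 ^ Suc i}. \<Sum>n\<in>{U<..x div m}. f m * g n * (\<Sum>q\<in>S. res_dev q (m * n))) \<le>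
    real (Suc i) * (6 / D0 * sqrt (real (2 ^ Suc i + 1 + D\<^sup>2) * real (T + 1 + D\<^sup>2))) *
      (sqrt (\<Sum>m\<in>{2 ^ i<..2 ^ Suc i}. (f m)\<^sup>2) * sqrt (\<Sum>n\<in>{U<..T}. (g n)\<^sup>2))"
proof -
  define \<phi> where "\<phi> m n = f m * g n * (\<Sum>q\<in>S. res_dev q (m * n))" for m n
  define C where "C = 6 / D0 * sqrt (real (2 ^ Suc i + 1 + D\<^sup>2) * real (T + 1 + D\<^sup>2))"
  define t where "t m = max U (x div m)" for m
  define s :: nat where "s = 2 ^ i"
  define e :: nat where "e = 2 ^ Suc i"
  have e: "e = s + 2 ^ i" by (simp add: s_def e_def)
  have s0: "s > 0" by (simp add: s_def)
  have C: "C \<ge> 0" using D by (simp add: C_def)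
  have rect: "(\<Sum>m\<in>I. \<Sum>n\<in>J. \<phi> m n) \<le> C * (sqrt (\<Sum>m\<in>I. (f m)\<^sup>2) * sqrt (\<Sum>n\<in>J. (g n)\<^sup>2))"
    if "I \<subseteq> {s<..e}" "J \<subseteq> {..<T + 1}" for I J
    unfolding \<phi>_def C_def using that by (intro bilinear_res_dev assms) (auto simp: e_def)
  have mono: "t m' \<le> t m" if "s \<le> m" "m \<le> m'" for m m'
    unfolding t_def using that s0 by (intro max.mono div_le_mono2) auto
  have tT: "t s = T" by (simp add: t_def T s_def)
  have stair: "(\<Sum>m\<in>{s<..s + 2 ^ i}. \<Sum>n\<in>{t (s + 2 ^ i)<..t m}. \<phi> m n) \<le>
      real i * C * (sqrt (\<Sum>m\<in>{s<..s + 2 ^ i}. (f m)\<^sup>2) * sqrt (\<Sum>n\<in>{t (s + 2 ^ i)<..t s}. (g n)\<^sup>2))"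
    by (rule staircase_bilinear[where l = "T + 1" and ?s0.0 = s and ?s1.0 = e])
       (use rect mono C tT e in auto)
  define A where "A = sqrt (\<Sum>m\<in>{s<..e}. (f m)\<^sup>2)"
  define B where "B = sqrt (\<Sum>n\<in>{U<..T}. (g n)\<^sup>2)"
  have "(\<Sum>m\<in>{s<..e}. \<Sum>n\<in>{U<..x div m}. \<phi> m n) =
     (\<Sum>m\<in>{s<..e}. (\<Sum>n\<in>{U<..t e}. \<phi> m n) + (\<Sum>n\<in>{t e<..t m}. \<phi> m n))"
  proof (rule sum.cong[OF refl])
    fix m assume m: "m \<in> {s<..e}"
    have "t e \<le> t m" using m by (intro mono) auto
    then have "{U<..x div m} = {U<..t e} \<union> {t e<..t m}" by (auto simp: t_def)
    then show "(\<Sum>n\<in>{U<..x div m}. \<phi> m n) = (\<Sum>n\<in>{U<..t e}. \<phi> m n) + (\<Sum>n\<in>{t e<..t m}. \<phi> m n)"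
      by (simp only:) (intro sum.union_disjoint, auto)
  qed
  also have "\<dots> = (\<Sum>m\<in>{s<..e}. \<Sum>n\<in>{U<..t e}. \<phi> m n) + (\<Sum>m\<in>{s<..e}. \<Sum>n\<in>{t e<..t m}. \<phi> m n)"
    by (rule sum.distrib)
  also have "(\<Sum>m\<in>{s<..e}. \<Sum>n\<in>{U<..t e}. \<phi> m n) \<le> C * (A * B)"
  proof (rule order_trans[OF rect])
    have te: "t e \<le> T" unfolding tT[symmetric] using e by (intro mono) auto
    then show "{U<..t e} \<subseteq> {..<T + 1}" by auto
    show "C * (sqrt (\<Sum>m\<in>{s<..e}. (f m)\<^sup>2) * sqrt (\<Sum>n\<in>{U<..t e}. (g n)\<^sup>2)) \<le> C * (A * B)"
      unfolding A_def B_def using C te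
      by (intro mult_left_mono mult_mono real_sqrt_le_mono sum_mono2 order_refl) (auto simp: sum_nonneg)
  qed simp
  also have "(\<Sum>m\<in>{s<..e}. \<Sum>n\<in>{t e<..t m}. \<phi> m n) \<le> real i * C * (A * B)"
  proof -
    have "sqrt (\<Sum>n\<in>{t e<..t s}. (g n)\<^sup>2) \<le> B"
      unfolding B_def tT by (intro real_sqrt_le_mono sum_mono2) (auto simp: t_def)
    then have "real i * C * (A * sqrt (\<Sum>n\<in>{t e<..t s}. (g n)\<^sup>2)) \<le> real i * C * (A * B)"
      using C by (intro mult_left_mono) (auto simp: A_def sum_nonneg)
    with stair show ?thesis unfolding A_def e[symmetric] by linarith
  qed
  finally have "(\<Sum>m\<in>{s<..e}. \<Sum>n\<in>{U<..x div m}. \<phi> m n) \<le> real (Suc i) * C * (A * B)"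
    by (simp add: algebra_simps)
  then show ?thesis unfolding \<phi>_def C_def A_def B_def s_def e_def .
qed

text \<open>As \<open>f\<close> vanishes up to \<open>U\<close> and \<open>n > U\<close>, only
  blocks with \<open>2 ^ Suc i > U\<close> and \<open>x div 2 ^ i > U\<close> survive. There
  \<open>y = 2 ^ i\<close> lies between \<open>U / 2\<close> and \<open>x / U\<close>, which bounds
  the product of the two large sieve factors by \<open>Z\<^sup>2\<close> independently of the block.
  A surviving block starts at or below \<open>x\<close> but may run past it, hence the range
  \<open>2 * x\<close> for \<open>f\<close>.\<close>

lemma type2_bound:
  fixes f g :: "nat \<Rightarrow> real"
  assumes "finite S" and S: "\<And>q. q \<in> S \<Longrightarrow> prime q \<and> real q \<ge> D0 \<and> q \<le> D" and D: "D > 0" "D0 > 0"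
    and U: "1 \<le> U" and n: "x \<le> 2 ^ n"
    and f0: "\<And>m. 1 \<le> m \<Longrightarrow> m \<le> U \<Longrightarrow> f m = 0"
    and F: "\<And>m. 1 \<le> m \<Longrightarrow> m \<le> 2 * x \<Longrightarrow> \<bar>f m\<bar> \<le> F" "F \<ge> 0"
    and G: "\<And>m. 1 \<le> m \<Longrightarrow> m \<le> x \<Longrightarrow> \<bar>g m\<bar> \<le> G" "G \<ge> 0"
    and Z: "7 * (real x + real x * (real D)\<^sup>2 / real U) + (real D) ^ 4 \<le> Z\<^sup>2" "Z \<ge> 0"
  shows "(\<Sum>m=1..x. \<Sum>n\<in>{U<..x div m}. f m * g n * (\<Sum>q\<in>S. res_dev q (m * n))) \<le>
    (real n)\<^sup>2 * (6 * F * G * sqrt (real x) * Z / D0)"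
proof -
  define h where "h m = (\<Sum>n\<in>{U<..x div m}. f m * g n * (\<Sum>q\<in>S. res_dev q (m * n)))" for m
  define E where "E = 6 * F * G * sqrt (real x) * Z / D0"
  have E: "E \<ge> 0" using F(2) G(2) Z(2) D by (simp add: E_def)
  have block: "(\<Sum>m\<in>{2 ^ i<..2 ^ Suc i}. h m) \<le> real (Suc i) * E" for i
  proof (cases "2 ^ Suc i \<le> U \<or> x div 2 ^ i \<le> U")
    case True
    have "h m = 0" if m: "m \<in> {2 ^ i<..2 ^ Suc i}" for m
    proof (cases "2 ^ Suc i \<le> U")
      case True
      then have "f m = 0" using m by (intro f0) auto
      then show ?thesis by (simp add: h_def)
    next
      case False
      with True have "x div 2 ^ i \<le> U" by simp
      moreover have "x div m \<le> x div 2 ^ i" using m by (intro div_le_mono2) auto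
      ultimately have "{U<..x div m} = {}" by auto
      then show ?thesis by (simp add: h_def)
    qed
    then show ?thesis using E by simp
  next
    case False
    define y :: real where "y = 2 ^ i"
    define w where "w = x div 2 ^ i"
    have Uw: "U < w" "U < 2 ^ Suc i" using False by (auto simp: w_def)
    have y: "y \<ge> 1" by (simp add: y_def)
    have "w * 2 ^ i \<le> x" unfolding w_def by simp
    then have "real (w * 2 ^ i) \<le> real x" by (simp only: of_nat_le_iff)
    then have wy: "real w * y \<le> real x" by (simp add: y_def)
    then have w: "real w \<le> real x / y" using y by (simp add: field_simps)
    have Uy: "real U < 2 * y" using Uw(2) unfolding y_def
      by (metis of_nat_less_iff of_nat_numeral of_nat_power power_Suc)
    have "real U * y \<le> real w * y" using Uw y by (intro mult_right_mono) auto
    then have yx: "real U * y \<le> real x" using wy by linarith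
    have x1: "y \<le> real x" using yx U y by (smt (verit, best) mult_le_cancel_right1 of_nat_1 of_nat_le_iff)
    have yU: "y \<le> real x / real U" using yx U by (simp add: field_simps)
    have iy: "1 / y \<le> 2 / real U" using Uy y U by (simp add: field_simps)
    define A where "A = real (2 ^ Suc i + 1 + D\<^sup>2)"
    define B where "B = real (w + 1 + D\<^sup>2)"
    have A: "A \<le> 3 * y + (real D)\<^sup>2" using y by (simp add: A_def y_def)
    have B: "B \<le> 2 * real x / y + (real D)\<^sup>2"
      using w x1 y by (simp add: B_def field_simps)
    \<comment> \<open>The mixed terms are \<open>3 * D\<^sup>2 * y\<close> and
      \<open>2 * D\<^sup>2 * x / y\<close>; with \<open>y \<le> x / U\<close> and
      \<open>1 / y \<le> 2 / U\<close> they add up to the 7 in the hypothesis on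
      \<open>Z\<close>.\<close>
    have "A * B \<le> (3 * y + (real D)\<^sup>2) * (2 * real x / y + (real D)\<^sup>2)"
      using A B y by (intro mult_mono) (auto simp: B_def)
    also have "\<dots> = 6 * real x + 3 * (real D)\<^sup>2 * y + 2 * (real D)\<^sup>2 * real x * (1 / y) + (real D) ^ 4"
      using y by (simp add: field_simps power2_eq_square power4_eq_xxxx)
    also have "\<dots> \<le> 6 * real x + 3 * (real D)\<^sup>2 * (real x / real U) + 2 * (real D)\<^sup>2 * real x * (2 / real U) + (real D) ^ 4"
      using yU iy by (intro add_mono mult_left_mono) auto
    also have "\<dots> \<le> 7 * (real x + real x * (real D)\<^sup>2 / real U) + (real D) ^ 4"
      by (simp add: algebra_simps)
    also note Z(1)
    finally have AB: "sqrt (A * B) \<le> Z" using Z(2) by (intro real_le_lsqrt) auto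
    have "(\<Sum>m\<in>{2 ^ i<..2 ^ Suc i}. (f m)\<^sup>2) \<le> (\<Sum>m\<in>{(2::nat) ^ i<..2 ^ Suc i}. F\<^sup>2)"
    proof (rule sum_mono)
      fix m :: nat assume m: "m \<in> {2 ^ i<..2 ^ Suc i}"
      have "(2::nat) ^ i \<le> x" using x1 unfolding y_def by (metis of_nat_le_iff of_nat_numeral of_nat_power)
      then have "\<bar>f m\<bar> \<le> F" using m by (intro F(1)) auto
      then show "(f m)\<^sup>2 \<le> F\<^sup>2" by (rule sqrt_ge_absD[of "f m" "F\<^sup>2", unfolded real_sqrt_abs, OF order_trans]) auto
    qed
    also have "\<dots> = y * F\<^sup>2" by (simp add: y_def)
    finally have fs: "sqrt (\<Sum>m\<in>{2 ^ i<..2 ^ Suc i}. (f m)\<^sup>2) \<le> sqrt y * F"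
      using F(2) by (metis real_sqrt_abs real_sqrt_le_mono real_sqrt_mult abs_of_nonneg)
    have "(\<Sum>m\<in>{U<..w}. (g m)\<^sup>2) \<le> (\<Sum>m\<in>{U<..w}. G\<^sup>2)"
    proof (rule sum_mono)
      fix m assume m: "m \<in> {U<..w}"
      have "w \<le> x" unfolding w_def by simp
      then have "\<bar>g m\<bar> \<le> G" using m by (intro G(1)) auto
      then show "(g m)\<^sup>2 \<le> G\<^sup>2" by (rule sqrt_ge_absD[of "g m" "G\<^sup>2", unfolded real_sqrt_abs, OF order_trans]) auto
    qed
    also have "\<dots> \<le> real w * G\<^sup>2" by (simp add: mult_right_mono)
    also have "\<dots> \<le> real x / y * G\<^sup>2" using w by (intro mult_right_mono) auto
    finally have gs: "sqrt (\<Sum>m\<in>{U<..w}. (g m)\<^sup>2) \<le> sqrt (real x / y) * G"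
      using G(2) by (metis real_sqrt_abs real_sqrt_le_mono real_sqrt_mult abs_of_nonneg)
    have "(\<Sum>m\<in>{2 ^ i<..2 ^ Suc i}. h m) \<le> real (Suc i) * (6 / D0 * sqrt (A * B)) *
      (sqrt (\<Sum>m\<in>{2 ^ i<..2 ^ Suc i}. (f m)\<^sup>2) * sqrt (\<Sum>n\<in>{U<..w}. (g n)\<^sup>2))"
      unfolding h_def A_def B_def by (rule type2_block[OF assms(1) S D]) (use Uw in \<open>auto simp: w_def\<close>)
    also have "\<dots> \<le> real (Suc i) * (6 / D0 * Z) * ((sqrt y * F) * (sqrt (real x / y) * G))"
      using AB fs gs D F(2) G(2) y Z(2) by (intro mult_mono mult_left_mono mult_nonneg_nonneg) (auto simp: sum_nonneg)
    also have "\<dots> = real (Suc i) * (6 / D0 * Z) * (sqrt y * sqrt (real x / y)) * (F * G)" by simp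
    also have "sqrt y * sqrt (real x / y) = sqrt (real x)" using y by (simp flip: real_sqrt_mult)
    finally show ?thesis by (simp add: E_def mult_ac)
  qed
  have "(\<Sum>m\<in>{1<..2 ^ j}. h m) \<le> (real j)\<^sup>2 * E" for j
  proof (induction j)
    case (Suc j)
    have "{1<..(2::nat) ^ Suc j} = {1<..2 ^ j} \<union> {2 ^ j<..2 ^ Suc j}" by auto
    then have "(\<Sum>m\<in>{1<..2 ^ Suc j}. h m) = (\<Sum>m\<in>{1<..2 ^ j}. h m) + (\<Sum>m\<in>{2 ^ j<..2 ^ Suc j}. h m)"
      by (simp only:) (intro sum.union_disjoint, auto)
    also have "\<dots> \<le> (real j)\<^sup>2 * E + real (Suc j) * E" by (intro add_mono Suc.IH block)
    also have "\<dots> \<le> (real (Suc j))\<^sup>2 * E" using E by (simp add: power2_eq_square algebra_simps)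
    finally show ?case .
  qed simp
  from this[of n] have "(\<Sum>m\<in>{1<..2 ^ n}. h m) \<le> (real n)\<^sup>2 * E" .
  also have "(\<Sum>m\<in>{1<..2 ^ n}. h m) = (\<Sum>m\<in>{1<..2 ^ n} \<union> {1}. h m)"
    using f0[of 1] U by (intro sum.mono_neutral_left) (auto simp: h_def)
  also have "\<dots> = (\<Sum>m=1..x. h m)"
    using n by (intro sum.mono_neutral_right) (auto simp: h_def)
  finally show ?thesis by (simp add: h_def E_def)
qed

section \<open>Chebyshev lower bounds\<close>

lemma psi_ge:
  assumes "n > 0"
  shows "real n * ln 4 - ln (2 * real n) \<le> (\<Sum>d=1..2 * n. mangoldt d)"
proof -
  have lf: "ln (fact k :: real) = (\<Sum>d=1..m. mangoldt d * real (k div d))" if "k \<le> m" for k m :: nat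
  proof -
    have "ln (fact k :: real) = ln (\<Prod>j=1..k. real j)" by (simp add: fact_prod)
    also have "\<dots> = (\<Sum>j=1..k. ln (real j))" by (intro ln_prod) auto
    also have "\<dots> = (\<Sum>j=1..k. \<Sum>d | d dvd j. mangoldt d)"
      by (intro sum.cong refl) (simp add: mangoldt_sum)
    also have "\<dots> = (\<Sum>d=1..k. \<Sum>i=1..k div d. mangoldt d)"
      by (rule sum_hyperbola[symmetric])
    also have "\<dots> = (\<Sum>d=1..k. mangoldt d * real (k div d))" by (simp add: mult.commute)
    also have "\<dots> = (\<Sum>d=1..m. mangoldt d * real (k div d))"
      using that by (intro sum.mono_neutral_left) auto
    finally show ?thesis .
  qed
  have "real n * ln 4 - ln (2 * real n) = ln (4 ^ n / (2 * real n))"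
    using assms by (simp add: ln_div ln_realpow)
  also have "\<dots> \<le> ln (real (2 * n choose n))"
    using assms central_binomial_lower_bound[OF assms] by (subst ln_le_cancel_iff) auto
  also have "real (2 * n choose n) = fact (2 * n) / (fact n * fact n)"
    by (simp add: binomial_fact)
  also have "ln (fact (2 * n) / (fact n * fact n) :: real) = ln (fact (2 * n)) - 2 * ln (fact n)"
    by (simp add: ln_div ln_mult)
  also have "\<dots> = (\<Sum>d=1..2 * n. mangoldt d * (real (2 * n div d) - 2 * real (n div d)))"
    by (simp add: lf[of _ "2 * n"] sum_distrib_left sum_subtractf[symmetric] algebra_simps)
  \<comment> \<open>Chebyshev's device: \<open>2 * n div d\<close> exceeds
    \<open>2 * (n div d)\<close> by at most 1, so the logarithm of the central binomial coefficient
    is at most the summed \<open>mangoldt\<close>.\<close>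
  also have "\<dots> \<le> (\<Sum>d=1..2 * n. mangoldt d * 1)"
  proof (intro sum_mono mult_left_mono mangoldt_nonneg)
    fix d assume "d \<in> {1..2 * n}"
    then have d: "d > 0" by simp
    have "n < d * (n div d + 1)" using d by (simp add: dividend_less_times_div)
    then have "2 * n < d * (2 * (n div d) + 2)" by (simp add: algebra_simps)
    then have "2 * n div d < 2 * (n div d) + 2" using d by (simp add: less_mult_imp_div_less mult.commute)
    then show "real (2 * n div d) - 2 * real (n div d) \<le> 1" by linarith
  qed
  finally show ?thesis by simp
qed

lemma eventually_psi_ge: "\<forall>\<^sub>F x in at_top. real x / 2 \<le> (\<Sum>d=1..x. mangoldt d)"
proof -
  \<comment> \<open>\<open>5 / 4\<close> is a convenient lower bound for \<open>ln 4\<close>; the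
    excess over 1 absorbs the logarithm and the rounding in \<open>x div 2\<close>.\<close>
  have "\<forall>\<^sub>F x in at_top. real x / 2 \<le> (real x - 1) / 2 * (5 / 4) - ln (real x)"
    by real_asymp
  moreover have "\<forall>\<^sub>F x in at_top. (x::nat) \<ge> 2" by (rule eventually_ge_at_top)
  ultimately show ?thesis
  proof eventually_elim
    case (elim x)
    define n where "n = x div 2"
    have n: "n > 0" "2 * n \<le> x" "x \<le> 2 * n + 1" using elim by (auto simp: n_def)
    have "ln (4 :: real) = 2 * ln 2" using ln_realpow[of 2 2] by simp
    then have "5 / 4 \<le> ln (4 :: real)" using ln2_ge_two_thirds by simp
    then have "(real x - 1) / 2 * (5 / 4) \<le> real n * ln 4" using n by (intro mult_mono) auto
    moreover have "ln (2 * real n) \<le> ln (real x)" using n by (subst ln_le_cancel_iff) auto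
    moreover have "(\<Sum>d=1..2 * n. mangoldt d) \<le> (\<Sum>d=1..x. mangoldt d :: real)"
      using n by (intro sum_mono2) (auto simp: mangoldt_nonneg)
    ultimately show ?case using elim psi_ge[OF n(1)] by linarith
  qed
qed

text \<open>Proper prime powers up to \<open>x\<close> have base at most \<open>sqrt x\<close> and
  exponent at most \<open>2 * ln x\<close>, because \<open>ln 2 \<ge> 1 / 2\<close>. They are few
  enough to be charged \<open>ln x\<close> each.\<close>

lemma sum_mangoldt_le:
  assumes "A \<subseteq> {1..x}" "x \<ge> 1"
  shows "(\<Sum>n\<in>A. mangoldt n) \<le> real (card {p \<in> A. prime p}) * ln (real x) + 2 * sqrt (real x) * (ln (real x))\<^sup>2"
proof -
  have fin: "finite A" using assms by (auto intro: finite_subset)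
  define N where "N = {n \<in> A. primepow n \<and> \<not> prime n}"
  define a where "a = nat \<lfloor>sqrt (real x)\<rfloor>"
  define l where "l = nat \<lfloor>2 * ln (real x)\<rfloor>"
  have lx: "ln (real x) \<ge> 0" using assms(2) by simp
  have "N \<subseteq> (\<lambda>(p, k). p ^ k) ` ({1..a} \<times> {1..l})"
  proof
    fix n assume "n \<in> N"
    then have n: "primepow n" "\<not> prime n" "n \<le> x" using assms by (auto simp: N_def)
    then obtain p k where pk: "prime p" "k > 0" "n = p ^ k" by (auto simp: primepow_def)
    have p2: "p \<ge> 2" using pk(1) by (rule prime_ge_2_nat)
    have k2: "k \<ge> 2" using pk n by (cases "k = 1") auto
    have "p ^ 2 \<le> p ^ k" using k2 p2 by (intro power_increasing) auto
    then have "p ^ 2 \<le> x" using pk n by linarith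
    then have "(real p)\<^sup>2 \<le> real x" by (metis of_nat_le_iff of_nat_power)
    then have "real p \<le> sqrt (real x)" by (rule real_le_rsqrt)
    then have "p \<le> a" unfolding a_def by (simp add: le_nat_floor)
    have "2 ^ k \<le> p ^ k" using p2 by (intro power_mono) auto
    then have "2 ^ k \<le> x" using pk n by linarith
    then have "2 ^ k \<le> real x" by (metis of_nat_le_iff of_nat_numeral of_nat_power)
    then have "ln (2 ^ k) \<le> ln (real x)" using assms(2) by (subst ln_le_cancel_iff) auto
    then have "real k * ln 2 \<le> ln (real x)" by (simp add: ln_realpow)
    moreover have "real k * (1/2) \<le> real k * ln 2" using ln2_ge_two_thirds by (intro mult_left_mono) auto
    ultimately have "k \<le> l" unfolding l_def by (intro le_nat_floor) simp
    with \<open>p \<le> a\<close> k2 p2 have "(p, k) \<in> {1..a} \<times> {1..l}" by simp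
    then show "n \<in> (\<lambda>(p, k). p ^ k) ` ({1..a} \<times> {1..l})"
      unfolding pk(3) by (rule rev_image_eqI) simp
  qed
  then have "card N \<le> card ({1..a} \<times> {1..l})" by (intro surj_card_le) auto
  then have "card N \<le> a * l" by (simp add: card_cartesian_product)
  then have "real (card N) \<le> real a * real l" by (metis of_nat_le_iff of_nat_mult)
  also have "\<dots> \<le> sqrt (real x) * (2 * ln (real x))"
    using lx by (intro mult_mono) (auto simp: a_def l_def)
  finally have N: "real (card N) \<le> sqrt (real x) * (2 * ln (real x))" .
  have "(\<Sum>n\<in>A. mangoldt n) = (\<Sum>n\<in>{p \<in> A. prime p} \<union> N. mangoldt n :: real)"
    using fin by (intro sum.mono_neutral_right) (auto simp: N_def mangoldt_def)
  also have "\<dots> \<le> (\<Sum>n\<in>{p \<in> A. prime p} \<union> N. ln (real x))"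
  proof (rule sum_mono)
    fix n assume "n \<in> {p \<in> A. prime p} \<union> N"
    then have "n \<in> A" by (auto simp: N_def)
    then have n: "1 \<le> n" "n \<le> x" using assms by auto
    then have "mangoldt n \<le> ln (real n)" by (intro mangoldt_le) auto
    also have "\<dots> \<le> ln (real x)" using n by (subst ln_le_cancel_iff) auto
    finally show "mangoldt n \<le> ln (real x)" .
  qed
  also have "\<dots> = real (card {p \<in> A. prime p}) * ln (real x) + real (card N) * ln (real x)"
    using fin by (simp add: card_Un_disjoint N_def disjoint_iff distrib_right)
  also have "real (card N) * ln (real x) \<le> sqrt (real x) * (2 * ln (real x)) * ln (real x)"
    using N lx by (intro mult_right_mono) auto
  finally show ?thesis by (simp add: power2_eq_square mult_ac)
qed

text \<open>For \<open>d = n / (8 * ln n)\<close> the Chebyshev bound yields at least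
  \<open>2 * d\<close> primes up to \<open>n\<close>, of which at most \<open>d\<close> can lie
  below \<open>d\<close>. The lower end serves to keep every modulus nearly of size
  \<open>n\<close>.\<close>

lemma eventually_card_primes_ge:
  "\<forall>\<^sub>F n in at_top. real n / (8 * ln (real n)) \<le>
     real (card {p. prime p \<and> real n / (8 * ln (real n)) \<le> real p \<and> p \<le> n})"
proof -
  have "\<forall>\<^sub>F n in at_top. real n / 4 \<le> real n / 2 - 2 * sqrt (real n) * (ln (real n))\<^sup>2"
    by real_asymp
  moreover have "\<forall>\<^sub>F n in at_top. (n::nat) \<ge> 3" by (rule eventually_ge_at_top)
  ultimately show ?thesis using eventually_psi_ge
  proof eventually_elim
    case (elim n)
    define P where "P = {p \<in> {1..n}. prime p}"
    define d where "d = real n / (8 * ln (real n))"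
    have ln: "ln (real n) > 0" using elim by simp
    have d0: "d \<ge> 0" using ln by (simp add: d_def)
    have "real n / 4 \<le> real (card P) * ln (real n)"
      using elim sum_mangoldt_le[of "{1..n}" n] unfolding P_def by simp
    then have P: "2 * d \<le> real (card P)" using ln by (simp add: d_def field_simps)
    have "P \<subseteq> {p. prime p \<and> d \<le> real p \<and> p \<le> n} \<union> {1..nat \<lfloor>d\<rfloor>}"
      using d0 by (auto simp: P_def not_le nat_less_iff floor_less_iff)
    then have "card P \<le> card ({p. prime p \<and> d \<le> real p \<and> p \<le> n} \<union> {1..nat \<lfloor>d\<rfloor>})"
      by (intro card_mono) (auto intro: finite_subset[of _ "{..n}"])
    also have "\<dots> \<le> card {p. prime p \<and> d \<le> real p \<and> p \<le> n} + nat \<lfloor>d\<rfloor>"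
      by (intro order_trans[OF card_Un_le]) simp
    finally have "real (card P) \<le> real (card {p. prime p \<and> d \<le> real p \<and> p \<le> n} + nat \<lfloor>d\<rfloor>)"
      by (simp only: of_nat_le_iff)
    moreover have "real (nat \<lfloor>d\<rfloor>) \<le> d" using d0 by simp
    ultimately show ?case using P unfolding d_def[symmetric] by linarith
  qed
qed

section \<open>Primes congruent to 1 modulo a large prime\<close>

lemma abs_res_dev_le:
  assumes "prime q"
  shows "\<bar>res_dev q n\<bar> \<le> 1"
proof -
  have "real q \<ge> 2" using prime_ge_2_nat[OF assms] by simp
  define u where "u = 1 / (real q - 1)"
  have u: "0 \<le> u" "u \<le> 1" using \<open>real q \<ge> 2\<close> by (auto simp: u_def)
  show ?thesis
  proof (cases "n mod q = 1")
    case True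
    then have "\<not> q dvd n" by (simp add: dvd_eq_mod_eq_0)
    with True have "res_dev q n = 1 - u" by (simp add: res_dev_def u_def)
    with u show ?thesis by simp
  next
    case False
    then have "res_dev q n = (if q dvd n then 0 else - u)" by (simp add: res_dev_def u_def)
    with u show ?thesis by simp
  qed
qed

text \<open>All moduli are primes exceeding \<open>U\<close>, so they divide no \<open>b\<close> and
  no \<open>b * c\<close> with factors up to \<open>U\<close>. Every inner progression sum is
  therefore bounded by 1, or by \<open>2 * ln x\<close> with the logarithmic weight, regardless of
  its length.\<close>

lemma type1_bounds:
  fixes S :: "nat set"
  assumes "finite S" and S: "\<And>q. q \<in> S \<Longrightarrow> prime q \<and> U < q" and U: "1 \<le> U" "U \<le> x"
  defines "R \<equiv> \<lambda>n. \<Sum>q\<in>S. res_dev q n"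
  shows "\<bar>\<Sum>n=1..U. mangoldt n * R n\<bar> \<le> real U * ln (real x) * real (card S)"
    and "\<bar>\<Sum>b=1..U. moebius b * (\<Sum>j=1..x div b. ln (real j) * R (b * j))\<bar> \<le> 2 * real U * ln (real x) * real (card S)"
    and "\<bar>\<Sum>b=1..U. \<Sum>c=1..U. moebius b * mangoldt c * (\<Sum>k=1..x div b div c. R (b * c * k))\<bar> \<le>
      (real U)\<^sup>2 * ln (real x) * real (card S)"
proof -
  have lnx: "ln (real x) \<ge> 0" using U by simp
  have mang: "\<bar>mangoldt n\<bar> \<le> ln (real x)" if "n \<in> {1..U}" for n
  proof -
    have "mangoldt n \<le> ln (real n)" using that by (intro mangoldt_le) auto
    also have "\<dots> \<le> ln (real x)" using that U by (subst ln_le_cancel_iff) auto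
    finally show ?thesis by simp
  qed
  have nd: "\<not> q dvd b" if "q \<in> S" "b \<in> {1..U}" for q b
    using that S[of q] by (auto dest: dvd_imp_le)
  have nd2: "\<not> q dvd b * c" if "q \<in> S" "b \<in> {1..U}" "c \<in> {1..U}" for q b c
    using nd[of q] that S[of q] by (simp add: prime_dvd_mult_iff)
  have sumS: "\<bar>\<Sum>q\<in>S. h q\<bar> \<le> B * real (card S)" if "\<And>q. q \<in> S \<Longrightarrow> \<bar>h q\<bar> \<le> B" for h :: "nat \<Rightarrow> real" and B
    using order_trans[OF sum_abs sum_bounded_above[of S "\<lambda>q. \<bar>h q\<bar>" B]] that by (simp add: mult.commute)
  have R1: "\<bar>R n\<bar> \<le> 1 * real (card S)" for n
    unfolding R_def by (intro sumS abs_res_dev_le) (use S in auto)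
  have "\<bar>\<Sum>n=1..U. mangoldt n * R n\<bar> \<le> (\<Sum>n=1..U. ln (real x) * real (card S))"
  proof (intro order_trans[OF sum_abs] sum_mono)
    fix n assume "n \<in> {1..U}"
    then show "\<bar>mangoldt n * R n\<bar> \<le> ln (real x) * real (card S)"
      unfolding abs_mult using R1[of n] mang[of n] lnx by (intro mult_mono) auto
  qed
  then show "\<bar>\<Sum>n=1..U. mangoldt n * R n\<bar> \<le> real U * ln (real x) * real (card S)" by simp
  have "\<bar>\<Sum>b=1..U. moebius b * (\<Sum>j=1..x div b. ln (real j) * R (b * j))\<bar> \<le> (\<Sum>b=1..U. 1 * (2 * ln (real x) * real (card S)))"
  proof (intro order_trans[OF sum_abs] sum_mono)
    fix b assume b: "b \<in> {1..U}"
    then have y: "x div b \<ge> 1" using U by (simp add: Suc_le_eq div_greater_zero_iff)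
    have "(\<Sum>j=1..x div b. ln (real j) * R (b * j)) = (\<Sum>q\<in>S. \<Sum>j=1..x div b. ln (real j) * res_dev q (b * j))"
      unfolding R_def sum_distrib_left by (rule sum.swap)
    also have "\<bar>\<dots>\<bar> \<le> 2 * ln (real x) * real (card S)"
    proof (rule sumS)
      fix q assume q: "q \<in> S"
      have "\<bar>\<Sum>j=1..x div b. ln (real j) * res_dev q (b * j)\<bar> \<le> 2 * ln (real (x div b))"
        by (rule abs_sum_mono_mult_le[OF _ _ _ y]) (use abs_sum_res_dev_le S[OF q] nd[OF q b] in auto)
      also have "\<dots> \<le> 2 * ln (real x)" using y U by (subst mult_le_cancel_left_pos, simp, subst ln_le_cancel_iff) auto
      finally show "\<bar>\<Sum>j=1..x div b. ln (real j) * res_dev q (b * j)\<bar> \<le> 2 * ln (real x)" .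
    qed
    finally show "\<bar>moebius b * (\<Sum>j=1..x div b. ln (real j) * R (b * j))\<bar> \<le> 1 * (2 * ln (real x) * real (card S))"
      unfolding abs_mult using abs_moebius_le[of b] by (intro mult_mono) auto
  qed
  then show "\<bar>\<Sum>b=1..U. moebius b * (\<Sum>j=1..x div b. ln (real j) * R (b * j))\<bar> \<le> 2 * real U * ln (real x) * real (card S)" by simp
  have "\<bar>\<Sum>b=1..U. \<Sum>c=1..U. moebius b * mangoldt c * (\<Sum>k=1..x div b div c. R (b * c * k))\<bar> \<le>
      (\<Sum>b=1..U. \<Sum>c=1..U. 1 * ln (real x) * (1 * real (card S)))"
  proof (intro order_trans[OF sum_abs] sum_mono)
    fix b c assume bc: "b \<in> {1..U}" "c \<in> {1..U}"
    have "(\<Sum>k=1..x div b div c. R (b * c * k)) = (\<Sum>q\<in>S. \<Sum>k=1..x div b div c. res_dev q (b * c * k))"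
      unfolding R_def by (rule sum.swap)
    also have "\<bar>\<dots>\<bar> \<le> 1 * real (card S)"
      using S nd2 bc by (intro sumS abs_sum_res_dev_le) auto
    finally show "\<bar>moebius b * mangoldt c * (\<Sum>k=1..x div b div c. R (b * c * k))\<bar> \<le> 1 * ln (real x) * (1 * real (card S))"
      unfolding abs_mult using abs_moebius_le[of b] mang[OF bc(2)] lnx by (intro mult_mono) (auto simp: mangoldt_nonneg)
  qed
  then show "\<bar>\<Sum>b=1..U. \<Sum>c=1..U. moebius b * mangoldt c * (\<Sum>k=1..x div b div c. R (b * c * k))\<bar> \<le>
      (real U)\<^sup>2 * ln (real x) * real (card S)" by (simp add: power2_eq_square mult_ac)
qed

lemma mangoldt_res_dev_ge:
  assumes "finite S" and S: "\<And>q. q \<in> S \<Longrightarrow> prime q \<and> real q \<ge> D0 \<and> q \<le> D \<and> U < q" and D: "D > 0" "D0 > 0"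
    and U: "1 \<le> U" "U \<le> x" and n: "x \<le> 2 ^ n"
    and F: "\<And>m. 1 \<le> m \<Longrightarrow> m \<le> 2 * x \<Longrightarrow> real (card {d. d dvd m}) \<le> F"
    and Z: "7 * (real x + real x * (real D)\<^sup>2 / real U) + (real D) ^ 4 \<le> Z\<^sup>2" "Z \<ge> 0"
  shows "- (4 * (real U)\<^sup>2 * ln (real x) * real (card S)) - (real n)\<^sup>2 * (6 * F * ln (real x) * sqrt (real x) * Z / D0) \<le>
    (\<Sum>m=1..x. mangoldt m * (\<Sum>q\<in>S. res_dev q m))"
proof -
  define R where "R m = (\<Sum>q\<in>S. res_dev q m)" for m
  \<comment> \<open>Opposite in sign to the coefficient in Vaughan's identity: the type II sum
    becomes \<open>- T\<close>, and the one-sided upper bound for \<open>T\<close> is what a lower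
    estimate needs.\<close>
  define f where "f m = trunc_moebius_sum U m - (if m = 1 then 1 else 0)" for m
  have "real (card {d. d dvd (1::nat)}) \<le> F" by (intro F) (use U in auto)
  then have F0: "F \<ge> 0" by (rule order_trans[rotated]) simp
  have fF: "\<bar>f m\<bar> \<le> F" if "1 \<le> m" "m \<le> 2 * x" for m
  proof (cases "m = 1")
    case True
    then show ?thesis using trunc_moebius_sum_eq[of 1 U] U F0 by (simp add: f_def)
  next
    case False
    then show ?thesis using abs_trunc_moebius_sum_le[of m U] F[OF that] that by (simp add: f_def)
  qed
  define T where "T = (\<Sum>m=1..x. \<Sum>c\<in>{U<..x div m}. f m * mangoldt c * R (m * c))"
  have T: "T \<le> (real n)\<^sup>2 * (6 * F * ln (real x) * sqrt (real x) * Z / D0)"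
    unfolding T_def R_def
  proof (rule type2_bound[OF assms(1) _ D U(1) n _ fF F0 _ _ Z])
    fix m assume "1 \<le> m" "m \<le> U"
    then show "f m = 0" using trunc_moebius_sum_eq[of m U] by (simp add: f_def)
  next
    fix m assume m: "1 \<le> m" "m \<le> x"
    have "mangoldt m \<le> ln (real m)" using m by (intro mangoldt_le) auto
    also have "\<dots> \<le> ln (real x)" using m by (subst ln_le_cancel_iff) auto
    finally show "\<bar>mangoldt m :: real\<bar> \<le> ln (real x)" by simp
  qed (use S U in auto)
  have "(\<Sum>m=1..x. \<Sum>c\<in>{U<..x div m}. ((if m = 1 then 1 else 0) - trunc_moebius_sum U m) * mangoldt c * R (m * c)) = - T"
    unfolding T_def sum_negf[symmetric] by (intro sum.cong refl) (simp add: f_def algebra_simps)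
  then have V: "(\<Sum>m=1..x. mangoldt m * R m) = (\<Sum>n=1..U. mangoldt n * R n)
    + (\<Sum>b=1..U. moebius b * (\<Sum>j=1..x div b. ln (real j) * R (b * j)))
    - (\<Sum>b=1..U. \<Sum>c=1..U. moebius b * mangoldt c * (\<Sum>k=1..x div b div c. R (b * c * k))) - T"
    using vaughan_identity[OF U, of R] by simp
  define w where "w = ln (real x) * real (card S)"
  have w: "w \<ge> 0" using U by (simp add: w_def)
  \<comment> \<open>Lets the three type I bounds, with weights 1, 2 and 1, merge into
    \<open>4 * ((real U)\<^sup>2 * w)\<close>.\<close>
  have "real U * w \<le> (real U)\<^sup>2 * w" using U w by (intro mult_right_mono) (auto simp: power2_eq_square)
  moreover have "\<bar>\<Sum>n=1..U. mangoldt n * R n\<bar> \<le> real U * w"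
      "\<bar>\<Sum>b=1..U. moebius b * (\<Sum>j=1..x div b. ln (real j) * R (b * j))\<bar> \<le> 2 * (real U * w)"
      "\<bar>\<Sum>b=1..U. \<Sum>c=1..U. moebius b * mangoldt c * (\<Sum>k=1..x div b div c. R (b * c * k))\<bar> \<le> (real U)\<^sup>2 * w"
    using type1_bounds[OF assms(1) _ U] S unfolding R_def w_def by (simp_all add: mult.assoc)
  ultimately have "- (4 * ((real U)\<^sup>2 * w)) - (real n)\<^sup>2 * (6 * F * ln (real x) * sqrt (real x) * Z / D0) \<le> (\<Sum>m=1..x. mangoldt m * R m)"
    using T unfolding V by linarith
  then show ?thesis unfolding R_def w_def by (simp add: mult.assoc)
qed

text \<open>The opposing estimate: class 1 holds few primes by assumption, whereas the subtracted
  mean is at least \<open>V / D\<close> for each modulus. Multiples of \<open>q\<close> carry at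
  most \<open>x / D0 * ln x\<close> of the summed \<open>mangoldt\<close>, and \<open>V\<close> is
  what the Chebyshev bound leaves after that.\<close>

lemma sum_mangoldt_res_dev_le:
  assumes S: "\<And>q. q \<in> S \<Longrightarrow> prime q \<and> real q \<ge> D0 \<and> q \<le> D" and D: "D0 > 0" and x: "x \<ge> 1"
    and psi: "real x / 2 \<le> (\<Sum>m=1..x. mangoldt m)"
    and few: "\<And>q. q \<in> S \<Longrightarrow> real (card {p. prime p \<and> p \<le> x \<and> p mod q = 1}) \<le> N"
    and V: "V = real x / 2 - real x / D0 * ln (real x)" "V \<ge> 0"
  shows "(\<Sum>m=1..x. mangoldt m * (\<Sum>q\<in>S. res_dev q m)) \<le>
    real (card S) * (N * ln (real x) + 2 * sqrt (real x) * (ln (real x))\<^sup>2 - V / real D)"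
proof -
  have lnx: "ln (real x) \<ge> 0" using x by simp
  have "(\<Sum>m=1..x. mangoldt m * (\<Sum>q\<in>S. res_dev q m)) = (\<Sum>q\<in>S. \<Sum>m=1..x. mangoldt m * res_dev q m)"
    unfolding sum_distrib_left by (rule sum.swap)
  also have "\<dots> \<le> (\<Sum>q\<in>S. N * ln (real x) + 2 * sqrt (real x) * (ln (real x))\<^sup>2 - V / real D)"
  proof (rule sum_mono)
    fix q assume q: "q \<in> S"
    have q2: "prime q" "real q \<ge> D0" "q \<le> D" "q \<ge> 2" using S[OF q] prime_ge_2_nat by auto
    define A where "A = {m \<in> {1..x}. m mod q = 1}"
    define B where "B = {m \<in> {1..x}. q dvd m}"
    have "(\<Sum>m=1..x. mangoldt m * res_dev q m) =
       (\<Sum>m=1..x. if m mod q = 1 then mangoldt m else 0) - (\<Sum>m=1..x. if q dvd m then 0 else mangoldt m) / (real q - 1)"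
      unfolding sum_divide_distrib sum_subtractf[symmetric] by (intro sum.cong refl) (auto simp: res_dev_def algebra_simps)
    also have "(\<Sum>m=1..x. if m mod q = 1 then mangoldt m else 0) = (\<Sum>m\<in>A. mangoldt m :: real)"
      unfolding A_def by (intro sum.inter_filter[symmetric]) auto
    also have "\<dots> \<le> N * ln (real x) + 2 * sqrt (real x) * (ln (real x))\<^sup>2"
    proof -
      have "{p \<in> A. prime p} = {p. prime p \<and> p \<le> x \<and> p mod q = 1}"
        by (auto simp: A_def dest: prime_gt_0_nat)
      then have "real (card {p \<in> A. prime p}) * ln (real x) \<le> N * ln (real x)"
        using few[OF q] lnx by (intro mult_right_mono) auto
      moreover have "A \<subseteq> {1..x}" by (auto simp: A_def)
      ultimately show ?thesis using sum_mangoldt_le[of A x] x by linarith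
    qed
    finally have "(\<Sum>m=1..x. mangoldt m * res_dev q m) \<le> N * ln (real x) + 2 * sqrt (real x) * (ln (real x))\<^sup>2
        - (\<Sum>m=1..x. if q dvd m then 0 else mangoldt m) / (real q - 1)" by simp
    moreover have "V / real D \<le> (\<Sum>m=1..x. if q dvd m then 0 else mangoldt m) / (real q - 1)"
    proof -
      have "B \<subseteq> (\<lambda>j. q * j) ` {1..x div q}"
      proof
        fix m assume "m \<in> B"
        then obtain j where j: "m = q * j" "1 \<le> m" "m \<le> x" by (auto simp: B_def)
        then have "j \<ge> 1" by (cases j) auto
        moreover have "j \<le> x div q" using j q2 by (simp add: less_eq_div_iff_mult_less_eq mult.commute)
        ultimately show "m \<in> (\<lambda>j. q * j) ` {1..x div q}" using j by auto
      qed
      then have "card B \<le> card {1..x div q}" by (intro surj_card_le) auto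
      then have "real (card B) \<le> real (x div q)" by simp
      also have "\<dots> \<le> real x / real q" by (rule of_nat_div_le_of_nat)
      also have "\<dots> \<le> real x / D0" using q2 D by (intro divide_left_mono) auto
      finally have cB: "real (card B) \<le> real x / D0" .
      have "(\<Sum>m\<in>B. mangoldt m) \<le> (\<Sum>m\<in>B. ln (real x))"
      proof (rule sum_mono)
        fix m assume "m \<in> B"
        then have m: "1 \<le> m" "m \<le> x" by (auto simp: B_def)
        have "mangoldt m \<le> ln (real m)" using m by (intro mangoldt_le) auto
        also have "\<dots> \<le> ln (real x)" using m by (subst ln_le_cancel_iff) auto
        finally show "mangoldt m \<le> ln (real x)" .
      qed
      also have "\<dots> \<le> real x / D0 * ln (real x)" using mult_right_mono[OF cB lnx] by simp
      finally have SB: "(\<Sum>m\<in>B. mangoldt m) \<le> real x / D0 * ln (real x)" .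
      have "(\<Sum>m=1..x. if q dvd m then 0 else mangoldt m) = (\<Sum>m=1..x. mangoldt m) - (\<Sum>m=1..x. if q dvd m then mangoldt m else 0 :: real)"
        unfolding sum_subtractf[symmetric] by (intro sum.cong) auto
      also have "(\<Sum>m=1..x. if q dvd m then mangoldt m else 0 :: real) = (\<Sum>m\<in>B. mangoldt m)"
        unfolding B_def by (intro sum.inter_filter[symmetric]) auto
      finally have "V \<le> (\<Sum>m=1..x. if q dvd m then 0 else mangoldt m)"
        using SB psi V(1) by linarith
      then show ?thesis using V(2) q2 by (intro frac_le) auto
    qed
    ultimately show "(\<Sum>m=1..x. mangoldt m * res_dev q m) \<le> N * ln (real x) + 2 * sqrt (real x) * (ln (real x))\<^sup>2 - V / real D"
      by linarith
  qed
  finally show ?thesis by simp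
qed

lemma eventually_const_mult_less:
  fixes g :: "nat \<Rightarrow> real"
  assumes "(\<lambda>t. g t / real t) \<longlonglongrightarrow> 0" "\<delta> > 0"
  shows "\<forall>\<^sub>F t in at_top. c * g t < \<delta> * real t"
proof -
  have "(\<lambda>t. c * (g t / real t)) \<longlonglongrightarrow> c * 0" by (intro tendsto_intros assms)
  then have "\<forall>\<^sub>F t in at_top. c * (g t / real t) < \<delta>" using assms(2) by (intro order_tendstoD) auto
  then show ?thesis using eventually_gt_at_top[of 0]
    by eventually_elim (auto simp: field_simps)
qed

text \<open>The cut-off in Vaughan's identity is \<open>U = t\<close>: large enough that
  \<open>x * D\<^sup>2 / U\<close> does not exceed \<open>D ^ 4\<close>, small enough that
  \<open>U\<^sup>2 \<le> D\<close> keeps the type I terms negligible, which uses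
  \<open>k \<ge> 2\<close>. The count is stated with \<open>t + 1\<close> because \<open>t\<close>
  will be a root rounded down.\<close>

theorem primes_in_progression_large_modulus:
  fixes k :: nat
  assumes k: "k \<ge> 2"
  shows "\<forall>\<^sub>F t in at_top. \<exists>q. prime q \<and> real (t ^ k) / (8 * ln (real (t ^ k))) \<le> real q \<and> q \<le> t ^ k \<and>
    (t + 1) ^ k \<le> card {p. prime p \<and> p \<le> t ^ (2 * k + 1) \<and> p mod q = 1}"
proof -
  \<comment> \<open>Chosen so that integers up to \<open>2 * x\<close>, which is at most
    \<open>t ^ (2 * k + 2)\<close>, have at most \<open>C * t powr (1 / 8)\<close> divisors.\<close>
  define \<epsilon> where "\<epsilon> = 1 / (16 * (real k + 1))"
  have \<epsilon>: "\<epsilon> > 0" by (simp add: \<epsilon>_def)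
  obtain C where C: "C \<ge> 1" "\<And>n. n > 0 \<Longrightarrow> real (card {d. d dvd n}) \<le> C * real n powr \<epsilon>"
    using divisor_bound[OF \<epsilon>] by blast
  define K where "K = real (2 * k + 1)"
  \<comment> \<open>Constants of the type II bound: \<open>9 * 6 * 4 = 216\<close> from
    \<open>(real n)\<^sup>2\<close>, the bilinear estimate and \<open>Z = 4 * Y\<close>, times 64
    from \<open>1 / (D0 * D0)\<close>. The powers of \<open>k\<close> and \<open>K\<close> come from
    \<open>ln D\<close> and \<open>ln x\<close>.\<close>
  define c5 where "c5 = 13824 * C * (real k)\<^sup>2 * K ^ 3"
  have k0: "real k > 0" using k by simp
  have power_at_top: "filterlim (\<lambda>t::nat. t ^ j) at_top at_top" if "j > 0" for j
    using that by (intro filterlim_at_top_mono[OF filterlim_ident]) (auto intro!: eventually_at_top_linorderI[of 1] self_le_power)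
  have "\<forall>\<^sub>F t in at_top. (t::nat) \<ge> 3" by (rule eventually_ge_at_top)
  moreover have "\<forall>\<^sub>F t in at_top. (8 * real k) * ln (real t) < 1 * real t"
    by (rule eventually_const_mult_less) (real_asymp, simp)
  moreover have "\<forall>\<^sub>F t in at_top. (8 * real k * K) * (ln (real t))\<^sup>2 < 1 / 10 * real t"
    by (rule eventually_const_mult_less) (real_asymp, simp)
  moreover have "\<forall>\<^sub>F t in at_top. (2 ^ k * K + 4 * K) * ln (real t) < 1 / 10 * real t"
    by (rule eventually_const_mult_less) (real_asymp, simp)
  moreover have "\<forall>\<^sub>F t in at_top. (2 * K\<^sup>2) * (sqrt (real t) * (ln (real t))\<^sup>2) < 1 / 10 * real t"
    by (rule eventually_const_mult_less) (real_asymp, simp)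
  moreover have "\<forall>\<^sub>F t in at_top. c5 * ((ln (real t)) ^ 5 * real t powr (1 / 8) * sqrt (real t)) < 1 / 10 * real t"
    by (rule eventually_const_mult_less) (real_asymp, simp)
  moreover have "\<forall>\<^sub>F t in at_top. real (t ^ (2 * k + 1)) / 2 \<le> (\<Sum>d=1..t ^ (2 * k + 1). mangoldt d)"
    by (rule eventually_compose_filterlim[OF eventually_psi_ge power_at_top]) simp
  moreover have "\<forall>\<^sub>F t in at_top. real (t ^ k) / (8 * ln (real (t ^ k))) \<le>
     real (card {p. prime p \<and> real (t ^ k) / (8 * ln (real (t ^ k))) \<le> real p \<and> p \<le> t ^ k})"
    by (rule eventually_compose_filterlim[OF eventually_card_primes_ge power_at_top]) (use k in simp)
  ultimately show ?thesis
  proof eventually_elim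
    case (elim t)
    define L where "L = ln (real t)"
    define x where "x = t ^ (2 * k + 1)"
    define D where "D = t ^ k"
    define D0 where "D0 = real D / (8 * ln (real D))"
    define S where "S = {q. prime q \<and> D0 \<le> real q \<and> q \<le> D}"
    define Y where "Y = real t ^ (2 * k)"
    define r where "r = sqrt (real t)"
    define Q where "Q = real t powr (1 / 8)"
    note ev = elim[folded L_def, folded r_def Q_def]
    have t3: "t \<ge> 3" using elim by simp
    have "exp 1 \<le> real t" using exp_le t3 by (metis le_trans numeral_3_eq_3 of_nat_le_iff of_nat_numeral order_trans)
    then have L1: "L \<ge> 1" unfolding L_def by (subst ln_ge_iff) (use t3 in auto)
    have K1: "K \<ge> 1" by (simp add: K_def)
    have lnx: "ln (real x) = K * L" unfolding x_def K_def L_def using t3 by (simp only: of_nat_power) (subst ln_realpow, auto)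
    have lnD: "ln (real D) = real k * L" unfolding D_def L_def using t3 by (simp only: of_nat_power) (subst ln_realpow, auto)
    have D0: "D0 = real t ^ k / (8 * real k * L)" unfolding D0_def lnD by (simp add: D_def)
    have D0pos: "D0 > 0" unfolding D0 using t3 k0 L1 by (intro divide_pos_pos mult_pos_pos) auto
    have Dpos: "D > 0" using t3 by (simp add: D_def)
    have Dr: "real D = real t ^ k" by (simp add: D_def)
    have Ypos: "Y > 0" using t3 by (simp add: Y_def)
    have DD: "real D * real D = Y" by (simp add: Dr Y_def mult_2 power_add)
    have xr: "real x = Y * real t" by (simp add: x_def Y_def)
    have x1: "x \<ge> 1" using t3 by (simp add: x_def)
    have tx: "t \<le> x" using t3 unfolding x_def by (intro self_le_power) auto
    have rpos: "r \<ge> 0" by (simp add: r_def)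
    have sqx: "sqrt (real x) = real D * r"
    proof -
      have "real x = (real D)\<^sup>2 * real t" by (simp add: xr power2_eq_square DD)
      then show ?thesis by (simp add: real_sqrt_mult r_def)
    qed
    have finS: "finite S" unfolding S_def by (rule finite_subset[of _ "{..D}"]) auto
    have cardS: "D0 \<le> real (card S)" using elim unfolding S_def D0_def D_def by simp
    have tS: "t < q" if "q \<in> S" for q
    proof -
      have "real t * (8 * real k * L) < real t * real t" using ev t3 by (intro mult_strict_left_mono) auto
      also have "\<dots> \<le> real t ^ k" using power_increasing[OF k, of "real t"] t3 by (simp add: power2_eq_square)
      finally have "real t < D0" unfolding D0 using k0 L1 by (simp add: field_simps)
      then show ?thesis using that by (simp add: S_def)
    qed
    show ?case
    proof (rule ccontr)
      \<comment> \<open>The negation makes all moduli of \<open>S\<close> poor at once, so the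
        signed sum is at most about \<open>- card S * V / D\<close>; the type I and type II bounds
        show that it cannot be that negative.\<close>
      assume "\<not> ?case"
      then have few: "card {p. prime p \<and> p \<le> x \<and> p mod q = 1} < (t + 1) ^ k" if "q \<in> S" for q
        using that unfolding S_def D0_def x_def D_def by (auto simp: not_le)
      define N where "N = (real t + 1) ^ k"
      have fewN: "real (card {p. prime p \<and> p \<le> x \<and> p mod q = 1}) \<le> N" if "q \<in> S" for q
      proof -
        have "real (card {p. prime p \<and> p \<le> x \<and> p mod q = 1}) \<le> real ((t + 1) ^ k)"
          using few[OF that] by (simp only: of_nat_le_iff)
        then show ?thesis by (simp add: N_def add.commute)
      qed
      define V where "V = real x / 2 - real x / D0 * ln (real x)"
      have Vge: "Y * (real t / 2 - real t / 10) \<le> V"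
      proof -
        have "real x / D0 * ln (real x) = Y * (8 * real k * K * L\<^sup>2) * (real t / real t ^ k)"
          unfolding lnx unfolding D0 xr using t3 k0 L1 by (simp add: power2_eq_square field_simps)
        also have "\<dots> \<le> Y * (8 * real k * K * L\<^sup>2) * 1"
        proof (rule mult_left_mono)
          have "real t ^ 1 \<le> real t ^ k" using t3 k by (intro power_increasing) auto
          then show "real t / real t ^ k \<le> 1" using t3 by simp
        qed (use Ypos K1 in auto)
        also have "\<dots> \<le> Y * (real t / 10)" using ev Ypos by simp
        finally have "real x / D0 * ln (real x) \<le> Y * (real t / 10)" .
        moreover have "real x / 2 = Y * (real t / 2)" by (simp add: xr)
        ultimately show ?thesis unfolding V_def right_diff_distrib by linarith
      qed
      have Vpos: "V \<ge> 0" by (rule order_trans[OF _ Vge]) (use Ypos in auto)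
      define n where "n = nat \<lceil>2 * ln (real x)\<rceil>"
      have lx1: "ln (real x) \<ge> 1" using mult_mono[OF K1 L1] K1 by (simp add: lnx)
      have nle: "real n \<le> 3 * ln (real x)" unfolding n_def using lx1 by linarith
      have xn: "x \<le> 2 ^ n"
      proof -
        have "2 * ln (real x) \<le> real n" unfolding n_def by linarith
        then have "ln (real x) \<le> real n * (2 / 3)" using lx1 by linarith
        also have "\<dots> \<le> real n * ln 2" using ln2_ge_two_thirds by (intro mult_left_mono) auto
        also have "\<dots> = ln (2 ^ n)" by (simp add: ln_realpow)
        finally have "real x \<le> 2 ^ n" using x1 by (subst (asm) ln_le_cancel_iff) auto
        then have "real x \<le> real (2 ^ n)" by simp
        then show ?thesis by (simp only: of_nat_le_iff)
      qed
      have F: "real (card {d. d dvd m}) \<le> C * Q" if "1 \<le> m" "m \<le> 2 * x" for m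
      proof -
        have "2 * x \<le> t * x" using t3 by simp
        also have "\<dots> = t ^ (2 * k + 2)" by (simp add: x_def)
        finally have "m \<le> t ^ (2 * k + 2)" using that by linarith
        then have "real m \<le> real (t ^ (2 * k + 2))" by (simp only: of_nat_le_iff)
        also have "\<dots> = real t powr (real (2 * k + 2))" unfolding of_nat_power by (subst powr_realpow) (use t3 in auto)
        finally have "real m powr \<epsilon> \<le> (real t powr (real (2 * k + 2))) powr \<epsilon>" using \<epsilon> by (intro powr_mono2) auto
        also have "\<dots> = Q"
          unfolding powr_powr Q_def by (rule arg_cong[where f = "\<lambda>u. real t powr u"]) (simp add: \<epsilon>_def field_simps)
        finally have "C * real m powr \<epsilon> \<le> C * Q" using C(1) by (intro mult_left_mono) auto
        with C(2)[of m] that show ?thesis by linarith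
      qed
      \<comment> \<open>With \<open>U = t\<close> the terms are at most
        \<open>7 * Y\<^sup>2\<close>, \<open>7 * Y\<^sup>2\<close> and \<open>Y\<^sup>2\<close>,
        together below \<open>16 * Y\<^sup>2\<close>.\<close>
      have Z: "7 * (real x + real x * (real D)\<^sup>2 / real t) + (real D) ^ 4 \<le> (4 * Y)\<^sup>2"
      proof -
        have e: "real x * (real D)\<^sup>2 / real t = Y\<^sup>2" "(real D) ^ 4 = Y\<^sup>2" "(4 * Y)\<^sup>2 = 16 * Y\<^sup>2"
          using t3 by (simp_all add: xr power4_eq_xxxx power2_eq_square DD[symmetric])
        have "real t ^ 1 \<le> Y" unfolding Y_def using t3 k by (intro power_increasing) auto
        then have "real x \<le> Y\<^sup>2" unfolding xr power2_eq_square using Ypos by (intro mult_left_mono) auto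
        then have "7 * (real x + Y\<^sup>2) + Y\<^sup>2 \<le> 16 * Y\<^sup>2" using zero_le_power2[of Y] by (smt (verit))
        then show ?thesis unfolding e .
      qed
      have Qpos: "Q \<ge> 0" by (simp add: Q_def)
      define T2 where "T2 = (real n)\<^sup>2 * (6 * (C * Q) * ln (real x) * sqrt (real x) * (4 * Y) / D0)"
      have lower: "- (4 * (real t)\<^sup>2 * ln (real x) * real (card S)) - T2 \<le> (\<Sum>m=1..x. mangoldt m * (\<Sum>q\<in>S. res_dev q m))"
        unfolding T2_def using t3 Ypos tS
        by (intro mangoldt_res_dev_ge[OF finS _ Dpos D0pos _ tx xn F Z]) (auto simp: S_def)
      have upper: "(\<Sum>m=1..x. mangoldt m * (\<Sum>q\<in>S. res_dev q m)) \<le>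
         real (card S) * (N * ln (real x) + 2 * sqrt (real x) * (ln (real x))\<^sup>2 - V / real D)"
        by (rule sum_mangoldt_res_dev_le[where ?D0.0 = D0])
           (use elim x1 D0pos fewN V_def Vpos in \<open>auto simp: S_def x_def\<close>)
      define B where "B = V / real D - N * ln (real x) - 2 * sqrt (real x) * (ln (real x))\<^sup>2 - 4 * (real t)\<^sup>2 * ln (real x)"
      have SB: "real (card S) * B \<le> T2"
        using lower upper unfolding B_def by (simp add: algebra_simps)
      have T2: "T2 \<le> D0 * (c5 * (L ^ 5 * Q * r) * Y / real D)"
      proof -
        have "(real n)\<^sup>2 \<le> (3 * ln (real x))\<^sup>2" using nle by (intro power_mono) auto
        then have "T2 \<le> (3 * ln (real x))\<^sup>2 * (6 * (C * Q) * ln (real x) * sqrt (real x) * (4 * Y) / D0)"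
          unfolding T2_def using C(1) Qpos lx1 Ypos D0pos by (intro mult_right_mono) auto
        also have "\<dots> = D0 * (216 * C * Q * (K * L) ^ 3 * r * Y * real D / (D0 * D0))"
          using D0pos by (simp add: lnx sqx power2_eq_square power3_eq_cube field_simps)
        also have "real D / (D0 * D0) = 64 * (real k * L)\<^sup>2 / real D"
          using Dpos k0 L1 t3 unfolding D0 Dr by (simp add: power2_eq_square field_simps)
        then have "216 * C * Q * (K * L) ^ 3 * r * Y * real D / (D0 * D0) = c5 * (L ^ 5 * Q * r) * Y / real D"
          unfolding times_divide_eq_right[symmetric] c5_def
          by (simp add: power_mult_distrib power2_eq_square power3_eq_cube numeral_eq_Suc mult_ac)
        finally show ?thesis .
      qed
      have "B \<le> c5 * (L ^ 5 * Q * r) * Y / real D"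
      \<comment> \<open>\<open>card S\<close> is bounded only from below, so replacing it by
        \<open>D0\<close> requires \<open>B > 0\<close>; otherwise the claim holds by sign.\<close>
      proof (cases "B \<le> 0")
        case True
        moreover have "0 \<le> c5 * (L ^ 5 * Q * r) * Y / real D"
          using C(1) K1 L1 Qpos rpos Ypos by (auto simp: c5_def)
        ultimately show ?thesis by linarith
      next
        case False
        then have "D0 * B \<le> real (card S) * B" using cardS by (intro mult_right_mono) auto
        also note SB
        also note T2
        finally show ?thesis using D0pos by (simp only: mult_le_cancel_left_pos)
      qed
      then have "real D * B \<le> c5 * (L ^ 5 * Q * r) * Y" using Dpos by (simp add: field_simps)
      then have VV: "V \<le> real D * N * (K * L) + 2 * (Y * r) * (K * L)\<^sup>2 + 4 * (real D * (real t)\<^sup>2) * (K * L) + c5 * (L ^ 5 * Q * r) * Y"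
        using Dpos unfolding B_def lnx sqx DD[symmetric] by (simp add: algebra_simps)
      have "real D * N \<le> 2 ^ k * Y"
      proof -
        have "N \<le> (2 * real t) ^ k" unfolding N_def using t3 by (intro power_mono) auto
        then have "real D * N \<le> real D * (2 ^ k * real D)" by (intro mult_left_mono) (auto simp: power_mult_distrib Dr)
        then show ?thesis unfolding DD[symmetric] by (simp only: mult_ac)
      qed
      then have 1: "real D * N * (K * L) \<le> 2 ^ k * Y * (K * L)" using K1 L1 by (intro mult_right_mono) auto
      have "real D * (real t)\<^sup>2 \<le> Y"
      proof -
        have "(real t)\<^sup>2 \<le> real D" unfolding Dr using t3 k by (intro power_increasing) auto
        then have "real D * (real t)\<^sup>2 \<le> real D * real D" by (intro mult_left_mono) auto
        then show ?thesis using DD by simp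
      qed
      then have 2: "4 * (real D * (real t)\<^sup>2) * (K * L) \<le> 4 * Y * (K * L)" using K1 L1 by (intro mult_right_mono) auto
      have "V \<le> Y * ((2 ^ k * K + 4 * K) * L + (2 * K\<^sup>2) * (r * L\<^sup>2) + c5 * (L ^ 5 * Q * r))"
        using VV 1 2 by (simp add: algebra_simps power_mult_distrib)
      also have "\<dots> \<le> Y * (1 / 10 * real t + 1 / 10 * real t + 1 / 10 * real t)"
        using ev Ypos by (intro mult_left_mono add_mono less_imp_le) auto
      \<comment> \<open>\<open>V\<close> keeps four tenths of \<open>Y * t\<close> after a tenth
        went to the multiples of \<open>q\<close>, while the error terms reach only three
        tenths.\<close>
      finally have "Y * (real t / 2 - real t / 10) \<le> Y * (3 / 10 * real t)" using Vge by (simp add: algebra_simps)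
      then have "real t / 2 - real t / 10 \<le> 3 / 10 * real t" using Ypos by simp
      then show False using t3 by simp
    qed
  qed
qed

section \<open>Bounds for M(n)\<close>

lemma ln_gcd_pair_prod:
  assumes "finite P" "\<And>p. p \<in> P \<Longrightarrow> prime p"
  shows "ln (real (gcd_pair_prod P)) = (\<Sum>p\<in>P. \<Sum>p'\<in>P. ln (real (gcd (p - 1) (p' - 1))))"
proof -
  have "ln (real (gcd_pair_prod P)) = ln (\<Prod>z\<in>P \<times> P. real (gcd (fst z - 1) (snd z - 1)))"
    unfolding gcd_pair_prod_def by (simp add: case_prod_unfold)
  also have "\<dots> = (\<Sum>z\<in>P \<times> P. ln (real (gcd (fst z - 1) (snd z - 1))))"
  proof (rule ln_prod)
    fix z assume z: "z \<in> P \<times> P"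
    then have "fst z > 1" using assms(2) prime_gt_1_nat by auto
    then show "real (gcd (fst z - 1) (snd z - 1)) \<noteq> 0" by simp
  qed (use assms in auto)
  also have "\<dots> = (\<Sum>p\<in>P. \<Sum>p'\<in>P. ln (real (gcd (p - 1) (p' - 1))))"
    by (simp add: sum.cartesian_product case_prod_unfold)
  finally show ?thesis .
qed

lemma sum_ln_admissible:
  assumes "admissible n P" "n \<ge> 1"
  shows "(\<Sum>p\<in>P. ln (real p)) \<le> ln (real n)"
proof -
  have "(\<Sum>p\<in>P. ln (real p)) = ln (\<Prod>p\<in>P. real p)"
    using assms(1) by (intro ln_prod[symmetric]) (auto simp: admissible_def prime_gt_0_nat)
  also have "\<dots> = ln (real (\<Prod>P))" by simp
  also have "\<dots> \<le> ln (real n)"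
  proof (rule ln_mono)
    have "\<Prod>P \<le> n" using assms(1) by (simp add: admissible_def)
    then show "real (\<Prod>P) \<le> real n" by (simp only: of_nat_le_iff)
    have "\<Prod>P > 0" using assms(1) by (auto simp: admissible_def intro!: prod_pos prime_gt_0_nat)
    then show "0 < real (\<Prod>P)" by (simp only: of_nat_0_less_iff)
  qed
  finally show ?thesis .
qed

lemma finite_gcd_pair_prods: "finite {gcd_pair_prod P | P. admissible n P}"
proof -
  have "{P. admissible n P} \<subseteq> Pow {..n}"
  proof safe
    fix P p assume "admissible n P" "p \<in> P"
    then have "p dvd \<Prod>P" "\<Prod>P > 0" "\<Prod>P \<le> n"
      by (auto simp: admissible_def intro!: dvd_prodI prod_pos prime_gt_0_nat)
    then show "p \<le> n" using dvd_imp_le[of p "\<Prod>P"] by simp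
  qed
  then have "finite {P. admissible n P}" by (rule finite_subset) simp
  then have "finite (gcd_pair_prod ` {P. admissible n P})" by simp
  then show ?thesis by (simp add: setcompr_eq_image)
qed

lemma gcd_pair_prod_le_M: "admissible n P \<Longrightarrow> gcd_pair_prod P \<le> M n"
  unfolding M_def using finite_gcd_pair_prods by (intro Max_ge) auto

lemma M_attained:
  assumes "n \<ge> 1"
  obtains P where "admissible n P" "M n = gcd_pair_prod P"
proof -
  have "admissible n {}" using assms by (simp add: admissible_def)
  then have "M n \<in> {gcd_pair_prod P | P. admissible n P}"
    unfolding M_def using finite_gcd_pair_prods by (intro Max_in) auto
  with that show ?thesis by blast
qed

section \<open>The upper bound for M(n)\<close>

lemma card_small_cofactor_le:
  fixes P :: "nat set" and T :: real
  assumes "finite P" "\<And>p'. p' \<in> P \<Longrightarrow> p' \<ge> 2" "a > 0" "T \<ge> 0"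
  shows "real (card {p' \<in> P. real (p' - 1) \<le> T * real (gcd a (p' - 1))}) \<le> real (card {d. d dvd a}) * T"
proof -
  define E where "E = {p' \<in> P. real (p' - 1) \<le> T * real (gcd a (p' - 1))}"
  define h where "h p' = (gcd a (p' - 1), (p' - 1) div gcd a (p' - 1))" for p' :: nat
  \<comment> \<open>\<open>p'\<close> is recovered from the gcd and the cofactor, which leaves at
    most the divisors of \<open>a\<close> times the cofactors up to \<open>T\<close>.\<close>
  have "inj_on h E"
  proof (rule inj_onI)
    fix p q assume pq: "p \<in> E" "q \<in> E" "h p = h q"
    have "p - 1 = fst (h p) * snd (h p)" "q - 1 = fst (h q) * snd (h q)" by (simp_all add: h_def)
    with pq have "p - 1 = q - 1" by simp
    moreover have "p \<ge> 2" "q \<ge> 2" using pq assms(2) by (auto simp: E_def)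
    ultimately show "p = q" by simp
  qed
  moreover have "h ` E \<subseteq> {d. d dvd a} \<times> {1..nat \<lfloor>T\<rfloor>}"
  proof (rule image_subsetI)
    fix p' assume p: "p' \<in> E"
    define g where "g = gcd a (p' - 1)"
    define s where "s = (p' - 1) div g"
    have gs: "p' - 1 = g * s" by (simp add: g_def s_def)
    have g0: "g > 0" using assms(3) by (simp add: g_def)
    have "p' - 1 \<ge> 1" using p assms(2)[of p'] by (simp add: E_def)
    then have "s \<ge> 1" using gs by (cases s) auto
    have "real (p' - 1) \<le> T * real g" using p by (simp add: E_def g_def)
    then have "real g * real s \<le> T * real g" unfolding gs of_nat_mult .
    then have "real s \<le> T" using g0 by (simp add: mult.commute)
    then have "s \<le> nat \<lfloor>T\<rfloor>" by (rule le_nat_floor)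
    with \<open>s \<ge> 1\<close> show "h p' \<in> {d. d dvd a} \<times> {1..nat \<lfloor>T\<rfloor>}"
      unfolding h_def g_def[symmetric] s_def[symmetric] by (auto simp: g_def)
  qed
  ultimately have "card E \<le> card ({d. d dvd a} \<times> {1..nat \<lfloor>T\<rfloor>})"
    using assms(3) by (metis card_inj_on_le finite_SigmaI finite_atLeastAtMost finite_divisors_nat)
  then have "card E \<le> card {d. d dvd a} * nat \<lfloor>T\<rfloor>" by (simp add: card_cartesian_product)
  then have "real (card E) \<le> real (card {d. d dvd a} * nat \<lfloor>T\<rfloor>)" by (simp only: of_nat_le_iff)
  also have "\<dots> \<le> real (card {d. d dvd a}) * T"
    using assms(4) by (simp add: mult_left_mono)
  finally show ?thesis by (simp add: E_def)
qed

text \<open>For primes \<open>p, p'\<close> up to \<open>L powr (1 / \<delta>)\<close> the divisor bound makes cofactors \<open>(p' - 1) / gcd\<close> below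
  \<open>T = L powr (1 - 2 * \<delta>)\<close> rare. For all other pairs \<open>G = ln gcd\<close> satisfies \<open>G + ln T \<le> min (ln p) (ln p')\<close>,
  and \<open>4 * ln T * G \<le> (G + ln T)\<^sup>2 \<le> ln p * ln p'\<close>.\<close>

lemma sum_ln_gcd_upper_bound:
  fixes \<delta> :: real
  assumes \<delta>: "0 < \<delta>" "\<delta> \<le> 1 / 4"
  obtains C where "C \<ge> 1" "\<And>P L. \<lbrakk>finite P; \<And>p. p \<in> P \<Longrightarrow> prime p; (\<Sum>p\<in>P. ln (real p)) \<le> L; L \<ge> 3\<rbrakk> \<Longrightarrow>
    (\<Sum>p\<in>P. \<Sum>p'\<in>P. ln (real (gcd (p - 1) (p' - 1)))) \<le>
      L\<^sup>2 / (4 * (1 - 2 * \<delta>) * ln L) + 2 * \<delta> * L\<^sup>2 / ln L + 2 * C * L powr (2 - \<delta>)"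
proof -
  have "\<delta>\<^sup>2 > 0" using \<delta> by simp
  \<comment> \<open>With exponent \<open>\<delta>\<^sup>2\<close>, a prime \<open>p\<close> up to
    \<open>L powr (1 / \<delta>)\<close> has at most \<open>C * L powr \<delta>\<close> divisors of
    \<open>p - 1\<close>.\<close>
  then obtain C where C: "C \<ge> 1" "\<And>n. n > 0 \<Longrightarrow> real (card {d. d dvd n}) \<le> C * real n powr (\<delta>\<^sup>2)"
    using divisor_bound by blast
  show ?thesis
  proof (rule that[OF C(1)])
    fix P :: "nat set" and L :: real
    assume P: "finite P" "\<And>p. p \<in> P \<Longrightarrow> prime p" and sumL: "(\<Sum>p\<in>P. ln (real p)) \<le> L" and L3: "L \<ge> 3"
    have p2: "p \<ge> 2" if "p \<in> P" for p using P(2)[OF that] by (rule prime_ge_2_nat)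
    have lnp: "ln (real p) \<ge> 0" if "p \<in> P" for p using p2[OF that] by simp
    define G where "G p p' = ln (real (gcd (p - 1) (p' - 1)))" for p p' :: nat
    define l where "l = ln L"
    have l: "l > 0" using L3 by (simp add: l_def)
    \<comment> \<open>One \<delta> of the exponent is given up to the divisor count; the other
      survives as the saving in \<open>cardE\<close>.\<close>
    define T where "T = L powr (1 - 2 * \<delta>)"
    define c where "c = (1 - 2 * \<delta>) * l"
    have c: "c > 0" using \<delta> l by (simp add: c_def)
    have lnT: "ln T = c" using L3 by (simp add: T_def c_def l_def ln_powr)
    have T0: "T > 0" using L3 by (simp add: T_def)
    define big where "big p \<longleftrightarrow> l / \<delta> < ln (real p)" for p :: nat
    define E where "E p = {p' \<in> P. real (p' - 1) \<le> T * real (gcd (p - 1) (p' - 1))}" for p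
    \<comment> \<open>A pair with big \<open>p\<close> is charged \<open>ln p'\<close>, since there
      are at most \<open>\<delta> * L / l\<close> such \<open>p\<close>; an exceptional pair is
      charged \<open>ln p\<close>, since its partners \<open>E p\<close> are few. Either way the
      charged logarithms sum to at most \<open>L\<close>.\<close>
    define W1 where "W1 p p' = (if big p then ln (real p') else 0)" for p p' :: nat
    define W2 where "W2 p p' = (if \<not> big p \<and> p' \<in> E p then ln (real p) else 0)" for p p' :: nat
    have W0: "W1 p p' \<ge> 0" "W2 p p' \<ge> 0" if "p \<in> P" "p' \<in> P" for p p'
      using lnp that by (auto simp: W1_def W2_def)
    have G_le: "G p p' \<le> ln (real p)" "G p p' = G p' p" "G p p' \<ge> 0" if "p \<in> P" "p' \<in> P" for p p'
    proof -
      have "gcd (p - 1) (p' - 1) dvd p - 1" by simp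
      then have "gcd (p - 1) (p' - 1) \<le> p - 1" using p2[OF that(1)] by (intro dvd_imp_le) auto
      then have "gcd (p - 1) (p' - 1) \<le> p" by simp
      moreover have g0: "gcd (p - 1) (p' - 1) > 0" using p2[OF that(1)] by simp
      ultimately show "G p p' \<le> ln (real p)" unfolding G_def using p2[OF that(1)] by (subst ln_le_cancel_iff) auto
      show "G p p' = G p' p" by (simp add: G_def gcd.commute)
      show "G p p' \<ge> 0" unfolding G_def using g0 by (intro ln_ge_zero) linarith
    qed
    have pair: "G p p' \<le> ln (real p) * ln (real p') / (4 * c) + (W1 p p' + W1 p' p) + (W2 p p' + W2 p' p)"
      if pp: "p \<in> P" "p' \<in> P" for p p'
    proof -
      have sym: "p \<in> E p' \<longleftrightarrow> real (p - 1) \<le> T * real (gcd (p - 1) (p' - 1))"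
        using pp by (simp add: E_def gcd.commute)
      have main0: "ln (real p) * ln (real p') / (4 * c) \<ge> 0" using lnp pp c by simp
      consider "big p" | "big p'" | "\<not> big p" "p' \<in> E p" | "\<not> big p'" "p \<in> E p'" | "p' \<notin> E p" "p \<notin> E p'"
        by blast
      then show ?thesis
      proof cases
        case 1
        then have "G p p' \<le> W1 p p'" using G_le(1)[OF pp(2,1)] G_le(2)[OF pp] by (simp add: W1_def)
        then show ?thesis using main0 W0[OF pp] W0[OF pp(2,1)] by linarith
      next
        case 2
        then have "G p p' \<le> W1 p' p" using G_le(1)[OF pp] by (simp add: W1_def)
        then show ?thesis using main0 W0[OF pp] W0[OF pp(2,1)] by linarith
      next
        case 3
        then have "G p p' \<le> W2 p p'" using G_le(1)[OF pp] by (simp add: W2_def)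
        then show ?thesis using main0 W0[OF pp] W0[OF pp(2,1)] by linarith
      next
        case 4
        then have "G p p' \<le> W2 p' p" using G_le(1)[OF pp(2,1)] G_le(2)[OF pp] by (simp add: W2_def)
        then show ?thesis using main0 W0[OF pp] W0[OF pp(2,1)] by linarith
      next
        case 5
        have g0: "gcd (p - 1) (p' - 1) > 0" using p2[OF pp(1)] by simp
        have "T * real (gcd (p - 1) (p' - 1)) \<le> real p'" "T * real (gcd (p - 1) (p' - 1)) \<le> real p"
          using 5 pp p2[OF pp(1)] p2[OF pp(2)] unfolding sym by (auto simp: E_def)
        then have "ln (T * real (gcd (p - 1) (p' - 1))) \<le> ln (real p')" "ln (T * real (gcd (p - 1) (p' - 1))) \<le> ln (real p)"
          using T0 g0 p2[OF pp(1)] p2[OF pp(2)] by (auto intro!: ln_mono mult_pos_pos)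
        then have *: "G p p' + c \<le> ln (real p')" "G p p' + c \<le> ln (real p)"
          using T0 g0 by (simp_all add: ln_mult G_def lnT)
        have "4 * c * G p p' \<le> (G p p' + c)\<^sup>2"
          using zero_le_power2[of "G p p' - c"] by (simp add: power2_eq_square algebra_simps)
        also have "\<dots> \<le> ln (real p) * ln (real p')"
          unfolding power2_eq_square using * c G_le(3)[OF pp] by (intro mult_mono) auto
        finally have "G p p' \<le> ln (real p) * ln (real p') / (4 * c)" using c by (simp add: field_simps)
        then show ?thesis using W0[OF pp] W0[OF pp(2,1)] by linarith
      qed
    qed
    define s where "s = (\<Sum>p\<in>P. ln (real p))"
    have s: "0 \<le> s" "s \<le> L" using sumL lnp by (auto simp: s_def intro!: sum_nonneg)
    have W1: "(\<Sum>p\<in>P. \<Sum>p'\<in>P. W1 p p') \<le> \<delta> * L\<^sup>2 / l"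
    proof -
      define b where "b = real (card {p \<in> P. big p})"
      have "b * (l / \<delta>) = (\<Sum>p\<in>{p \<in> P. big p}. l / \<delta>)" by (simp add: b_def)
      also have "\<dots> \<le> (\<Sum>p\<in>{p \<in> P. big p}. ln (real p))" by (intro sum_mono) (auto simp: big_def)
      also have "\<dots> \<le> s" unfolding s_def using P(1) lnp by (intro sum_mono2) auto
      finally have "b * (l / \<delta>) \<le> L" using s by simp
      then have b: "b \<le> \<delta> * L / l" using l \<delta> by (simp add: field_simps)
      have "(\<Sum>p\<in>P. \<Sum>p'\<in>P. W1 p p') = (\<Sum>p\<in>P. if big p then s else 0)"
        by (intro sum.cong refl) (auto simp: W1_def s_def)
      also have "\<dots> = b * s" using P(1) by (simp add: b_def flip: sum.inter_filter)
      also have "\<dots> \<le> \<delta> * L / l * L" using b s l \<delta> L3 by (intro mult_mono) auto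
      finally show ?thesis by (simp add: power2_eq_square)
    qed
    have cardE: "real (card (E p)) \<le> C * L powr (1 - \<delta>)" if "p \<in> P" "\<not> big p" for p
    proof -
      have p1: "p - 1 > 0" using p2[OF that(1)] by simp
      have "real (card (E p)) \<le> real (card {d. d dvd (p - 1)}) * T"
        unfolding E_def using P(1) p2 p1 T0 by (intro card_small_cofactor_le) auto
      also have "\<dots> \<le> C * L powr \<delta> * T"
      proof (rule mult_right_mono)
        have "real (card {d. d dvd (p - 1)}) \<le> C * real (p - 1) powr (\<delta>\<^sup>2)" using p1 by (rule C(2))
        also have "\<dots> \<le> C * real p powr (\<delta>\<^sup>2)" using C(1) p1 by (intro mult_left_mono powr_mono2) auto
        also have "\<dots> \<le> C * L powr \<delta>"
        proof (rule mult_left_mono)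
          have "ln (real p) * \<delta> \<le> l" using that(2) \<delta> by (simp add: big_def not_less field_simps)
          then have "\<delta> * (ln (real p) * \<delta>) \<le> \<delta> * l" using \<delta> by (intro mult_left_mono) auto
          then show "real p powr (\<delta>\<^sup>2) \<le> L powr \<delta>"
            using L3 p1 by (simp add: powr_def l_def power2_eq_square mult_ac)
        qed (use C(1) in simp)
        finally show "real (card {d. d dvd (p - 1)}) \<le> C * L powr \<delta>" .
      qed (use T0 in simp)
      also have "\<dots> = C * L powr (1 - \<delta>)" by (simp add: T_def mult.assoc flip: powr_add)
      finally show ?thesis .
    qed
    have W2: "(\<Sum>p\<in>P. \<Sum>p'\<in>P. W2 p p') \<le> C * L powr (2 - \<delta>)"
    proof -
      have "(\<Sum>p\<in>P. \<Sum>p'\<in>P. W2 p p') \<le> (\<Sum>p\<in>P. C * L powr (1 - \<delta>) * ln (real p))"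
      proof (rule sum_mono)
        fix p assume p: "p \<in> P"
        show "(\<Sum>p'\<in>P. W2 p p') \<le> C * L powr (1 - \<delta>) * ln (real p)"
        proof (cases "big p")
          case True
          then show ?thesis using C(1) lnp[OF p] by (simp add: W2_def)
        next
          case False
          have "(\<Sum>p'\<in>P. W2 p p') = (\<Sum>p'\<in>E p. ln (real p))"
            using False P(1) by (intro sum.mono_neutral_cong_right) (auto simp: W2_def E_def)
          then show ?thesis using cardE[OF p False] lnp[OF p] by (simp add: mult_right_mono)
        qed
      qed
      also have "\<dots> = C * L powr (1 - \<delta>) * s" by (simp add: s_def sum_distrib_left)
      also have "\<dots> \<le> C * L powr (1 - \<delta>) * L powr 1" using C(1) s L3 by (intro mult_left_mono) auto
      also have "\<dots> = C * L powr (2 - \<delta>)" by (simp only: mult.assoc powr_add[symmetric]) simp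
      finally show ?thesis .
    qed
    have "(\<Sum>p\<in>P. \<Sum>p'\<in>P. G p p') \<le> (\<Sum>p\<in>P. \<Sum>p'\<in>P. ln (real p) * ln (real p') / (4 * c) + (W1 p p' + W1 p' p) + (W2 p p' + W2 p' p))"
      by (intro sum_mono pair)
    also have "\<dots> = s * s / (4 * c) + 2 * (\<Sum>p\<in>P. \<Sum>p'\<in>P. W1 p p') + 2 * (\<Sum>p\<in>P. \<Sum>p'\<in>P. W2 p p')"
      using sum.swap[of W1 P P] sum.swap[of W2 P P]
      by (simp add: sum.distrib s_def sum_product sum_divide_distrib)
    also have "s * s \<le> L * L" using s by (intro mult_mono) auto
    finally have "(\<Sum>p\<in>P. \<Sum>p'\<in>P. G p p') \<le> L * L / (4 * c) + 2 * (\<delta> * L\<^sup>2 / l) + 2 * (C * L powr (2 - \<delta>))"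
      using W1 W2 c by (simp add: divide_right_mono)
    then show "(\<Sum>p\<in>P. \<Sum>p'\<in>P. ln (real (gcd (p - 1) (p' - 1)))) \<le>
        L\<^sup>2 / (4 * (1 - 2 * \<delta>) * ln L) + 2 * \<delta> * L\<^sup>2 / ln L + 2 * C * L powr (2 - \<delta>)"
      unfolding G_def c_def l_def by (simp only: power2_eq_square mult.assoc times_divide_eq_right)
  qed
qed

lemma filterlim_ln_nat: "filterlim (\<lambda>n. ln (real n)) at_top at_top"
  by real_asymp

lemma eventually_M_upper:
  fixes \<epsilon> :: real
  assumes "\<epsilon> > 0"
  shows "\<forall>\<^sub>F n in at_top. ln (real (M n)) / lambda_fn n < 1 / 4 + \<epsilon>"
proof -
  \<comment> \<open>The main term loses at most one \<delta> and the big primes cost two, in all at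
    most \<open>3 * \<epsilon> / 8\<close>; the term with a power saving stays below
    \<open>\<epsilon> / 2\<close>.\<close>
  define \<delta> where "\<delta> = min (1 / 4) (\<epsilon> / 8)"
  have \<delta>: "0 < \<delta>" "\<delta> \<le> 1 / 4" "\<delta> \<le> \<epsilon> / 8" using assms by (auto simp: \<delta>_def)
  obtain C where C: "C \<ge> 1" "\<And>P L. \<lbrakk>finite P; \<And>p. p \<in> P \<Longrightarrow> prime p; (\<Sum>p\<in>P. ln (real p)) \<le> L; L \<ge> 3\<rbrakk> \<Longrightarrow>
    (\<Sum>p\<in>P. \<Sum>p'\<in>P. ln (real (gcd (p - 1) (p' - 1)))) \<le>
      L\<^sup>2 / (4 * (1 - 2 * \<delta>) * ln L) + 2 * \<delta> * L\<^sup>2 / ln L + 2 * C * L powr (2 - \<delta>)"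
    using sum_ln_gcd_upper_bound[OF \<delta>(1,2)] by blast
  have "((\<lambda>L. 2 * C * (ln L * L powr (- \<delta>))) \<longlongrightarrow> 2 * C * 0) at_top"
    using \<delta>(1) by (intro tendsto_mult tendsto_const) real_asymp
  then have "\<forall>\<^sub>F L in at_top. 2 * C * (ln L * L powr (- \<delta>)) < \<epsilon> / 2"
    using assms by (intro order_tendstoD) auto
  then have "\<forall>\<^sub>F n in at_top. 2 * C * (ln (ln (real n)) * ln (real n) powr (- \<delta>)) < \<epsilon> / 2"
    by (rule eventually_compose_filterlim[OF _ filterlim_ln_nat])
  moreover have "\<forall>\<^sub>F n in at_top. ln (real n) \<ge> 3" by real_asymp
  moreover have "\<forall>\<^sub>F n in at_top. (n::nat) \<ge> 1" by (rule eventually_ge_at_top)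
  ultimately show ?thesis
  proof eventually_elim
    case (elim n)
    define L where "L = ln (real n)"
    define l where "l = ln L"
    have L: "L \<ge> 3" using elim by (simp add: L_def)
    have l: "l > 0" using L by (simp add: l_def)
    obtain P where P: "admissible n P" "M n = gcd_pair_prod P" using M_attained[OF elim(3)] .
    have fp: "finite P" "\<And>p. p \<in> P \<Longrightarrow> prime p" using P(1) by (auto simp: admissible_def)
    have "ln (real (M n)) = (\<Sum>p\<in>P. \<Sum>p'\<in>P. ln (real (gcd (p - 1) (p' - 1))))"
      unfolding P(2) by (rule ln_gcd_pair_prod[OF fp])
    also have "\<dots> \<le> L\<^sup>2 / (4 * (1 - 2 * \<delta>) * l) + 2 * \<delta> * L\<^sup>2 / l + 2 * C * L powr (2 - \<delta>)"
      unfolding l_def by (intro C(2) fp L sum_ln_admissible[OF P(1) elim(3), folded L_def])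
    also have "L powr (2 - \<delta>) = L\<^sup>2 / l * (l * L powr (- \<delta>))"
    proof -
      have "L powr (2 - \<delta>) = L powr 2 * L powr (- \<delta>)" by (simp flip: powr_add)
      also have "L powr 2 = L\<^sup>2" using L by simp
      finally show ?thesis using l by simp
    qed
    also have "L\<^sup>2 / (4 * (1 - 2 * \<delta>) * l) + 2 * \<delta> * L\<^sup>2 / l + 2 * C * (L\<^sup>2 / l * (l * L powr (- \<delta>))) =
        L\<^sup>2 / l * (1 / (4 * (1 - 2 * \<delta>)) + 2 * \<delta> + 2 * C * (l * L powr (- \<delta>)))"
      by (simp add: distrib_left mult_ac)
    also have "\<dots> < L\<^sup>2 / l * (1 / 4 + \<epsilon>)"
    proof (rule mult_strict_left_mono)
      have "1 / (4 * (1 - 2 * \<delta>)) \<le> 1 / 4 + \<delta>"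
      proof -
        have "\<delta> * \<delta> \<le> \<delta> * (1 / 4)" using \<delta> by (intro mult_left_mono) auto
        then have "1 \<le> (1 / 4 + \<delta>) * (4 * (1 - 2 * \<delta>))" by (simp add: algebra_simps)
        then show ?thesis using \<delta> by (simp add: pos_divide_le_eq)
      qed
      moreover have "2 * C * (l * L powr (- \<delta>)) < \<epsilon> / 2" using elim(1) by (simp add: l_def L_def)
      moreover have "A + 2 * \<delta> + B < 1 / 4 + \<epsilon>" if "A \<le> 1 / 4 + \<delta>" "B < \<epsilon> / 2" for A B :: real
        using that \<delta> by simp
      ultimately show "1 / (4 * (1 - 2 * \<delta>)) + 2 * \<delta> + 2 * C * (l * L powr (- \<delta>)) < 1 / 4 + \<epsilon>"
        by blast
    qed (use L l in auto)
    finally show ?case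
      using L l unfolding lambda_fn_def L_def[symmetric] l_def[symmetric] by (simp add: field_simps)
  qed
qed

section \<open>The lower bound for M(n)\<close>

lemma gcd_pair_prod_common_modulus:
  assumes "finite P" "\<And>p. p \<in> P \<Longrightarrow> prime p" "\<And>p. p \<in> P \<Longrightarrow> p mod q = 1" "q \<ge> 1"
  shows "(real (card P))\<^sup>2 * ln (real q) \<le> ln (real (gcd_pair_prod P))"
proof -
  have "(real (card P))\<^sup>2 * ln (real q) = (\<Sum>p\<in>P. \<Sum>p'\<in>P. ln (real q))" by (simp add: power2_eq_square)
  also have "\<dots> \<le> (\<Sum>p\<in>P. \<Sum>p'\<in>P. ln (real (gcd (p - 1) (p' - 1))))"
  proof (intro sum_mono)
    fix p p' assume pp: "p \<in> P" "p' \<in> P"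
    have d: "q dvd p - 1" if "p \<in> P" for p
      using assms(3)[OF that] by (metis dvd_minus_mod)
    then have "q dvd gcd (p - 1) (p' - 1)" using pp by simp
    moreover have g0: "gcd (p - 1) (p' - 1) > 0" using prime_gt_1_nat[OF assms(2)[OF pp(1)]] by simp
    ultimately have "q \<le> gcd (p - 1) (p' - 1)" by (rule dvd_imp_le)
    then show "ln (real q) \<le> ln (real (gcd (p - 1) (p' - 1)))"
      using assms(4) g0 by (subst ln_le_cancel_iff) auto
  qed
  also have "\<dots> = ln (real (gcd_pair_prod P))" by (rule ln_gcd_pair_prod[OF assms(1,2), symmetric])
  finally show ?thesis .
qed

text \<open>About \<open>L / (c * ln L)\<close> primes of size at most \<open>L powr c\<close>, all
  congruent to 1 modulo one prime \<open>q\<close> of size \<open>L\<close> up to logarithms, have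
  product at most \<open>n\<close>. The square of their number times \<open>ln q\<close> is about
  \<open>L\<^sup>2 / (c\<^sup>2 * ln L)\<close>, hence the threshold for \<gamma>.\<close>

lemma eventually_M_lower:
  fixes k :: nat and \<gamma> :: real
  assumes k: "k \<ge> 2" and \<gamma>: "\<gamma> < (1 / (2 + 1 / real k))\<^sup>2"
  shows "\<forall>\<^sub>F n in at_top. \<gamma> < ln (real (M n)) / lambda_fn n"
proof -
  define c where "c = 2 + 1 / real k"
  have c: "c > 0" by (simp add: c_def add_pos_nonneg)
  \<comment> \<open>\<open>h L * (L\<^sup>2 / ln L)\<close> is the explicit lower bound reached
    below: the square reflects the rounded number of primes, the other factor the losses in
    \<open>ln q\<close>.\<close>
  define h where "h L = (1 / c - ln L / L)\<^sup>2 * (1 - real k * ln 2 * (1 / ln L) - ln (8 * ln L) / ln L)" for L :: real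
  have "(h \<longlongrightarrow> (1 / c - 0)\<^sup>2 * (1 - real k * ln 2 * 0 - 0)) at_top"
    unfolding h_def by (intro tendsto_mult tendsto_power tendsto_diff tendsto_const; real_asymp)
  then have "\<forall>\<^sub>F L in at_top. \<gamma> < h L" using \<gamma> by (intro order_tendstoD) (auto simp: c_def)
  then have ev_h: "\<forall>\<^sub>F n in at_top. \<gamma> < h (ln (real n))"
    by (rule eventually_compose_filterlim[OF _ filterlim_ln_nat])
  \<comment> \<open>The integer root of \<open>L\<close>: from
    \<open>t ^ k \<le> L \<le> (t + 1) ^ k\<close> the moduli have size about \<open>L\<close>, and
    \<open>(t + 1) ^ k\<close> primes are enough to choose \<open>j \<le> L\<close> of them.\<close>
  define t where "t n = nat \<lfloor>ln (real n) powr (1 / real k)\<rfloor>" for n :: nat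
  have "filterlim t at_top at_top"
    unfolding t_def using k
    by (intro filterlim_compose[OF filterlim_nat_sequentially] filterlim_compose[OF filterlim_floor_sequentially]) real_asymp
  then have ev_t: "\<forall>\<^sub>F n in at_top. t n \<ge> 3 \<and> (\<exists>q. prime q \<and> real (t n ^ k) / (8 * ln (real (t n ^ k))) \<le> real q \<and> q \<le> t n ^ k \<and>
      (t n + 1) ^ k \<le> card {p. prime p \<and> p \<le> t n ^ (2 * k + 1) \<and> p mod q = 1})"
    using k by (intro eventually_compose_filterlim[OF eventually_conj[OF eventually_ge_at_top primes_in_progression_large_modulus]])
  have ev_pos: "\<forall>\<^sub>F n in at_top. ln (ln (real n)) / ln (real n) < 1 / c \<and> ln (ln (real n)) > 1"
  proof (rule eventually_conj)
    have "((\<lambda>n. ln (ln (real n)) / ln (real n)) \<longlongrightarrow> 0) at_top" by real_asymp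
    then show "\<forall>\<^sub>F n in at_top. ln (ln (real n)) / ln (real n) < 1 / c" using c by (intro order_tendstoD) auto
    show "\<forall>\<^sub>F n in at_top. ln (ln (real n)) > 1" by real_asymp
  qed
  have ev_L: "\<forall>\<^sub>F n in at_top. ln (real n) > 3" by real_asymp
  have ev_n: "\<forall>\<^sub>F n in at_top. (n::nat) \<ge> 1" by (rule eventually_ge_at_top)
  show ?thesis
    using ev_h ev_t ev_pos ev_L ev_n
  proof eventually_elim
    case (elim n)
    define L where "L = ln (real n)"
    define l where "l = ln L"
    define s where "s = t n"
    define x where "x = s ^ (2 * k + 1)"
    obtain q where q: "prime q" "real (s ^ k) / (8 * ln (real (s ^ k))) \<le> real q"
      and many: "(s + 1) ^ k \<le> card {p. prime p \<and> p \<le> x \<and> p mod q = 1}"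
      using elim(2) unfolding s_def x_def by blast
    have s3: "s \<ge> 3" using elim(2) by (simp add: s_def)
    have L: "L > 3" "l > 1" "l / L < 1 / c" using elim by (auto simp: L_def l_def)
    have k0: "real k > 0" using k by simp
    have Lroot: "(L powr (1 / real k)) ^ k = L"
      using L k0 by (simp add: powr_powr flip: powr_realpow)
    have "real s \<le> L powr (1 / real k)" unfolding s_def t_def L_def[symmetric] by simp
    then have "real s ^ k \<le> L" using Lroot by (metis power_mono of_nat_0_le_iff)
    then have sL: "real k * ln (real s) \<le> l"
      using s3 L unfolding l_def by (subst ln_realpow[symmetric]) (auto intro!: ln_mono)
    have "L powr (1 / real k) \<le> real s + 1" unfolding s_def t_def L_def[symmetric] by linarith
    then have Ls: "L \<le> (real s + 1) ^ k" using Lroot by (metis power_mono powr_ge_zero)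
    have "l \<le> real k * ln (2 * real s)"
    proof -
      have "(real s + 1) ^ k \<le> (2 * real s) ^ k" using s3 by (intro power_mono) auto
      with Ls have "L \<le> (2 * real s) ^ k" by linarith
      then have "l \<le> ln ((2 * real s) ^ k)" unfolding l_def using L by (intro ln_mono) auto
      then show ?thesis by (simp only: ln_realpow)
    qed
    then have ls: "l - real k * ln 2 \<le> real k * ln (real s)" using s3 by (simp add: ln_mult algebra_simps)
    have lns: "ln (real s) \<ge> 1"
    proof -
      have "exp 1 \<le> real s" using exp_le s3 by linarith
      then show ?thesis using s3 by (subst ln_ge_iff) auto
    qed
    have lnx: "ln (real x) = real (2 * k + 1) * ln (real s)"
      unfolding x_def of_nat_power by (rule ln_realpow)
    have lnx1: "ln (real x) \<ge> 1"
      using mult_mono[of 1 "real (2 * k + 1)" 1 "ln (real s)"] lns unfolding lnx by simp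
    have "ln (real x) = c * (real k * ln (real s))"
      unfolding lnx c_def using k0 by (simp add: field_simps)
    also have "\<dots> \<le> c * l" using sL c by (intro mult_left_mono) auto
    finally have lnx_le: "ln (real x) \<le> c * l" .
    \<comment> \<open>As many primes up to \<open>x\<close> as are sure to have a product of at most
      \<open>exp L = n\<close>.\<close>
    define j where "j = nat \<lfloor>L / ln (real x)\<rfloor>"
    have j_le: "real j \<le> L / ln (real x)" unfolding j_def using L lnx1 by simp
    have "L / ln (real x) \<ge> L / (c * l)" using lnx_le lnx1 L by (intro divide_left_mono) auto
    then have j_ge: "L / (c * l) - 1 \<le> real j" unfolding j_def by linarith
    have "L / ln (real x) \<le> L / 1" using lnx1 L by (intro divide_left_mono) auto
    then have "real j \<le> L" using j_le by simp
    then have "real j \<le> real ((s + 1) ^ k)" using Ls by (simp add: add.commute)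
    then have "j \<le> (s + 1) ^ k" by (simp only: of_nat_le_iff)
    with many have "j \<le> card {p. prime p \<and> p \<le> x \<and> p mod q = 1}" by simp
    then obtain P where P: "P \<subseteq> {p. prime p \<and> p \<le> x \<and> p mod q = 1}" "card P = j" "finite P"
      by (rule obtain_subset_with_card_n)
    have "x \<ge> 1" using s3 by (simp add: x_def)
    then have "real (\<Prod>P) \<le> real x ^ j"
      unfolding of_nat_prod P(2)[symmetric] using P(1) by (intro prod_le_power) (auto dest: prime_gt_0_nat)
    also have "\<dots> = exp (real j * ln (real x))"
      using s3 by (simp add: exp_of_nat_mult x_def)
    also have "\<dots> \<le> exp L" using j_le lnx1 by (simp add: field_simps)
    also have "\<dots> = real n" using elim(5) by (simp add: L_def)
    finally have "\<Prod>P \<le> n" by (simp only: of_nat_le_iff)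
    then have adm: "admissible n P" using P by (auto simp: admissible_def)
    have q1: "q \<ge> 1" using q(1) by (simp add: Suc_le_eq prime_gt_0_nat)
    have lnq: "l - real k * ln 2 - ln (8 * l) \<le> ln (real q)"
    proof -
      have lk: "ln (real (s ^ k)) = real k * ln (real s)" unfolding of_nat_power by (rule ln_realpow)
      have pos: "real k * ln (real s) > 0" using k0 lns by simp
      have "l - real k * ln 2 - ln (8 * l) \<le> real k * ln (real s) - ln (8 * (real k * ln (real s)))"
        using ls sL pos by (intro diff_mono ln_mono) auto
      also have "\<dots> = ln (real (s ^ k) / (8 * ln (real (s ^ k))))"
        using s3 pos lk by (subst ln_div) auto
      also have "\<dots> \<le> ln (real q)" using q(2) s3 pos unfolding lk by (intro ln_mono) auto
      finally show ?thesis .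
    qed
    have jsq: "(L / (c * l) - 1)\<^sup>2 \<le> (real j)\<^sup>2"
    proof (intro power_mono j_ge)
      have "l / L * (c * L) < 1 / c * (c * L)" using L c by (intro mult_strict_right_mono) auto
      then have "c * l < L" using L c by (simp add: mult.commute)
      then show "0 \<le> L / (c * l) - 1" using c L by simp
    qed
    have "h L * (L\<^sup>2 / l) = (L / (c * l) - 1)\<^sup>2 * (l - real k * ln 2 - ln (8 * l))"
    proof -
      have "(1 / c - l / L) * L = (L / (c * l) - 1) * l" using L c by (simp add: field_simps)
      then have "(1 / c - l / L)\<^sup>2 * L\<^sup>2 = (L / (c * l) - 1)\<^sup>2 * l\<^sup>2"
        by (simp only: power_mult_distrib[symmetric])
      moreover have "l * (1 - real k * ln 2 * (1 / l) - ln (8 * l) / l) = l - real k * ln 2 - ln (8 * l)"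
        using L by (simp add: algebra_simps)
      moreover have "A * B * (W / l) = A' * E" if "A * W = A' * l\<^sup>2" "l * B = E" for A A' B W E :: real
      proof -
        have "A * B * (W / l) = A * W * B / l" by simp
        also have "\<dots> = A' * E" unfolding that(1) that(2)[symmetric] using L by (simp add: power2_eq_square)
        finally show ?thesis .
      qed
      ultimately show ?thesis unfolding h_def l_def[symmetric] by blast
    qed
    also have "\<dots> \<le> (L / (c * l) - 1)\<^sup>2 * ln (real q)" using lnq by (intro mult_left_mono) auto
    also have "\<dots> \<le> (real j)\<^sup>2 * ln (real q)" using jsq q1 by (intro mult_right_mono) auto
    also have "\<dots> \<le> ln (real (gcd_pair_prod P))"
      using gcd_pair_prod_common_modulus[of P q] P q1 by auto
    also have "\<dots> \<le> ln (real (M n))"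
    proof (rule ln_mono)
      show "real (gcd_pair_prod P) \<le> real (M n)" using gcd_pair_prod_le_M[OF adm] by simp
      have "gcd_pair_prod P > 0"
        unfolding gcd_pair_prod_def
      proof (rule prod_pos)
        fix z assume "z \<in> P \<times> P"
        then obtain p p' where z: "z = (p, p')" "p \<in> P" by auto
        then have "prime p" using P(1) by auto
        then have "p > 1" by (rule prime_gt_1_nat)
        then show "0 < (case z of (p, p') \<Rightarrow> gcd (p - 1) (p' - 1))" by (simp add: z(1))
      qed
      then show "0 < real (gcd_pair_prod P)" by simp
    qed
    finally have "h L * (L\<^sup>2 / l) \<le> ln (real (M n))" .
    then have "h L \<le> ln (real (M n)) / lambda_fn n"
      using L unfolding lambda_fn_def L_def[symmetric] l_def[symmetric] by (simp add: field_simps)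
    then show ?case using elim(1) unfolding L_def[symmetric] by linarith
  qed
qed

theorem theorem9:
  shows "(\<lambda>n. ln (real (M n)) / lambda_fn n) \<longlonglongrightarrow> 1/4"
proof (rule order_tendstoI)
  fix \<gamma> :: real assume "\<gamma> < 1 / 4"
  \<comment> \<open>The spare power makes the exponent \<open>2 + 1 / k\<close> instead of 2; with
    \<open>k\<close> fixed before \<open>n\<close> grows, large \<open>k\<close> reaches every value
    below \<open>1 / 4\<close>.\<close>
  have "(\<lambda>k. (1 / (2 + 1 / real k))\<^sup>2) \<longlonglongrightarrow> (1 / 2)\<^sup>2"
    by (intro tendsto_power) real_asymp
  also have "(1 / 2 :: real)\<^sup>2 = 1 / 4" by (simp add: power2_eq_square)
  finally have "(\<lambda>k. (1 / (2 + 1 / real k))\<^sup>2) \<longlonglongrightarrow> 1 / 4" .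
  from order_tendstoD(1)[OF this \<open>\<gamma> < 1 / 4\<close>] have "\<forall>\<^sub>F k in at_top. \<gamma> < (1 / (2 + 1 / real k))\<^sup>2 \<and> k \<ge> 2"
    by (intro eventually_conj eventually_ge_at_top)
  then obtain k where "\<gamma> < (1 / (2 + 1 / real k))\<^sup>2" "k \<ge> 2" by (auto dest: eventually_happens)
  then show "\<forall>\<^sub>F n in sequentially. \<gamma> < ln (real (M n)) / lambda_fn n" by (intro eventually_M_lower)
next
  fix \<gamma> :: real assume "1 / 4 < \<gamma>"
  then show "\<forall>\<^sub>F n in sequentially. ln (real (M n)) / lambda_fn n < \<gamma>"
    using eventually_M_upper[of "\<gamma> - 1 / 4"] by simp
qed

end
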